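(* There is a Type-2 Turing machine which, given a total-information name of a nonempty closed set $F\subseteq\mathbb{R}^n$, outputs a name of a family $\mathcal{F}\subseteq\mathcal{M}$ of dyadic cubes such that (C1) $\bigcup_{Q\in\mathcal{F}}Q=\mathbb{R}^n\setminus F$; (C2) any two distinct cubes of $\mathcal{F}$ have disjoint interiors; (C3) for every $Q\in\mathcal{F}$, $\frac12\operatorname{diam}(Q)<d(Q,F)<5\operatorname{diam}(Q)$. (That is, the multi-valued function $\mathrm{CUBE}$, sending $F$ to the set of such families, is computable.)
   Context: For $k\in\mathbb{Z}$, $\mathcal{M}_k$ is the set of closed cubes in $\mathbb{R}^n$ with edges parallel to the coordinate axes, edge length $2^{-k}$, and vertices whose coordinates are integer multiples of $2^{-k}$; $\mathcal{M}=\bigcup_{k\in\mathbb{Z}}\mathcal{M}_k$. A cube $Q\in\mathcal{M}_k$ is coded by the pair $(k,c_Q)$ with $c_Q\in\mathbb{Q}^n$ its center; fix a computable bijection $\rho:\mathbb{Z}\times\mathbb{Q}^n\to\mathbb{N}$. A name of a family $\mathcal{G}\subseteq\mathcal{M}$ is a function $p:\mathbb{N}\to\{0,1\}$ with $p(\rho(k,c_Q))=1$ iff $Q\in\mathcal{G}$ (for $Q\in\mathcal{M}_k$). A total-information name of a closed $F$ is a pair consisting of an enumeration of rational open balls (centers in $\mathbb{Q}^n$, rational radii $\ge0$) whose union is $\mathbb{R}^n\setminus F$ and an enumeration of exactly those rational open balls meeting $F$. $d$ is the Euclidean distance and $d(A,B)=\inf\{d(a,b):a\in A,b\in B\}$.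 *)

theory Defs
  imports "HOL-Analysis.Analysis" "HOL-Library.Nat_Bijection" "HOL-Library.Countable_Set"
begin

section \<open>Type-2 Turing machines\<close>

text \<open>
  Machines have finitely many one-way read-only input tapes, finitely many two-way work tapes and
  one one-way write-only output tape. The input and output alphabet consists of the letters
  \<open>0\<close> and \<open>1\<close>, the symbol \<open>2\<close> is the blank, and the work tapes may use further
  symbols below \<open>num_symbols\<close>.
\<close>

type_synonym symbol = nat

abbreviation (input) blank :: symbol where "blank \<equiv> 2"

datatype direction = Left | Stay | Right

fun shift :: "direction \<Rightarrow> int" where
  "shift Left = -1"
| "shift Stay = 0"
| "shift Right = 1"

text \<open>
  The transition function gets the state and the symbols under the input heads and under the work
  heads. Its result \<open>None\<close> means halting. Otherwise it gives the next state, the input heads that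
  move one cell to the right, the symbol written and the move made on each work tape, and the letter
  (if any) appended to the output tape.
\<close>

record machine =
  num_states :: nat
  num_symbols :: nat
  num_inputs :: nat
  num_works :: nat
  delta :: "nat \<Rightarrow> symbol list \<Rightarrow> symbol list \<Rightarrow>
    (nat \<times> bool list \<times> (symbol \<times> direction) list \<times> symbol option) option"

definition type2_machine :: "machine \<Rightarrow> bool" where
  "type2_machine M \<longleftrightarrow> 0 < num_states M \<and> blank < num_symbols M \<and>
    (\<forall>q as bs q' adv acts out.
       q < num_states M \<and>
       length as = num_inputs M \<and> set as \<subseteq> {..<num_symbols M} \<and>
       length bs = num_works M \<and> set bs \<subseteq> {..<num_symbols M} \<and>
       delta M q as bs = Some (q', adv, acts, out) \<longrightarrow>
       q' < num_states M \<and>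
       length adv = num_inputs M \<and>
       length acts = num_works M \<and> fst ` set acts \<subseteq> {..<num_symbols M} \<and>
       set_option out \<subseteq> {0, 1})"

record config =
  state :: nat
  in_heads :: "nat list"
  works :: "((int \<Rightarrow> symbol) \<times> int) list"
  written :: "symbol list"

definition init_config :: "machine \<Rightarrow> config" where
  "init_config M =
    \<lparr>state = 0, in_heads = replicate (num_inputs M) 0,
     works = replicate (num_works M) (\<lambda>_. blank, 0), written = []\<rparr>"

definition step :: "machine \<Rightarrow> (nat \<Rightarrow> symbol) list \<Rightarrow> config \<Rightarrow> config option" where
  "step M xs c =
    (case delta M (state c) (map2 (\<lambda>x h. x h) xs (in_heads c)) (map (\<lambda>(t, h). t h) (works c)) of
       None \<Rightarrow> None
     | Some (q, adv, acts, out) \<Rightarrow> Some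
         \<lparr>state = q,
          in_heads = map2 (\<lambda>h b. if b then Suc h else h) (in_heads c) adv,
          works = map2 (\<lambda>(t, h) (a, d). (t(h := a), h + shift d)) (works c) acts,
          written = written c @ (case out of None \<Rightarrow> [] | Some a \<Rightarrow> [a])\<rparr>)"

text \<open>The configuration after \<open>t\<close> steps; it remains unchanged once the machine has halted.\<close>

fun run :: "machine \<Rightarrow> (nat \<Rightarrow> symbol) list \<Rightarrow> nat \<Rightarrow> config" where
  "run M xs 0 = init_config M"
| "run M xs (Suc t) = (case step M xs (run M xs t) of None \<Rightarrow> run M xs t | Some c \<Rightarrow> c)"

definition outputs_word :: "machine \<Rightarrow> (nat \<Rightarrow> symbol) list \<Rightarrow> symbol list \<Rightarrow> bool" where
  "outputs_word M xs w \<longleftrightarrow> (\<exists>t. step M xs (run M xs t) = None \<and> written (run M xs t) = w)"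

text \<open>The output tape is never rewritten, so this determines the infinite output word.\<close>

definition outputs_sequence :: "machine \<Rightarrow> (nat \<Rightarrow> symbol) list \<Rightarrow> (nat \<Rightarrow> symbol) \<Rightarrow> bool" where
  "outputs_sequence M xs p \<longleftrightarrow>
    (\<forall>j. \<exists>t. j < length (written (run M xs t)) \<and> written (run M xs t) ! j = p j)"

definition word_tape :: "symbol list \<Rightarrow> nat \<Rightarrow> symbol" where
  "word_tape w i = (if i < length w then w ! i else blank)"

text \<open>
  A sequence \<open>f\<close> of natural numbers is written on an input tape as the infinite word
  \<open>1\<^sup>f\<^sup>(\<^sup>0\<^sup>) 0 1\<^sup>f\<^sup>(\<^sup>1\<^sup>) 0 1\<^sup>f\<^sup>(\<^sup>2\<^sup>) 0 \<dots>\<close>;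
  its \<open>k\<close>-th letter \<open>0\<close> is at position \<open>f 0 + \<dots> + f k + k\<close>.
\<close>

definition sequence_tape :: "(nat \<Rightarrow> nat) \<Rightarrow> nat \<Rightarrow> symbol" where
  "sequence_tape f i = (if \<exists>k. i = (\<Sum>j\<le>k. f j) + k then 0 else 1)"

definition computable_nat_fun :: "(nat \<Rightarrow> nat) \<Rightarrow> bool" where
  "computable_nat_fun f \<longleftrightarrow>
    (\<exists>M. type2_machine M \<and> num_inputs M = 1 \<and>
      (\<forall>e. outputs_word M [word_tape (replicate e 1)] (replicate (f e) 1)))"


section \<open>Numberings of rational points and rational balls\<close>

definition rat_of_code :: "nat \<Rightarrow> rat" where
  "rat_of_code e = (let (a, b) = prod_decode e in of_int (int_decode a) / of_nat (Suc b))"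

definition nonneg_rat_of_code :: "nat \<Rightarrow> rat" where
  "nonneg_rat_of_code e = (let (a, b) = prod_decode e in of_nat a / of_nat (Suc b))"

text \<open>The number \<open>\<langle>e\<^sub>0, \<langle>e\<^sub>1, \<langle>e\<^sub>2, \<dots>\<rangle>\<rangle>\<rangle>\<close> has the components \<open>e\<^sub>0, e\<^sub>1, e\<^sub>2, \<dots>\<close>.\<close>

fun component :: "nat \<Rightarrow> nat \<Rightarrow> nat" where
  "component 0 e = fst (prod_decode e)"
| "component (Suc j) e = component j (snd (prod_decode e))"

text \<open>The function \<^term>\<open>to_nat_on (UNIV :: 'n::finite set)\<close> numbers the coordinates from 0 on.\<close>

definition rat_vec_of_code :: "nat \<Rightarrow> rat ^ 'n" where
  "rat_vec_of_code e = (\<chi> i. rat_of_code (component (to_nat_on (UNIV :: 'n set) i) e))"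

definition real_vec :: "rat ^ 'n \<Rightarrow> real ^ 'n" where
  "real_vec c = (\<chi> i. of_rat (c $ i))"

definition rational_balls :: "(real ^ 'n) set set" where
  "rational_balls = {ball (real_vec c) (of_rat r) | c r. 0 \<le> r}"

definition ball_of_code :: "nat \<Rightarrow> (real ^ 'n) set" where
  "ball_of_code e =
    (let (a, b) = prod_decode e in ball (real_vec (rat_vec_of_code a)) (of_rat (nonneg_rat_of_code b)))"

definition level_point_of_code :: "nat \<Rightarrow> int \<times> (rat ^ 'n)" where
  "level_point_of_code e = (let (a, b) = prod_decode e in (int_decode a, rat_vec_of_code b))"

text \<open>
  Since the numbering below is onto, the inverse of such a bijection is computable as well, by search.
\<close>

definition computable_bijection :: "(int \<times> (rat ^ 'n) \<Rightarrow> nat) \<Rightarrow> bool" where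
  "computable_bijection \<rho> \<longleftrightarrow> bij \<rho> \<and> computable_nat_fun (\<lambda>e. \<rho> (level_point_of_code e))"

lemma surj_rat_of_code: "surj rat_of_code"
proof -
  have "\<exists>e. q = rat_of_code e" for q
  proof -
    obtain n d where "quotient_of q = (n, d)" by fastforce
    then have q: "q = of_int n / of_int d" and d: "d > 0"
      by (simp_all add: quotient_of_div quotient_of_denom_pos)
    obtain b where "d = int (Suc b)" using d zero_less_imp_eq_int gr0_implies_Suc by metis
    then have "q = rat_of_code (prod_encode (int_encode n, b))" by (simp add: q rat_of_code_def)
    then show ?thesis ..
  qed
  then show ?thesis unfolding surj_def by blast
qed

lemma nonneg_rat_of_code_nonneg: "0 \<le> nonneg_rat_of_code e"
  by (simp add: nonneg_rat_of_code_def split: prod.split)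

lemma range_nonneg_rat_of_code: "range nonneg_rat_of_code = {r. 0 \<le> r}"
proof (intro equalityI subsetI)
  fix q :: rat assume "q \<in> {r. 0 \<le> r}"
  then have nonneg: "0 \<le> q" by simp
  obtain n d where "quotient_of q = (n, d)" by fastforce
  then have q: "q = of_int n / of_int d" and d: "d > 0"
    by (simp_all add: quotient_of_div quotient_of_denom_pos)
  obtain b where b: "d = int (Suc b)" using d zero_less_imp_eq_int gr0_implies_Suc by metis
  have "0 \<le> n" using nonneg d unfolding q by (simp add: zero_le_divide_iff)
  then obtain a where "n = int a" using nonneg_int_cases by blast
  then have "q = nonneg_rat_of_code (prod_encode (a, b))" by (simp add: q b nonneg_rat_of_code_def)
  then show "q \<in> range nonneg_rat_of_code" by blast
qed (auto simp: nonneg_rat_of_code_nonneg)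

lemma ex_component: "\<exists>e. \<forall>j<n. component j e = f j"
proof (induction n arbitrary: f)
  case (Suc n)
  obtain e where e: "\<forall>j<n. component j e = f (Suc j)"
    using Suc.IH[of "\<lambda>j. f (Suc j)"] by blast
  have "component j (prod_encode (f 0, e)) = f j" if "j < Suc n" for j
    using that e by (cases j) auto
  then show ?case by blast
qed simp

lemma surj_rat_vec_of_code: "surj (rat_vec_of_code :: nat \<Rightarrow> rat ^ 'n)"
proof -
  have "\<exists>e. c = rat_vec_of_code e" for c :: "rat ^ 'n"
  proof -
    let ?t = "to_nat_on (UNIV :: 'n set)"
    let ?g = "inv rat_of_code"
    have g: "rat_of_code (?g q) = q" for q
      using surj_rat_of_code by (rule surj_f_inv_f)
    obtain e where e: "\<forall>j<card (UNIV :: 'n set). component j e = ?g (c $ inv ?t j)"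
      using ex_component[of _ "\<lambda>j. ?g (c $ inv ?t j)"] by blast
    have "bij_betw ?t UNIV {..<card (UNIV :: 'n set)}"
      by (rule to_nat_on_finite) simp
    then have "?t i < card (UNIV :: 'n set)" "inv ?t (?t i) = i" for i
      by (auto simp: bij_betw_def)
    then have "c = rat_vec_of_code e" using e g by (simp add: rat_vec_of_code_def vec_eq_iff)
    then show ?thesis ..
  qed
  then show ?thesis unfolding surj_def by blast
qed

lemma range_ball_of_code: "range ball_of_code = (rational_balls :: (real ^ 'n) set set)"
proof (intro equalityI subsetI)
  fix B :: "(real ^ 'n) set" assume "B \<in> rational_balls"
  then obtain c :: "rat ^ 'n" and r where B: "B = ball (real_vec c) (of_rat r)" "0 \<le> r"
    by (auto simp: rational_balls_def)
  obtain a where a: "c = rat_vec_of_code a" using surjD[OF surj_rat_vec_of_code] by blast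
  obtain b where b: "r = nonneg_rat_of_code b"
    using B(2) range_nonneg_rat_of_code by blast
  have "B = ball_of_code (prod_encode (a, b))" by (simp add: B a b ball_of_code_def)
  then show "B \<in> range ball_of_code" by blast
next
  fix B :: "(real ^ 'n) set" assume "B \<in> range ball_of_code"
  then obtain a b where "B = ball (real_vec (rat_vec_of_code a)) (of_rat (nonneg_rat_of_code b))"
    by (auto simp: ball_of_code_def case_prod_beta)
  then show "B \<in> rational_balls"
    using nonneg_rat_of_code_nonneg unfolding rational_balls_def by blast
qed

lemma surj_level_point_of_code: "surj (level_point_of_code :: nat \<Rightarrow> int \<times> (rat ^ 'n))"
proof -
  have "\<exists>e. (k, c) = level_point_of_code e" for k and c :: "rat ^ 'n"
  proof -
    obtain b where b: "c = rat_vec_of_code b" using surjD[OF surj_rat_vec_of_code] by blast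
    then have "(k, c) = level_point_of_code (prod_encode (int_encode k, b))"
      by (simp add: level_point_of_code_def)
    then show ?thesis ..
  qed
  then show ?thesis unfolding surj_def by (simp add: split_paired_all)
qed


section \<open>Names of closed sets and of families of dyadic cubes\<close>

definition total_information_name :: "(real ^ 'n) set \<Rightarrow> (nat \<Rightarrow> nat) \<times> (nat \<Rightarrow> nat) \<Rightarrow> bool" where
  "total_information_name F = (\<lambda>(u, v).
    (\<Union>i. ball_of_code (u i)) = - F \<and>
    range (\<lambda>i. ball_of_code (v i)) = {B \<in> rational_balls. B \<inter> F \<noteq> {}})"

definition dyadic_cube :: "int \<Rightarrow> int ^ 'n \<Rightarrow> (real ^ 'n) set" where
  "dyadic_cube k m =
    cbox (\<chi> i. of_int (m $ i) * 2 powi (- k)) (\<chi> i. (of_int (m $ i) + 1) * 2 powi (- k))"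

definition dyadic_center :: "int \<Rightarrow> int ^ 'n \<Rightarrow> rat ^ 'n" where
  "dyadic_center k m = (\<chi> i. (of_int (m $ i) + 1 / 2) * 2 powi (- k))"

definition dyadic_cubes :: "(real ^ 'n) set set" where
  "dyadic_cubes = {dyadic_cube k m | k m. True}"

definition family_name ::
    "(int \<times> (rat ^ 'n) \<Rightarrow> nat) \<Rightarrow> (real ^ 'n) set set \<Rightarrow> (nat \<Rightarrow> nat) \<Rightarrow> bool" where
  "family_name \<rho> \<G> p \<longleftrightarrow> \<G> \<subseteq> dyadic_cubes \<and> range p \<subseteq> {0, 1} \<and>
    (\<forall>k m. p (\<rho> (k, dyadic_center k m)) = 1 \<longleftrightarrow> dyadic_cube k m \<in> \<G>)"

definition CUBE :: "(real ^ 'n) set \<Rightarrow> (real ^ 'n) set set set" where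
  "CUBE F = {\<F>. \<F> \<subseteq> dyadic_cubes \<and>
    \<Union>\<F> = - F \<and>
    (\<forall>Q\<in>\<F>. \<forall>Q'\<in>\<F>. Q \<noteq> Q' \<longrightarrow> interior Q \<inter> interior Q' = {}) \<and>
    (\<forall>Q\<in>\<F>. 1 / 2 * diameter Q < setdist Q F \<and> setdist Q F < 5 * diameter Q)}"

end

theory Submission
  imports Defs
begin

text \<open>
  Finitely many balls of the negative information show that a cube \<open>Q\<close> has distance more than
  \<open>diam Q / 2\<close> from \<open>F\<close> (cover a fine grid around \<open>Q\<close>), and one small ball of the positive
  information shows that the distance is less than \<open>diam Q\<close>. One of the two facts is always found;
  call \<open>Q\<close> far if the first is, at the earliest stage at which one is. Since the two thresholds
  differ by the factor 2, the subcubes of a far cube are far. Hence the far cubes with a parent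
  that is not far are the maximal far cubes, and they form the family.

  For the machine, everything but the reading of the input is primitive recursive, including the
  simulation of the machine for \<open>\<rho>\<close> up to a time bound, so that registers with increment,
  decrement and zero test suffice.
\<close>

section \<open>Primitive recursive functions\<close>


text \<open>The condition (C3) cannot be decided from a name of F: d(Q,F) > c and d(Q,F) < c can be
  confirmed, but neither search ends when d(Q,F) = c. Overlapping thresholds are therefore forced. A
  cube between them may be classified either way, depending on the name, so the family is a function
  of the name and not of F. Fixing the earliest stage ensures that a cube gets the same verdict
  whether it is examined for its own sake or as the parent of another cube. The bound 5 comes from
  the parent P of Q: as P is not far, some q in P has distance less than diam P from F, every point
  of Q has distance at most diam P from q, and 2 diam P = 4 diam Q. The values of the name must be
  written in the order of their arguments, while \<rho> is given only by a machine with unknown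
  running time. At each stage all searches are bounded by the number of the stage. This keeps a
  single stage primitive recursive; only the succession of stages is unbounded.\<close>

abbreviation pfst :: "nat \<Rightarrow> nat" where "pfst x \<equiv> fst (prod_decode x)"
abbreviation psnd :: "nat \<Rightarrow> nat" where "psnd x \<equiv> snd (prod_decode x)"
abbreviation ppair :: "nat \<Rightarrow> nat \<Rightarrow> nat" where "ppair x y \<equiv> prod_encode (x, y)"

text \<open>Several arguments are packed by pairing. Iteration takes the place of primitive
  recursion because it compiles directly into a loop; recursion is recovered in
  \<open>pr_rec_nat\<close>.\<close>

inductive pr :: "(nat \<Rightarrow> nat) \<Rightarrow> bool" where
  pr_zero: "pr (\<lambda>_. 0)"
| pr_Suc_basic: "pr Suc"
| pr_fst_basic: "pr (\<lambda>x. pfst x)"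
| pr_snd_basic: "pr (\<lambda>x. psnd x)"
| pr_pair: "pr f \<Longrightarrow> pr g \<Longrightarrow> pr (\<lambda>x. ppair (f x) (g x))"
| pr_comp: "pr f \<Longrightarrow> pr g \<Longrightarrow> pr (\<lambda>x. f (g x))"
| pr_iterate: "pr f \<Longrightarrow> pr (\<lambda>x. (f ^^ pfst x) (psnd x))"

definition pr2 :: "(nat \<Rightarrow> nat \<Rightarrow> nat) \<Rightarrow> bool" where
  "pr2 f \<longleftrightarrow> pr (\<lambda>p. f (pfst p) (psnd p))"

definition prd :: "(nat \<Rightarrow> bool) \<Rightarrow> bool" where
  "prd P \<longleftrightarrow> pr (\<lambda>x. if P x then 1 else 0)"

lemma pr_id: "pr (\<lambda>x. x)"
  using pr_pair[OF pr_fst_basic pr_snd_basic] by simp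

lemma pr_Suc: "pr f \<Longrightarrow> pr (\<lambda>x. Suc (f x))"
  by (rule pr_comp[OF pr_Suc_basic])

lemma pr_fst: "pr f \<Longrightarrow> pr (\<lambda>x. pfst (f x))"
  by (rule pr_comp[OF pr_fst_basic])

lemma pr_snd: "pr f \<Longrightarrow> pr (\<lambda>x. psnd (f x))"
  by (rule pr_comp[OF pr_snd_basic])

lemma pr_const: "pr (\<lambda>_. c)"
  by (induction c) (simp_all add: pr_zero pr_Suc)

text \<open>The functions iterated by \<open>pr_iterate\<close> have no parameter, so
  \<open>x\<close> travels unchanged in the first component.\<close>

lemma pr_funpow:
  assumes "pr2 f" "pr n" "pr a"
  shows "pr (\<lambda>x. (f x ^^ n x) (a x))"
proof -
  let ?F = "\<lambda>p. ppair (pfst p) (f (pfst p) (psnd p))"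
  have F: "pr ?F"
    using assms(1) unfolding pr2_def by (intro pr_pair pr_fst_basic)
  have eq: "(?F ^^ k) (ppair x y) = ppair x ((f x ^^ k) y)" for k x y
    by (induction k) simp_all
  have "pr (\<lambda>x. ppair (n x) (ppair x (a x)))"
    using assms by (intro pr_pair pr_id)
  from pr_comp[OF pr_iterate[OF F] this]
  have "pr (\<lambda>x. (?F ^^ n x) (ppair x (a x)))" by simp
  from pr_snd[OF this] show ?thesis by (simp add: eq)
qed

text \<open>The recursion step sees the index, so pairs of index and value are iterated.\<close>

lemma pr_rec_nat:
  assumes "pr (\<lambda>p. f (pfst p) (pfst (psnd p)) (psnd (psnd p)))" "pr n" "pr a"
  shows "pr (\<lambda>x. rec_nat (a x) (f x) (n x))"
proof -
  let ?G = "\<lambda>x y. ppair (Suc (pfst y)) (f x (pfst y) (psnd y))"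
  have "pr2 ?G"
    using assms(1) unfolding pr2_def
    by (intro pr_pair pr_Suc pr_fst pr_snd pr_id)
  then have "pr (\<lambda>x. (?G x ^^ n x) (ppair 0 (a x)))"
    using assms by (intro pr_funpow pr_pair pr_zero)
  moreover have "(?G x ^^ k) (ppair 0 y) = ppair k (rec_nat y (f x) k)" for k x y
    by (induction k) simp_all
  ultimately show ?thesis using pr_snd[of "\<lambda>x. (?G x ^^ n x) (ppair 0 (a x))"] by simp
qed

lemma pr_add: assumes "pr f" "pr g" shows "pr (\<lambda>x. f x + g x)"
proof -
  have "pr2 (\<lambda>_. Suc)" unfolding pr2_def by (intro pr_Suc pr_snd pr_id)
  from pr_funpow[OF this assms(1,2)] have "pr (\<lambda>x. (Suc ^^ f x) (g x))" .
  moreover have "(Suc ^^ k) y = k + y" for k y by (induction k) auto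
  ultimately show ?thesis by simp
qed

lemma pr_mult: assumes "pr f" "pr g" shows "pr (\<lambda>x. f x * g x)"
proof -
  have "pr (\<lambda>x. rec_nat 0 (\<lambda>_ y. y + g x) (f x))"
    by (intro pr_rec_nat pr_add pr_snd pr_id pr_zero assms pr_comp[OF assms(2)] pr_fst)
  moreover have "rec_nat 0 (\<lambda>_ y. y + b) a = a * b" for a b :: nat
    by (induction a) auto
  ultimately show ?thesis by simp
qed

lemma pr_power: assumes "pr f" "pr g" shows "pr (\<lambda>x. f x ^ g x)"
proof -
  have "pr (\<lambda>x. rec_nat 1 (\<lambda>_ y. y * f x) (g x))"
    by (intro pr_rec_nat pr_mult pr_snd pr_id pr_const assms pr_comp[OF assms(1)] pr_fst)
  moreover have "rec_nat 1 (\<lambda>_ y. y * b) a = b ^ a" for a b :: nat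
    by (induction a) auto
  ultimately show ?thesis by simp
qed

lemma pr_pred: assumes "pr f" shows "pr (\<lambda>x. f x - 1)"
proof -
  have "pr (\<lambda>x. rec_nat 0 (\<lambda>i _. i) (f x))"
    by (intro pr_rec_nat pr_snd pr_fst pr_id pr_zero assms)
  moreover have "rec_nat 0 (\<lambda>i _. i) a = a - 1" for a :: nat
    by (cases a) auto
  ultimately show ?thesis by simp
qed

lemma pr_diff: assumes "pr f" "pr g" shows "pr (\<lambda>x. f x - g x)"
proof -
  have "pr (\<lambda>x. rec_nat (f x) (\<lambda>_ y. y - 1) (g x))"
    by (intro pr_rec_nat pr_pred pr_snd pr_id assms)
  moreover have "rec_nat b (\<lambda>_ y. y - 1) a = b - a" for a b :: nat
    by (induction a) auto
  ultimately show ?thesis by simp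
qed

lemma pr_component: assumes "pr f" "pr g" shows "pr (\<lambda>x. component (f x) (g x))"
proof -
  have "pr (\<lambda>x. pfst (rec_nat (g x) (\<lambda>_ y. psnd y) (f x)))"
    by (intro pr_fst pr_rec_nat pr_snd pr_id assms)
  moreover have "component a b = pfst (rec_nat b (\<lambda>_ y. psnd y) a)" for a b
  proof (induction a arbitrary: b)
    case (Suc a)
    have "rec_nat (psnd b) (\<lambda>_ y. psnd y) a = psnd (rec_nat b (\<lambda>_ y. psnd y) a)"
      by (induction a) auto
    with Suc show ?case by simp
  qed simp
  ultimately show ?thesis by simp
qed

lemma prd_comp: "prd P \<Longrightarrow> pr f \<Longrightarrow> prd (\<lambda>x. P (f x))"
  unfolding prd_def using pr_comp[of "\<lambda>x. if P x then 1 else 0"] by simp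

lemma prd_not: assumes "prd P" shows "prd (\<lambda>x. \<not> P x)"
proof -
  have "(\<lambda>x. if \<not> P x then 1 else 0) = (\<lambda>x. 1 - (if P x then 1 else (0::nat)))" by auto
  then show ?thesis using pr_diff[OF pr_const[of 1] assms[unfolded prd_def]] unfolding prd_def by simp
qed

lemma prd_conj: assumes "prd P" "prd Q" shows "prd (\<lambda>x. P x \<and> Q x)"
proof -
  have "(\<lambda>x. if P x \<and> Q x then 1 else 0) =
      (\<lambda>x. (if P x then 1 else (0::nat)) * (if Q x then 1 else 0))" by auto
  then show ?thesis using pr_mult[OF assms[unfolded prd_def]] unfolding prd_def by simp
qed

lemma prd_disj: assumes "prd P" "prd Q" shows "prd (\<lambda>x. P x \<or> Q x)"
  using prd_not[OF prd_conj[OF prd_not[OF assms(1)] prd_not[OF assms(2)]]] by simp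

lemma prd_imp: assumes "prd P" "prd Q" shows "prd (\<lambda>x. P x \<longrightarrow> Q x)"
  using prd_disj[OF prd_not[OF assms(1)] assms(2)] by (simp only: imp_conv_disj)

lemma prd_const: "prd (\<lambda>_. b)"
  unfolding prd_def by (rule pr_const)

lemma pr_if: assumes "prd P" "pr f" "pr g" shows "pr (\<lambda>x. if P x then f x else g x)"
proof -
  have "(\<lambda>x. if P x then f x else g x) =
      (\<lambda>x. (if P x then 1 else 0) * f x + (1 - (if P x then 1 else (0::nat))) * g x)" by auto
  moreover have "pr (\<lambda>x. (if P x then 1 else 0) * f x + (1 - (if P x then 1 else (0::nat))) * g x)"
    by (intro pr_add pr_mult pr_diff pr_const assms assms(1)[unfolded prd_def])
  ultimately show ?thesis by simp
qed

lemma prd_less: assumes "pr f" "pr g" shows "prd (\<lambda>x. f x < g x)"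
proof -
  have "(\<lambda>x. if f x < g x then 1 else 0) = (\<lambda>x. 1 - (1 - (g x - f x)))" by auto
  moreover have "pr (\<lambda>x. 1 - (1 - (g x - f x)))"
    by (intro pr_diff pr_const assms)
  ultimately show ?thesis unfolding prd_def by simp
qed

lemma prd_le: assumes "pr f" "pr g" shows "prd (\<lambda>x. f x \<le> g x)"
  using prd_not[OF prd_less[OF assms(2,1)]] by (simp add: not_less)

lemma prd_eq: assumes "pr f" "pr g" shows "prd (\<lambda>x. f x = g x)"
  using prd_conj[OF prd_le[OF assms] prd_le[OF assms(2,1)]] by (simp only: order_eq_iff)

text \<open>Bounded search is a recursion that keeps the value 1 once it has been reached.\<close>

lemma prd_Ex_less:
  assumes "prd (\<lambda>p. P (pfst p) (psnd p))" "pr n"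
  shows "prd (\<lambda>x. \<exists>i<n x. P x i)"
proof -
  have "pr (\<lambda>p. if P (pfst p) (psnd p) then 1 else 0)"
    using assms(1) unfolding prd_def .
  from pr_comp[OF this, of "\<lambda>p. ppair (pfst p) (pfst (psnd p))"]
  have "prd (\<lambda>p. P (pfst p) (pfst (psnd p)))"
    unfolding prd_def by (simp add: pr_pair pr_fst pr_snd pr_id)
  then have "pr (\<lambda>x. rec_nat 0 (\<lambda>i y. if P x i then 1 else y) (n x))"
    by (intro pr_rec_nat pr_if pr_const pr_snd pr_id assms)
  moreover have "rec_nat 0 (\<lambda>i y. if P x i then 1 else y) k = (if \<exists>i<k. P x i then 1 else (0::nat))"
    for x k by (induction k) (auto simp: less_Suc_eq)
  ultimately show ?thesis unfolding prd_def by (simp only:)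
qed

lemma prd_All_less:
  assumes "prd (\<lambda>p. P (pfst p) (psnd p))" "pr n"
  shows "prd (\<lambda>x. \<forall>i<n x. P x i)"
  using prd_not[OF prd_Ex_less[OF prd_not[OF assms(1)] assms(2)]] by simp

lemma prd_Ball_finite:
  assumes "finite A" "\<And>i. i \<in> A \<Longrightarrow> prd (\<lambda>x. P x i)"
  shows "prd (\<lambda>x. \<forall>i\<in>A. P x i)"
  using assms by (induction A) (simp_all add: prd_conj prd_const)

lemma prd_even: assumes "pr f" shows "prd (\<lambda>x. even (f x))"
proof -
  have "pr (\<lambda>x. rec_nat 1 (\<lambda>_ y. 1 - y) (f x))"
    by (intro pr_rec_nat pr_diff pr_snd pr_id pr_const assms)
  moreover have "rec_nat 1 (\<lambda>_ y. 1 - y) k = (if even k then 1 else (0::nat))" for k :: nat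
    by (induction k) auto
  ultimately show ?thesis unfolding prd_def by simp
qed

lemma pr_div2: assumes "pr f" shows "pr (\<lambda>x. f x div 2)"
proof -
  have "pr (\<lambda>x. rec_nat 0 (\<lambda>i y. if even i then y else Suc y) (f x))"
    by (intro pr_rec_nat pr_if prd_even pr_Suc pr_fst pr_snd pr_id pr_const assms)
  moreover have "rec_nat 0 (\<lambda>i y. if even i then y else Suc y) k = k div 2" for k :: nat
    by (induction k) (auto elim!: evenE oddE)
  ultimately show ?thesis by simp
qed

lemma prd_map_eq:
  assumes "\<And>f. f \<in> set fs \<Longrightarrow> pr f"
  shows "prd (\<lambda>x. map (\<lambda>f. f x) fs = ys)"
  using assms
proof (induction fs arbitrary: ys)
  case Nil
  show ?case by (simp add: prd_const)
next
  case (Cons f fs)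
  show ?case
  proof (cases ys)
    case Nil
    then show ?thesis by (simp add: prd_const)
  next
    case (Cons z zs)
    with Cons.IH Cons.prems show ?thesis by (auto intro!: prd_conj prd_eq pr_const)
  qed
qed

text \<open>A case distinction over a finite table is a nest of conditionals. In this way the
  transition function of an arbitrary machine enters the simulation: it is consulted at finitely
  many observations only.\<close>

lemma pr_finite_cases:
  assumes "finite A" "\<And>l. l \<in> A \<Longrightarrow> pr (g l)" "pr d" "\<And>f. f \<in> set fs \<Longrightarrow> pr f"
  shows "pr (\<lambda>x. if map (\<lambda>f. f x) fs \<in> A then g (map (\<lambda>f. f x) fs) x else d x)"
  using assms(1,2)
proof (induction A)
  case empty
  show ?case using assms(3) by simp
next
  case (insert l A)
  have "(\<lambda>x. if map (\<lambda>f. f x) fs \<in> insert l A then g (map (\<lambda>f. f x) fs) x else d x) =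
    (\<lambda>x. if map (\<lambda>f. f x) fs = l then g l x
       else if map (\<lambda>f. f x) fs \<in> A then g (map (\<lambda>f. f x) fs) x else d x)" by auto
  moreover have "pr \<dots>"
    by (rule pr_if[OF prd_map_eq]) (use insert assms(4) in auto)
  ultimately show ?case by simp
qed

section \<open>Codes of finite lists\<close>

fun tuple :: "nat list \<Rightarrow> nat" where
  "tuple [] = 0"
| "tuple (x # xs) = ppair x (tuple xs)"

text \<open>As 0 codes the pair of zeros, it also codes the infinite sequence of zeros. Hence lists
  need no end mark, and an empty tape can have the code 0.\<close>

lemma component_0: "component j 0 = 0"
proof -
  have "prod_decode 0 = (0, 0)" by (simp add: prod_decode_def prod_decode_aux.simps)
  then show ?thesis by (induction j) simp_all
qed

lemma component_tuple: "component j (tuple xs) = (if j < length xs then xs ! j else 0)"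
proof (induction xs arbitrary: j)
  case (Cons x xs)
  then show ?case by (cases j) auto
qed (simp add: component_0)

lemma pr_tuple:
  assumes "\<And>f. f \<in> set fs \<Longrightarrow> pr f"
  shows "pr (\<lambda>x. tuple (map (\<lambda>f. f x) fs))"
  using assms by (induction fs) (simp_all add: pr_zero pr_pair)

section \<open>Register programs\<close>


datatype com =
    Skip
  | Inc nat
  | Dec nat
  | Read bool nat
  | Out bool
  | Seq com com (infixr ";;" 60)
  | Cond nat com com
  | While nat com

text \<open>The result has the shape of a machine transition: remaining command, advanced input
  tape, register changed by one, letter written. Registers are visible only through the zero test
  \<open>z\<close>, the input only through the current letters \<open>a\<close>, just as heads see
  single cells. \<open>Read\<close> counts a block of ones and also passes the separator behind
  it.\<close>

fun next_com :: "com \<Rightarrow> (nat \<Rightarrow> bool) \<Rightarrow> (bool \<Rightarrow> symbol) \<Rightarrow>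
    (com \<times> bool option \<times> (nat \<times> direction) option \<times> symbol option) option" where
  "next_com Skip z a = None"
| "next_com (Inc r) z a = Some (Skip, None, Some (r, Right), None)"
| "next_com (Dec r) z a = Some (Skip, None, if z r then None else Some (r, Left), None)"
| "next_com (Read i r) z a =
    (if a i = 1 then Some (Read i r, Some i, Some (r, Right), None)
     else Some (Skip, Some i, None, None))"
| "next_com (Out b) z a = Some (Skip, None, None, Some (if b then 1 else 0))"
| "next_com (Seq c1 c2) z a =
    (if c1 = Skip then Some (c2, None, None, None)
     else map_option (\<lambda>(c, r). (Seq c c2, r)) (next_com c1 z a))"
| "next_com (Cond r c1 c2) z a = Some (if z r then c2 else c1, None, None, None)"
| "next_com (While r c) z a =
    Some (if z r then Skip else Seq c (While r c), None, None, None)"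

type_synonym store = "(nat \<Rightarrow> nat) \<times> (bool \<Rightarrow> nat) \<times> symbol list"

fun small_step :: "(bool \<Rightarrow> nat \<Rightarrow> symbol) \<Rightarrow> com \<times> store \<Rightarrow> (com \<times> store) option" where
  "small_step X (c, \<sigma>, hs, w) =
    (case next_com c (\<lambda>r. \<sigma> r = 0) (\<lambda>i. X i (hs i)) of
       None \<Rightarrow> None
     | Some (c', adv, mv, out) \<Rightarrow> Some (c',
         (case mv of None \<Rightarrow> \<sigma> | Some (r, d) \<Rightarrow> \<sigma>(r := nat (int (\<sigma> r) + shift d))),
         (case adv of None \<Rightarrow> hs | Some i \<Rightarrow> hs(i := Suc (hs i))),
         w @ (case out of None \<Rightarrow> [] | Some b \<Rightarrow> [b])))"

definition steps :: "(bool \<Rightarrow> nat \<Rightarrow> symbol) \<Rightarrow> com \<times> store \<Rightarrow> com \<times> store \<Rightarrow> bool" where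
  "steps X = (\<lambda>x y. small_step X x = Some y)\<^sup>*\<^sup>*"

definition exec :: "(bool \<Rightarrow> nat \<Rightarrow> symbol) \<Rightarrow> com \<Rightarrow> store \<Rightarrow> store \<Rightarrow> bool" where
  "exec X c s s' \<longleftrightarrow> steps X (c, s) (Skip, s')"

text \<open>For programs that neither read nor write: quantifying over the tapes makes their runs
  usable in every context.\<close>

definition pexec :: "com \<Rightarrow> (nat \<Rightarrow> nat) \<Rightarrow> (nat \<Rightarrow> nat) \<Rightarrow> bool" where
  "pexec c \<sigma> \<sigma>' \<longleftrightarrow> (\<forall>X hs w. exec X c (\<sigma>, hs, w) (\<sigma>', hs, w))"

section \<open>Rules for executions\<close>

lemma steps_refl: "steps X x x"
  by (simp add: steps_def)

lemma steps_trans: "steps X x y \<Longrightarrow> steps X y z \<Longrightarrow> steps X x z"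
  by (simp add: steps_def)

lemma steps_first: "small_step X x = Some y \<Longrightarrow> steps X y z \<Longrightarrow> steps X x z"
  unfolding steps_def by (rule converse_rtranclp_into_rtranclp)

lemma small_step_Seq:
  "small_step X (c, s) = Some (c', s') \<Longrightarrow> small_step X (c;; d, s) = Some (c';; d, s')"
  by (cases s) (auto split: option.splits prod.splits)

lemma steps_Seq:
  assumes "steps X (c, s) (c', s')"
  shows "steps X (c;; d, s) (c';; d, s')"
  using assms[unfolded steps_def]
proof (induction rule: converse_rtranclp_induct2)
  case refl
  show ?case by (rule steps_refl)
next
  case (step a b)
  then show ?case using small_step_Seq steps_first by metis
qed

lemma exec_Skip: "exec X Skip s s"
  by (simp add: exec_def steps_refl)

lemma steps_Seq_exec: "exec X c s s' \<Longrightarrow> steps X (c;; d, s) (d, s')"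
proof -
  assume "exec X c s s'"
  then have "steps X (c;; d, s) (Skip;; d, s')" unfolding exec_def by (rule steps_Seq)
  moreover have "small_step X (Skip;; d, s') = Some (d, s')" by (cases s') simp
  ultimately show ?thesis by (blast intro: steps_trans steps_first steps_refl)
qed

lemma exec_Seq: "exec X c s s' \<Longrightarrow> exec X d s' s'' \<Longrightarrow> exec X (c;; d) s s''"
  unfolding exec_def[of X d] exec_def[of X "c;; d"] by (rule steps_trans[OF steps_Seq_exec])

lemma exec_small_step: "small_step X (c, s) = Some (d, s') \<Longrightarrow> exec X d s' s'' \<Longrightarrow> exec X c s s''"
  unfolding exec_def by (rule steps_first)

lemma exec_Cond:
  "exec X (if \<sigma> r = 0 then d else c) (\<sigma>, s) s' \<Longrightarrow> exec X (Cond r c d) (\<sigma>, s) s'"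
  by (cases s) (rule exec_small_step, simp_all)

lemma exec_While_0: "\<sigma> r = 0 \<Longrightarrow> exec X (While r c) (\<sigma>, s) (\<sigma>, s)"
  by (cases s) (rule exec_small_step[OF _ exec_Skip], simp)

lemma steps_While:
  assumes "\<sigma> r \<noteq> 0" "exec X c (\<sigma>, s) s'"
  shows "steps X (While r c, \<sigma>, s) (While r c, s')"
  by (rule steps_first[OF _ steps_Seq_exec[OF assms(2)]]) (cases s, use assms in simp)

lemma pexec_Inc: "pexec (Inc r) \<sigma> (\<sigma>(r := Suc (\<sigma> r)))"
  unfolding pexec_def
  by (intro allI exec_small_step[OF _ exec_Skip]) (simp add: nat_add_distrib)

lemma pexec_Dec: "pexec (Dec r) \<sigma> (\<sigma>(r := \<sigma> r - 1))"
  unfolding pexec_def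
  by (intro allI exec_small_step[OF _ exec_Skip]) (auto simp: fun_upd_idem nat_diff_distrib)

lemma pexec_Seq: "pexec c \<sigma> \<sigma>' \<Longrightarrow> pexec d \<sigma>' \<sigma>'' \<Longrightarrow> pexec (c;; d) \<sigma> \<sigma>''"
  unfolding pexec_def using exec_Seq by blast

lemma pexec_Cond: "pexec (if \<sigma> r = 0 then d else c) \<sigma> \<sigma>' \<Longrightarrow> pexec (Cond r c d) \<sigma> \<sigma>'"
  unfolding pexec_def using exec_Cond by blast

text \<open>\<open>f i\<close> is the store when \<open>i\<close> rounds remain; the family plays
  the role of a loop invariant and of a termination measure at once.\<close>

lemma pexec_While:
  assumes "\<And>i. i < n \<Longrightarrow> f (Suc i) r \<noteq> 0 \<and> pexec c (f (Suc i)) (f i)" "f 0 r = 0"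
  shows "pexec (While r c) (f n) (f 0)"
  using assms(1)
proof (induction n)
  case 0
  then show ?case using assms(2) by (simp add: pexec_def exec_While_0)
next
  case (Suc n)
  then have IH: "pexec (While r c) (f n) (f 0)" by simp
  have "f (Suc n) r \<noteq> 0" "pexec c (f (Suc n)) (f n)" using Suc.prems by auto
  then have "steps X (While r c, f (Suc n), hs, w) (While r c, f n, hs, w)" for X hs w
    by (intro steps_While) (auto simp: pexec_def)
  with IH show ?case
    unfolding pexec_def exec_def by (blast intro: steps_trans)
qed

lemma pexec_cong: "pexec c \<sigma> \<sigma>' \<Longrightarrow> \<sigma>' = \<sigma>'' \<Longrightarrow> pexec c \<sigma> \<sigma>''"
  by simp

section \<open>Arithmetic on registers by loops\<close>

definition "clear_com k = While k (Dec k)"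
definition "move_com j k = While j (Dec j;; Inc k)"
text \<open>Reading a register empties it, so a copy has two targets; moving one of them back
  restores the source.\<close>

definition "copy_com j k l = While j (Dec j;; Inc k;; Inc l)"

lemma pexec_clear: "pexec (clear_com k) \<sigma> (\<sigma>(k := 0))"
proof -
  have "pexec (While k (Dec k)) ((\<lambda>i. \<sigma>(k := i)) (\<sigma> k)) ((\<lambda>i. \<sigma>(k := i)) 0)"
    by (rule pexec_While) (auto intro!: pexec_Dec[THEN pexec_cong])
  then show ?thesis by (simp add: clear_com_def)
qed

lemma pexec_move:
  assumes "j \<noteq> k"
  shows "pexec (move_com j k) \<sigma> (\<sigma>(k := \<sigma> k + \<sigma> j, j := 0))"
proof -
  let ?f = "\<lambda>i. \<sigma>(k := \<sigma> k + (\<sigma> j - i), j := i)"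
  have "pexec (move_com j k) (?f (\<sigma> j)) (?f 0)"
    unfolding move_com_def
    by (rule pexec_While)
      (use assms in \<open>auto intro!: pexec_Seq pexec_Dec pexec_Inc[THEN pexec_cong] ext\<close>)
  then show ?thesis by simp
qed

lemma pexec_copy:
  assumes "j \<noteq> k" "j \<noteq> l" "k \<noteq> l"
  shows "pexec (copy_com j k l) \<sigma> (\<sigma>(k := \<sigma> k + \<sigma> j, l := \<sigma> l + \<sigma> j, j := 0))"
proof -
  let ?f = "\<lambda>i. \<sigma>(k := \<sigma> k + (\<sigma> j - i), l := \<sigma> l + (\<sigma> j - i), j := i)"
  have "pexec (copy_com j k l) (?f (\<sigma> j)) (?f 0)"
    unfolding copy_com_def
    by (rule pexec_While)
      (use assms in \<open>auto intro!: pexec_Seq pexec_Dec pexec_Inc pexec_Inc[THEN pexec_cong] ext\<close>)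
  then show ?thesis by simp
qed

text \<open>Since \<open>\<langle>x, y\<rangle> = x + (0 + 1 + \<dots> + (x + y))\<close>, the code is accumulated in \<open>r\<close>.\<close>

definition pair_com :: "nat \<Rightarrow> nat \<Rightarrow> nat \<Rightarrow> nat \<Rightarrow> com" where
  "pair_com a b r t = copy_com a b r;; While b (copy_com b r t;; move_com t b;; Dec b)"

lemma pexec_pair:
  assumes d: "distinct [a, b, r, t]" and 0: "\<sigma> r = 0" "\<sigma> t = 0"
  shows "pexec (pair_com a b r t) \<sigma> (\<sigma>(a := 0, b := 0, r := ppair (\<sigma> a) (\<sigma> b)))"
proof -
  define s where "s = \<sigma> a + \<sigma> b"
  \<comment> \<open>With \<open>i\<close> rounds left, the summands from \<open>s\<close> down to
    \<open>i + 1\<close> have been added.\<close>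
  let ?f = "\<lambda>i. \<sigma>(a := 0, b := i, r := \<sigma> a + (triangle s - triangle i))"
  have mono: "triangle i \<le> triangle j" if "i \<le> j" for i j
    using that by (induction rule: dec_induct) (auto simp: triangle_Suc)
  have "pexec (copy_com a b r) \<sigma> (?f s)"
    by (rule pexec_copy[THEN pexec_cong]) (use d 0 in \<open>auto simp: s_def fun_eq_iff\<close>)
  moreover have "pexec (While b (copy_com b r t;; move_com t b;; Dec b)) (?f s) (?f 0)"
  proof (rule pexec_While, intro conjI)
    fix i assume i: "i < s"
    have "triangle (Suc i) \<le> triangle s" by (rule mono) (use i in auto)
    then have "\<sigma> a + (triangle s - triangle (Suc i)) + Suc i = \<sigma> a + (triangle s - triangle i)"
      by (simp add: triangle_Suc)
    then show "pexec (copy_com b r t;; move_com t b;; Dec b) (?f (Suc i)) (?f i)"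
      using d 0
      by (intro pexec_Seq[OF pexec_copy] pexec_Seq[OF pexec_move] pexec_Dec[THEN pexec_cong] ext)
        auto
  qed (use d in auto)
  moreover have "?f 0 = \<sigma>(a := 0, b := 0, r := ppair (\<sigma> a) (\<sigma> b))"
    by (simp add: prod_encode_def s_def add.commute)
  ultimately show ?thesis unfolding pair_com_def by (auto intro: pexec_Seq)
qed

text \<open>Instead of solving for a triangular number, the loop enumerates the pairs in the order
  of their codes, along the antidiagonals, one step per unit of \<open>n\<close>; at the end of an
  antidiagonal it jumps to the start of the next one.\<close>

definition unpair_com :: "nat \<Rightarrow> nat \<Rightarrow> nat \<Rightarrow> com" where
  "unpair_com n a b =
    While n (Dec n;; Cond b (Inc a;; Dec b) (move_com a b;; Inc b))"

lemma prod_decode_Suc: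
  "prod_decode (Suc n) =
    (if psnd n = 0 then (0, Suc (pfst n)) else (Suc (pfst n), psnd n - 1))"
proof -
  obtain x y where n: "n = ppair x y" by (metis prod.collapse prod_decode_inverse)
  have "Suc n = ppair 0 (Suc x)" if "y = 0"
    using that by (simp add: n prod_encode_def triangle_Suc)
  moreover have "Suc n = ppair (Suc x) (y - 1)" if "y \<noteq> 0"
    using that by (cases y) (simp_all add: n prod_encode_def triangle_Suc)
  ultimately show ?thesis by (cases "y = 0") (simp_all add: n del: prod_encode_def)
qed

lemma pexec_unpair:
  assumes d: "distinct [n, a, b]" and 0: "\<sigma> a = 0" "\<sigma> b = 0"
  shows "pexec (unpair_com n a b) \<sigma> (\<sigma>(n := 0, a := pfst (\<sigma> n), b := psnd (\<sigma> n)))"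
proof -
  let ?f = "\<lambda>i. \<sigma>(n := i, a := pfst (\<sigma> n - i), b := psnd (\<sigma> n - i))"
  have "prod_decode 0 = (0, 0)" by (simp add: prod_decode_def prod_decode_aux.simps)
  then have "?f (\<sigma> n) = \<sigma>" using d 0 by (auto simp: fun_eq_iff)
  moreover have "pexec (unpair_com n a b) (?f (\<sigma> n)) (?f 0)"
    unfolding unpair_com_def
  proof (rule pexec_While, intro conjI)
    fix i assume i: "i < \<sigma> n"
    then have m: "\<sigma> n - i = Suc (\<sigma> n - Suc i)" by simp
    define x y where "x = pfst (\<sigma> n - Suc i)" and "y = psnd (\<sigma> n - Suc i)"
    have dec: "prod_decode (\<sigma> n - i) = (if y = 0 then (0, Suc x) else (Suc x, y - 1))"
      unfolding m prod_decode_Suc x_def y_def ..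
    show "pexec (Dec n;; Cond b (Inc a;; Dec b) (move_com a b;; Inc b)) (?f (Suc i)) (?f i)"
      unfolding dec x_def[symmetric] y_def[symmetric]
    proof (rule pexec_Seq[OF pexec_Dec], rule pexec_Cond, goal_cases)
      case 1
      show ?case
      proof (cases "y = 0")
        case True
        then show ?thesis
          using d by (auto intro!: pexec_Seq[OF pexec_move] pexec_Inc[THEN pexec_cong] ext)
      next
        case False
        then show ?thesis
          using d by (auto intro!: pexec_Seq[OF pexec_Inc] pexec_Dec[THEN pexec_cong] ext)
      qed
    qed
  qed (use d in auto)
  ultimately show ?thesis by simp
qed

section \<open>Compilation of primitive recursive functions\<close>

definition computes :: "nat \<Rightarrow> (nat \<Rightarrow> nat) \<Rightarrow> com \<Rightarrow> bool" where
  "computes k f c \<longleftrightarrow> (\<forall>\<sigma>. (\<forall>j>k. \<sigma> j = 0) \<longrightarrow> pexec c \<sigma> (\<sigma>(k := f (\<sigma> k))))"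

lemma pexec_computes:
  "computes k f c \<Longrightarrow> (\<And>j. j > k \<Longrightarrow> \<sigma> j = 0) \<Longrightarrow> pexec c \<sigma> (\<sigma>(k := f (\<sigma> k)))"
  by (simp add: computes_def)

text \<open>A program at register \<open>k\<close> leaves the registers below \<open>k\<close> alone
  and the scratch registers above it zero again. The induction is over all \<open>k\<close> at once,
  so a subprogram can be placed above the values that must survive it.\<close>

lemma computes_pr:
  assumes "pr f"
  shows "\<exists>c. computes k f c"
  using assms
proof (induction arbitrary: k)
  case pr_zero
  then show ?case using pexec_clear by (auto simp: computes_def)
next
  case pr_Suc_basic
  then show ?case using pexec_Inc by (auto simp: computes_def)
next
  case pr_fst_basic
  have "computes k (\<lambda>x. pfst x)
    (unpair_com k (k + 1) (k + 2);; clear_com (k + 2);; move_com (k + 1) k)"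
    unfolding computes_def
    by (auto intro!: pexec_Seq[OF pexec_unpair] pexec_Seq[OF pexec_clear]
        pexec_move[THEN pexec_cong] ext)
  then show ?case by blast
next
  case pr_snd_basic
  have "computes k (\<lambda>x. psnd x)
    (unpair_com k (k + 1) (k + 2);; clear_com (k + 1);; move_com (k + 2) k)"
    unfolding computes_def
    by (auto intro!: pexec_Seq[OF pexec_unpair] pexec_Seq[OF pexec_clear]
        pexec_move[THEN pexec_cong] ext)
  then show ?case by blast
next
  case (pr_pair f g)
  \<comment> \<open>The program for \<open>g\<close> runs first, in register \<open>k + 2\<close>,
    while \<open>k + 1\<close> keeps the other copy of the argument. Its value moves down to
    \<open>k\<close> before the program for \<open>f\<close> runs in \<open>k + 1\<close>.\<close>
  obtain c d where c: "computes (k + 1) f c" and d: "computes (k + 2) g d"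
    using pr_pair.IH by meson
  have "computes k (\<lambda>x. ppair (f x) (g x))
    (copy_com k (k + 1) (k + 2);; d;; move_com (k + 2) k;; c;;
     pair_com (k + 1) k (k + 2) (k + 3);; move_com (k + 2) k)"
    unfolding computes_def
    by (auto intro!: pexec_Seq[OF pexec_copy] pexec_Seq[OF pexec_computes[OF c]]
        pexec_Seq[OF pexec_computes[OF d]] pexec_Seq[OF pexec_pair] pexec_Seq[OF pexec_move]
        pexec_move[THEN pexec_cong] ext)
  then show ?case by blast
next
  case (pr_comp f g)
  obtain c d where c: "computes k f c" and d: "computes k g d"
    using pr_comp.IH by meson
  have "computes k (\<lambda>x. f (g x)) (d;; c)"
    unfolding computes_def
    by (auto intro!: pexec_Seq[OF pexec_computes[OF d]] pexec_computes[OF c, THEN pexec_cong])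
  then show ?case by blast
next
  case (pr_iterate f)
  obtain c where c: "computes (k + 1) f c" using pr_iterate.IH by meson
  \<comment> \<open>The loop counter in \<open>k\<close> lies below the register
    \<open>k + 1\<close> on which \<open>c\<close> acts.\<close>
  let ?W = "While k (Dec k;; c)"
  have W: "pexec ?W (\<sigma>(k := n, Suc k := x)) (\<sigma>(k := 0, Suc k := (f ^^ n) x))"
    if "\<forall>j>k. \<sigma> j = 0" for \<sigma> n x
  proof -
    let ?f = "\<lambda>i. \<sigma>(k := i, Suc k := (f ^^ (n - i)) x)"
    have "pexec ?W (?f n) (?f 0)"
    proof (rule pexec_While, intro conjI)
      fix i assume "i < n"
      then have "n - i = Suc (n - Suc i)" by simp
      then show "pexec (Dec k;; c) (?f (Suc i)) (?f i)"
        using that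
        by (auto intro!: pexec_Seq[OF pexec_Dec] pexec_computes[OF c, THEN pexec_cong] ext)
    qed auto
    then show ?thesis by simp
  qed
  have "computes k (\<lambda>x. (f ^^ pfst x) (psnd x))
    (unpair_com k (k + 1) (k + 2);; move_com (k + 1) k;; move_com (k + 2) (k + 1);; ?W;;
     move_com (k + 1) k)"
    unfolding computes_def
  proof (intro allI impI)
    fix \<sigma> :: "nat \<Rightarrow> nat" assume \<sigma>: "\<forall>j>k. \<sigma> j = 0"
    let ?n = "pfst (\<sigma> k)" and ?x = "psnd (\<sigma> k)"
    let ?\<sigma>1 = "\<sigma>(k := 0, k + 1 := ?n, k + 2 := ?x)"
    let ?\<sigma>2 = "\<sigma>(k := ?n, k + 2 := ?x)"
    let ?\<sigma>3 = "\<sigma>(k := ?n, Suc k := ?x)"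
    let ?\<sigma>4 = "\<sigma>(k := 0, Suc k := (f ^^ ?n) ?x)"
    have "pexec (unpair_com k (k + 1) (k + 2)) \<sigma> ?\<sigma>1"
      by (rule pexec_unpair) (use \<sigma> in auto)
    moreover have "pexec (move_com (k + 1) k) ?\<sigma>1 ?\<sigma>2"
      by (rule pexec_move[THEN pexec_cong]) (use \<sigma> in \<open>auto simp: fun_eq_iff\<close>)
    moreover have "pexec (move_com (k + 2) (k + 1)) ?\<sigma>2 ?\<sigma>3"
      by (rule pexec_move[THEN pexec_cong]) (use \<sigma> in \<open>auto simp: fun_eq_iff\<close>)
    moreover have "pexec ?W ?\<sigma>3 ?\<sigma>4" by (rule W[OF \<sigma>])
    moreover have "pexec (move_com (k + 1) k) ?\<sigma>4 (\<sigma>(k := (f ^^ ?n) ?x))"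
      by (rule pexec_move[THEN pexec_cong]) (use \<sigma> in \<open>auto simp: fun_eq_iff\<close>)
    ultimately show "pexec (unpair_com k (k + 1) (k + 2);; move_com (k + 1) k;;
        move_com (k + 2) (k + 1);; ?W;; move_com (k + 1) k) \<sigma> (\<sigma>(k := (f ^^ ?n) ?x))"
      by (intro pexec_Seq)
  qed
  then show ?case by blast
qed

section \<open>Register programs as machines\<close>


text \<open>A set that contains the program and is closed under \<open>next_com\<close>; being
  finite, it provides the states of the machine.\<close>

fun sub_coms :: "com \<Rightarrow> com set" where
  "sub_coms Skip = {Skip}"
| "sub_coms (Inc r) = {Inc r, Skip}"
| "sub_coms (Dec r) = {Dec r, Skip}"
| "sub_coms (Read i r) = {Read i r, Skip}"
| "sub_coms (Out b) = {Out b, Skip}"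
| "sub_coms (Seq c d) = (\<lambda>c'. Seq c' d) ` sub_coms c \<union> sub_coms d"
| "sub_coms (Cond r c d) = insert (Cond r c d) (sub_coms c \<union> sub_coms d)"
| "sub_coms (While r c) = {While r c, Skip} \<union> (\<lambda>c'. Seq c' (While r c)) ` sub_coms c"

fun regs_below :: "nat \<Rightarrow> com \<Rightarrow> bool" where
  "regs_below n Skip \<longleftrightarrow> True"
| "regs_below n (Inc r) \<longleftrightarrow> r < n"
| "regs_below n (Dec r) \<longleftrightarrow> r < n"
| "regs_below n (Read i r) \<longleftrightarrow> r < n"
| "regs_below n (Out b) \<longleftrightarrow> True"
| "regs_below n (Seq c d) \<longleftrightarrow> regs_below n c \<and> regs_below n d"
| "regs_below n (Cond r c d) \<longleftrightarrow> r < n \<and> regs_below n c \<and> regs_below n d"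
| "regs_below n (While r c) \<longleftrightarrow> r < n \<and> regs_below n c"

lemma finite_sub_coms: "finite (sub_coms c)"
  by (induction c) auto

lemma sub_coms_refl: "c \<in> sub_coms c"
  by (induction c) auto

lemma next_com_sub_coms:
  "c' \<in> sub_coms c \<Longrightarrow> next_com c' z a = Some (c'', r) \<Longrightarrow> c'' \<in> sub_coms c"
proof (induction c arbitrary: c' c'' r)
  case (Seq c d)
  from Seq.prems(1) consider e where "c' = Seq e d" "e \<in> sub_coms c" | "c' \<in> sub_coms d" by auto
  then show ?case
  proof cases
    case 1
    then show ?thesis
      using Seq.prems(2) Seq.IH(1) by (auto simp: sub_coms_refl split: if_splits)
  next
    case 2
    then show ?thesis using Seq.prems(2) Seq.IH(2) by simp
  qed
next
  case (Cond r' c d)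
  from Cond.prems(1) consider "c' = Cond r' c d" | "c' \<in> sub_coms c" | "c' \<in> sub_coms d" by auto
  then show ?case
  proof cases
    case 1
    then show ?thesis using Cond.prems(2) by (auto simp: sub_coms_refl)
  next
    case 2
    then show ?thesis using Cond.prems(2) Cond.IH(1) by simp
  next
    case 3
    then show ?thesis using Cond.prems(2) Cond.IH(2) by simp
  qed
next
  case (While r' c)
  then show ?case
    by (auto simp: sub_coms_refl split: if_splits)
qed (auto split: if_splits)

lemma regs_below_sub_coms: "c' \<in> sub_coms c \<Longrightarrow> regs_below n c \<Longrightarrow> regs_below n c'"
  by (induction c arbitrary: c') auto

lemma next_com_cong:
  assumes "regs_below n c" "\<And>r. r < n \<Longrightarrow> z r = z' r"
  shows "next_com c z a = next_com c z' a"
  using assms(1) by (induction c) (auto simp: assms(2))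

text \<open>A left move is guarded by the zero test, which keeps the heads from passing the mark on
  cell 0.\<close>

lemma next_com_effect:
  assumes "regs_below n c" "next_com c z a = Some (c', adv, mv, out)"
  shows "(\<forall>r d. mv = Some (r, d) \<longrightarrow> r < n \<and> (d = Left \<longrightarrow> \<not> z r)) \<and> set_option out \<subseteq> {0, 1}"
  using assms
  by (induction c arbitrary: c' adv mv out) (auto split: if_splits)

lemma regs_below_mono: "regs_below m c \<Longrightarrow> m \<le> n \<Longrightarrow> regs_below n c"
  by (induction c) auto

lemma ex_regs_below: "\<exists>n. regs_below n c"
proof (induction c)
  case (Seq c d)
  then obtain k l where "regs_below k c" "regs_below l d" by auto
  then show ?case using regs_below_mono by (intro exI[of _ "max k l"]) auto
next
  case (Cond r c d)
  then obtain k l where "regs_below k c" "regs_below l d" by auto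
  then show ?case using regs_below_mono by (intro exI[of _ "max (Suc r) (max k l)"]) auto
next
  case (While r c)
  then obtain k where "regs_below k c" by auto
  then show ?case using regs_below_mono by (intro exI[of _ "max (Suc r) k"]) auto
qed auto

text \<open>
  Register \<open>r\<close> is the position of the head of work tape \<open>r\<close>, whose only nonblank symbol is a mark
  on cell 0. State 0 writes the marks, state \<open>Suc (h c)\<close> executes the command \<open>c\<close>.
\<close>

definition mark_tape :: "int \<Rightarrow> symbol" where
  "mark_tape = (\<lambda>_. blank)(0 := 1)"

text \<open>Outside state 0 every symbol is written back as it was read, so the marks persist and
  the register values are carried by the head positions alone.\<close>

definition com_delta :: "(com \<Rightarrow> nat) \<Rightarrow> com \<Rightarrow> nat \<Rightarrow> nat \<Rightarrow> symbol list \<Rightarrow> symbol list \<Rightarrow>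
    (nat \<times> bool list \<times> (symbol \<times> direction) list \<times> symbol option) option" where
  "com_delta h c n q as bs =
    (if q = 0 then Some (Suc (h c), [False, False], replicate n (1, Stay), None)
     else case next_com (inv_into (sub_coms c) h (q - 1)) (\<lambda>r. bs ! r = 1)
         (\<lambda>i. as ! (if i then 1 else 0)) of
       None \<Rightarrow> None
     | Some (c', adv, mv, out) \<Rightarrow>
         Some (Suc (h c'), [adv = Some False, adv = Some True],
           map (\<lambda>r. (bs ! r, case mv of None \<Rightarrow> Stay | Some (r', d) \<Rightarrow> if r' = r then d else Stay))
             [0..<n], out))"

definition com_machine :: "(com \<Rightarrow> nat) \<Rightarrow> com \<Rightarrow> nat \<Rightarrow> machine" where
  "com_machine h c n =
    \<lparr>num_states = Suc (card (sub_coms c)), num_symbols = 3, num_inputs = 2, num_works = n,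
     delta = com_delta h c n\<rparr>"

definition com_config :: "(com \<Rightarrow> nat) \<Rightarrow> nat \<Rightarrow> com \<times> store \<Rightarrow> config" where
  "com_config h n = (\<lambda>(c, \<sigma>, hs, w).
    \<lparr>state = Suc (h c), in_heads = [hs False, hs True],
     works = map (\<lambda>r. (mark_tape, int (\<sigma> r))) [0..<n], written = w\<rparr>)"

lemma type2_machine_com:
  assumes h: "bij_betw h (sub_coms c) {..<card (sub_coms c)}" and n: "regs_below n c"
  shows "type2_machine (com_machine h c n)"
proof -
  have h': "h c' < card (sub_coms c)" if "c' \<in> sub_coms c" for c'
    using h that by (auto simp: bij_betw_def)
  have inv: "inv_into (sub_coms c) h (q - Suc 0) \<in> sub_coms c"
    if "q < Suc (card (sub_coms c))" "0 < q" for q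
    using that by (intro inv_into_into) (use h in \<open>auto simp: bij_betw_def\<close>)
  have *: "c' \<in> sub_coms c \<and> set_option out \<subseteq> {0, 1}"
    if "next_com (inv_into (sub_coms c) h (q - Suc 0)) z a = Some (c', adv, mv, out)"
      "q < Suc (card (sub_coms c))" "0 < q" for q z a c' adv mv out
    using that next_com_sub_coms[OF inv] next_com_effect[OF regs_below_sub_coms[OF inv n]] by blast
  have nth3: "bs ! i < 3" if "set bs \<subseteq> {..<3}" "i < length bs" for bs :: "symbol list" and i
    using that nth_mem by blast
  show ?thesis
    unfolding type2_machine_def com_machine_def com_delta_def
    by (auto simp: h' sub_coms_refl dest!: * dest: nth3 split: if_splits option.splits)
qed

text \<open>Head \<open>r\<close> sees the mark exactly when register \<open>r\<close> is 0, so both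
  sides evaluate the same \<open>next_com\<close>, and halting corresponds too.\<close>

lemma step_com_machine:
  assumes h: "bij_betw h (sub_coms c) {..<card (sub_coms c)}" and n: "regs_below n c"
    and d: "d \<in> sub_coms c"
  shows "step (com_machine h c n) [X False, X True] (com_config h n (d, s)) =
    map_option (com_config h n) (small_step X (d, s))"
proof -
  obtain \<sigma> hs w where s: "s = (\<sigma>, hs, w)" by (cases s)
  have inv: "inv_into (sub_coms c) h (h d) = d"
    using h d by (simp add: bij_betw_def)
  have nd: "regs_below n d" using regs_below_sub_coms[OF d n] .
  have next1: "next_com d (\<lambda>r. map ((\<lambda>(t, h). t h) \<circ> (\<lambda>r. (mark_tape, int (\<sigma> r)))) [0..<n] ! r = Suc 0) a =
      next_com d (\<lambda>r. \<sigma> r = 0) a" for a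
    by (rule next_com_cong[OF nd]) (simp add: mark_tape_def)
  have reads: "(\<lambda>i. [X False (hs False), X True (hs True)] ! (if i then 1 else 0)) =
      (\<lambda>i. X i (hs i))" by (auto simp: fun_eq_iff)
  show ?thesis
  proof (cases "next_com d (\<lambda>r. \<sigma> r = 0) (\<lambda>i. X i (hs i))")
    case None
    then show ?thesis
      by (simp add: step_def com_machine_def com_config_def s com_delta_def inv next1 reads)
  next
    case (Some res)
    then obtain c' adv mv out where
      next2: "next_com d (\<lambda>r. \<sigma> r = 0) (\<lambda>i. X i (hs i)) = Some (c', adv, mv, out)"
      by (cases res) auto
    note eff = next_com_effect[OF nd next2]
    have heads: "map2 (\<lambda>h b. if b then Suc h else h) [hs False, hs True]
        [adv = Some False, adv = Some True] =
      map (case adv of None \<Rightarrow> hs | Some i \<Rightarrow> hs(i := Suc (hs i))) [False, True]"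
      by (auto split: option.split)
    have tapes: "map2 (\<lambda>(t, h) (a, d). (t(h := a), h + shift d))
        (map (\<lambda>r. (mark_tape, int (\<sigma> r))) [0..<n])
        (map (\<lambda>r. (map ((\<lambda>(t, h). t h) \<circ> (\<lambda>r. (mark_tape, int (\<sigma> r)))) [0..<n] ! r,
          case mv of None \<Rightarrow> Stay | Some (r', d) \<Rightarrow> if r' = r then d else Stay)) [0..<n]) =
      map (\<lambda>r. (mark_tape,
        int ((case mv of None \<Rightarrow> \<sigma> | Some (r, d) \<Rightarrow> \<sigma>(r := nat (int (\<sigma> r) + shift d))) r))) [0..<n]"
    proof (rule nth_equalityI, goal_cases)
      case (2 i)
      show ?case
      proof (cases mv)
        case None
        then show ?thesis using 2 by (simp add: fun_upd_idem)
      next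
        case (Some m)
        then obtain r d where mv: "mv = Some (r, d)" by (cases m) auto
        \<comment> \<open>At register value 0 a left move would send the head to cell -1, while
          \<open>nat\<close> would keep the register at 0; the guard excludes this.\<close>
        with eff have "d = Left \<longrightarrow> \<sigma> r \<noteq> 0" by auto
        then have "0 \<le> int (\<sigma> r) + shift d" by (cases d) auto
        then show ?thesis using 2 mv by (simp add: fun_upd_idem)
      qed
    qed simp
    show ?thesis
      using next2 heads tapes
      by (simp add: step_def com_machine_def com_config_def s com_delta_def inv next1 reads
          split: option.split)
  qed
qed


lemma run_com_machine:
  assumes h: "bij_betw h (sub_coms c) {..<card (sub_coms c)}" and n: "regs_below n c"
    and steps: "steps X (c, (\<lambda>_. 0), (\<lambda>_. 0), []) (d, s)"
  shows "\<exists>t. run (com_machine h c n) [X False, X True] t = com_config h n (d, s)"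
proof -
  let ?M = "com_machine h c n" and ?xs = "[X False, X True]"
  have "fst x \<in> sub_coms c \<and> (\<exists>t. run ?M ?xs t = com_config h n x)"
    if "(\<lambda>x y. small_step X x = Some y)\<^sup>*\<^sup>* (c, (\<lambda>_. 0), (\<lambda>_. 0), []) x" for x
    using that
  proof (induction rule: rtranclp_induct)
    case base
    \<comment> \<open>The first step of the machine only writes the marks.\<close>
    have "run ?M ?xs (Suc 0) = com_config h n (c, (\<lambda>_. 0), (\<lambda>_. 0), [])"
      by (auto simp: step_def init_config_def com_machine_def com_delta_def com_config_def
          mark_tape_def zip_replicate numeral_2_eq_2 intro!: nth_equalityI)
    then show ?case using sub_coms_refl by (metis fst_conv)
  next
    case (step x y)
    then obtain t where x: "fst x \<in> sub_coms c" and t: "run ?M ?xs t = com_config h n x" by auto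
    obtain d s where ds: "x = (d, s)" by (cases x) blast
    have "step ?M ?xs (run ?M ?xs t) = Some (com_config h n y)"
      using step_com_machine[OF h n] x step.hyps(2) unfolding t ds by simp
    then have "run ?M ?xs (Suc t) = com_config h n y" by simp
    moreover have "fst y \<in> sub_coms c"
      using step.hyps(2) x next_com_sub_coms
      by (cases x, cases y) (auto split: option.splits)
    ultimately show ?case by blast
  qed
  from this[OF steps[unfolded steps_def]] show ?thesis by blast
qed

section \<open>The endless loop over the input\<close>

lemma exec_Read:
  assumes "\<And>d. d < k \<Longrightarrow> X i (hs i + d) = 1" "X i (hs i + k) \<noteq> 1"
  shows "exec X (Read i r) (\<sigma>, hs, w) (\<sigma>(r := \<sigma> r + k), hs(i := Suc (hs i + k)), w)"
  using assms
proof (induction k arbitrary: \<sigma> hs)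
  case 0
  then show ?case by (auto simp: fun_upd_def intro!: exec_small_step[OF _ exec_Skip])
next
  case (Suc k)
  let ?\<sigma> = "\<sigma>(r := Suc (\<sigma> r))" and ?hs = "hs(i := Suc (hs i))"
  have "small_step X (Read i r, \<sigma>, hs, w) = Some (Read i r, ?\<sigma>, ?hs, w)"
    using Suc.prems(1)[of 0] by (simp add: nat_add_distrib)
  moreover have "exec X (Read i r) (?\<sigma>, ?hs, w)
      (?\<sigma>(r := ?\<sigma> r + k), ?hs(i := Suc (?hs i + k)), w)"
    by (rule Suc.IH) (use Suc.prems(1)[of "Suc _"] Suc.prems(2) in auto)
  ultimately show ?case by (rule exec_small_step[THEN back_subst[of "exec X _ _"]]) (auto simp: fun_eq_iff)
qed

lemma exec_Out: "exec X (Out b) (\<sigma>, hs, w) (\<sigma>, hs, w @ [if b then 1 else 0])"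
  by (rule exec_small_step[OF _ exec_Skip]) simp

lemma exec_pexec: "pexec c \<sigma> \<sigma>' \<Longrightarrow> exec X c (\<sigma>, s) (\<sigma>', s)"
  by (cases s) (simp add: pexec_def)

lemma sequence_tape_read:
  defines "p \<equiv> \<lambda>f t. (\<Sum>j<t. f j) + t"
  shows "d < f t \<Longrightarrow> sequence_tape f (p f t + d) = 1" "sequence_tape f (p f t + f t) = 0"
proof -
  have p_Suc: "p f (Suc k) = Suc ((\<Sum>j\<le>k. f j) + k)" for k
    by (simp add: p_def lessThan_Suc_atMost)
  have "mono (p f)" by (simp add: mono_iff_le_Suc p_def)
  \<comment> \<open>The separators of earlier blocks lie before \<open>p f t\<close>, those of block
    \<open>t\<close> and later blocks not before \<open>p f t + f t\<close>.\<close>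
  have "p f t + d \<noteq> (\<Sum>j\<le>k. f j) + k" if "d < f t" for k
  proof (cases "k < t")
    case True
    then have "p f (Suc k) \<le> p f t" using \<open>mono (p f)\<close> by (simp add: monoD)
    then show ?thesis using p_Suc by simp
  next
    case False
    then have "p f (Suc t) \<le> p f (Suc k)" using \<open>mono (p f)\<close> by (simp add: monoD)
    moreover have "p f (Suc t) = Suc (p f t + f t)" by (simp add: p_def)
    ultimately show ?thesis using p_Suc[of k] that by simp
  qed
  then show "d < f t \<Longrightarrow> sequence_tape f (p f t + d) = 1" by (simp add: sequence_tape_def)
  have "p f t + f t = (\<Sum>j\<le>t. f j) + t" by (simp add: p_def lessThan_Suc_atMost[symmetric])
  then show "sequence_tape f (p f t + f t) = 0" by (auto simp: sequence_tape_def)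
qed

fun stage :: "(nat \<Rightarrow> nat) \<Rightarrow> (nat \<Rightarrow> nat) \<Rightarrow> (nat \<Rightarrow> nat) \<Rightarrow> nat \<Rightarrow> nat" where
  "stage f u v 0 = 0"
| "stage f u v (Suc t) = f (ppair (stage f u v t) (ppair (u t) (v t)))"

text \<open>The shift by one leaves the value 0 for a stage without output.\<close>

definition letter :: "nat \<Rightarrow> symbol list" where
  "letter k = (if k = 0 then [] else if k = 1 then [0] else [1])"

fun emitted :: "(nat \<Rightarrow> nat) \<Rightarrow> (nat \<Rightarrow> nat) \<Rightarrow> (nat \<Rightarrow> nat) \<Rightarrow> nat \<Rightarrow> symbol list" where
  "emitted f u v 0 = []"
| "emitted f u v (Suc t) = emitted f u v t @ letter (pfst (stage f u v (Suc t)))"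

text \<open>Register 0 holds the constant 1 that keeps the outer loop running, and register 1 the
  state between stages. The other registers are scratch and are zero at both ends of a
  stage.\<close>

definition stage_com :: "com \<Rightarrow> com \<Rightarrow> com" where
  "stage_com c d = Read False 2;; Read True 3;; pair_com 2 3 4 5;; pair_com 1 4 2 3;;
    move_com 2 1;; c;; copy_com 1 2 3;; move_com 2 1;; d;;
    Cond 3 (Dec 3;; Cond 3 (clear_com 3;; Out True) (Out False)) Skip"

lemma exec_stage_com:
  assumes c: "computes 1 f c" and d: "computes 3 (\<lambda>x. pfst x) d"
  shows "exec (\<lambda>b. sequence_tape (if b then v else u)) (stage_com c d)
    ((\<lambda>_. 0)(0 := 1, 1 := z), (\<lambda>b. (\<Sum>j<t. if b then v j else u j) + t), w)
    ((\<lambda>_. 0)(0 := 1, 1 := f (ppair z (ppair (u t) (v t)))),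
      (\<lambda>b. (\<Sum>j<Suc t. if b then v j else u j) + Suc t),
      w @ letter (pfst (f (ppair z (ppair (u t) (v t))))))"
proof -
  let ?X = "\<lambda>b. sequence_tape (if b then v else u)"
  let ?z = "f (ppair z (ppair (u t) (v t)))"
  let ?h = "\<lambda>b. (\<Sum>j<t. if b then v j else u j) + t"
  let ?h' = "\<lambda>b. (\<Sum>j<Suc t. if b then v j else u j) + Suc t"
  let ?\<sigma>z = "(\<lambda>_. 0)(0 := 1, 1 := z) :: nat \<Rightarrow> nat"
  let ?\<sigma> = "(\<lambda>_. 0)(0 := 1, 1 := ?z) :: nat \<Rightarrow> nat"
  have R1: "exec ?X (Read False 2) (?\<sigma>z, ?h, w)
      (?\<sigma>z(2 := ?\<sigma>z 2 + u t), ?h(False := Suc (?h False + u t)), w)"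
    by (rule exec_Read) (use sequence_tape_read[where f = u and t = t] in auto)
  have R2: "exec ?X (Read True 3) (\<sigma>, ?h(False := Suc (?h False + u t)), w)
      (\<sigma>(3 := \<sigma> 3 + v t), ?h(False := Suc (?h False + u t), True := Suc (?h True + v t)), w)"
    for \<sigma>
    using exec_Read[where X = ?X and k = "v t" and i = True and r = 3 and w = w and \<sigma> = \<sigma>
        and hs = "?h(False := Suc (?h False + u t))"]
      sequence_tape_read[where f = v and t = t] by simp
  have h': "?h(False := Suc (?h False + u t), True := Suc (?h True + v t)) = ?h'"
    by (auto simp: fun_eq_iff)
  have P1: "pexec (pair_com 2 3 4 5) (?\<sigma>z(2 := u t, 3 := v t)) (?\<sigma>z(4 := ppair (u t) (v t)))"
    by (rule pexec_pair[THEN pexec_cong]) (auto simp: fun_eq_iff)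
  have P2: "pexec (pair_com 1 4 2 3) (?\<sigma>z(4 := y)) ((\<lambda>_. 0)(0 := 1, 2 := ppair z y))" for y
    by (rule pexec_pair[THEN pexec_cong]) (auto simp: fun_eq_iff)
  have P3: "pexec (move_com 2 1) ((\<lambda>_. 0)(0 := 1, 2 := y)) ((\<lambda>_. 0)(0 := 1, 1 := y))" for y
    by (rule pexec_move[THEN pexec_cong]) (auto simp: fun_eq_iff)
  have P4: "pexec c ((\<lambda>_. 0)(0 := 1, 1 := y)) ((\<lambda>_. 0)(0 := 1, 1 := f y))" for y
    by (rule pexec_computes[OF c, THEN pexec_cong]) (auto simp: fun_eq_iff)
  have P5: "pexec (copy_com 1 2 3) ?\<sigma> ((\<lambda>_. 0)(0 := 1, 2 := ?z, 3 := ?z))"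
    by (rule pexec_copy[THEN pexec_cong]) (auto simp: fun_eq_iff)
  have P6: "pexec (move_com 2 1) ((\<lambda>_. 0)(0 := 1, 2 := ?z, 3 := ?z)) (?\<sigma>(3 := ?z))"
    by (rule pexec_move[THEN pexec_cong]) (auto simp: fun_eq_iff)
  have P7: "pexec d (?\<sigma>(3 := ?z)) (?\<sigma>(3 := pfst ?z))"
    by (rule pexec_computes[OF d, THEN pexec_cong]) (auto simp: fun_eq_iff)
  have out: "exec X (Cond 3 (Dec 3;; Cond 3 (clear_com 3;; Out True) (Out False)) Skip)
      (?\<sigma>(3 := y), hs, w) (?\<sigma>, hs, w @ letter y)" for X y hs
  proof (rule exec_Cond, goal_cases)
    case 1
    have D: "exec X (Dec 3) (?\<sigma>(3 := y), hs, w) (?\<sigma>(3 := y - 1), hs, w)"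
      by (rule exec_pexec, rule pexec_Dec[THEN pexec_cong]) (auto simp: fun_eq_iff)
    have C: "exec X (clear_com 3) (?\<sigma>(3 := y - 1), hs, w) (?\<sigma>, hs, w)"
      by (rule exec_pexec, rule pexec_clear[THEN pexec_cong]) (auto simp: fun_eq_iff)
    have O: "exec X (Out b) (?\<sigma>, hs, w) (?\<sigma>, hs, w @ [if b then 1 else 0])" for b
      by (rule exec_Out)
    consider "y = 0" | "y = 1" | "y \<ge> 2" by linarith
    then show ?case
    proof cases
      case 1
      moreover have "?\<sigma>(3 := 0) = ?\<sigma>" by (auto simp: fun_eq_iff)
      ultimately show ?thesis using exec_Skip by (simp add: letter_def)
    next
      case 2
      moreover have "?\<sigma>(3 := 0) = ?\<sigma>" by (auto simp: fun_eq_iff)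
      ultimately show ?thesis
        using exec_Seq[OF D exec_Cond] O[of False] by (simp add: letter_def)
    next
      case 3
      then show ?thesis
        using exec_Seq[OF D exec_Cond] exec_Seq[OF C O[of True]] by (simp add: letter_def)
    qed
  qed
  show ?thesis
    unfolding stage_com_def
    apply (rule exec_Seq[OF R1])
    apply (rule exec_Seq[OF R2[unfolded h']])
    apply (rule exec_Seq[OF exec_pexec])
     apply (rule P1[THEN back_subst[of "\<lambda>\<sigma>. pexec _ \<sigma> _"]])
     apply (simp add: fun_eq_iff)
    apply (intro exec_Seq[OF exec_pexec[OF P2]] exec_Seq[OF exec_pexec[OF P3]]
        exec_Seq[OF exec_pexec[OF P4]] exec_Seq[OF exec_pexec[OF P5]]
        exec_Seq[OF exec_pexec[OF P6]] exec_Seq[OF exec_pexec[OF P7]])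
    apply (rule out)
    done
qed

text \<open>The loop has no exit, so the claim concerns the output present after each stage, which
  is what \<open>outputs_sequence\<close> asks about.\<close>

lemma computes_stages:
  assumes "pr f"
  shows "\<exists>M. type2_machine M \<and> num_inputs M = 2 \<and>
    (\<forall>u v t. \<exists>t'. written (run M [sequence_tape u, sequence_tape v] t') = emitted f u v t)"
proof -
  obtain c where c: "computes 1 f c" using computes_pr[OF assms] by blast
  obtain d where d: "computes 3 (\<lambda>x. pfst x) d" using computes_pr[OF pr_fst_basic] by blast
  define L where "L = While 0 (stage_com c d)"
  define P where "P = Inc 0;; L"
  obtain h where h: "bij_betw h (sub_coms P) {..<card (sub_coms P)}"
    using ex_bij_betw_finite_nat[OF finite_sub_coms[of P]] by (auto simp: atLeast0LessThan)
  obtain n where n: "regs_below n P" using ex_regs_below by blast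
  have "\<exists>t'. written (run (com_machine h P n) [sequence_tape u, sequence_tape v] t') =
      emitted f u v t" for u v t
  proof -
    define X where "X = (\<lambda>b. sequence_tape (if b then v else u))"
    have "steps X (P, (\<lambda>_. 0), (\<lambda>_. 0), [])
      (L, (\<lambda>_. 0)(0 := 1, 1 := stage f u v t), (\<lambda>b. (\<Sum>j<t. if b then v j else u j) + t),
       emitted f u v t)"
    proof (induction t)
      case 0
      have "exec X (Inc 0) (\<lambda>_. 0, \<lambda>_. 0, []) ((\<lambda>_. 0)(0 := 1, 1 := 0), \<lambda>_. 0, [])"
        by (rule exec_pexec, rule pexec_Inc[THEN pexec_cong]) (auto simp: fun_eq_iff)
      from steps_Seq_exec[OF this, of L] show ?case by (simp add: P_def fun_upd_def)
    next
      case (Suc t)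
      show ?case
        by (rule steps_trans[OF Suc], unfold L_def emitted.simps stage.simps, rule steps_While)
          (use exec_stage_com[OF c d] in \<open>simp_all add: X_def fun_upd_def\<close>)
    qed
    from run_com_machine[OF h n this] obtain t' where
      "run (com_machine h P n) [X False, X True] t' = com_config h n
        (L, (\<lambda>_. 0)(0 := 1, 1 := stage f u v t), (\<lambda>b. (\<Sum>j<t. if b then v j else u j) + t),
         emitted f u v t)" by blast
    then have "written (run (com_machine h P n) [X False, X True] t') = emitted f u v t"
      by (simp add: com_config_def)
    then show ?thesis by (auto simp: X_def)
  qed
  moreover have "num_inputs (com_machine h P n) = 2" by (simp add: com_machine_def)
  ultimately show ?thesis using type2_machine_com[OF h n] by blast
qed

section \<open>Simulation of a machine\<close>


text \<open>
  A tape with its head is coded by two streams of symbols, to the left and to the right of the head.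
  The blank and 0 are exchanged, so that the code 0 is an empty stream of blanks.
\<close>

definition swap_blank :: "nat \<Rightarrow> nat" where
  "swap_blank s = (if s = 0 then blank else if s = blank then 0 else s)"

lemma swap_blank_swap_blank: "swap_blank (swap_blank s) = s"
  by (simp add: swap_blank_def)

definition codes_tape :: "nat \<Rightarrow> (int \<Rightarrow> symbol) \<times> int \<Rightarrow> bool" where
  "codes_tape y = (\<lambda>(t, h). \<forall>j. t (h + int j) = swap_blank (component j (psnd y)) \<and>
    t (h - 1 - int j) = swap_blank (component j (pfst y)))"

text \<open>The streams act as two stacks: a move pops a symbol from one and pushes a symbol on the
  other. Popping from the code 0 yields a blank and again 0.\<close>

fun act_code :: "symbol \<Rightarrow> direction \<Rightarrow> nat \<Rightarrow> nat" where
  "act_code a Left y =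
    ppair (psnd (pfst y)) (ppair (pfst (pfst y)) (ppair (swap_blank a) (psnd (psnd y))))"
| "act_code a Stay y = ppair (pfst y) (ppair (swap_blank a) (psnd (psnd y)))"
| "act_code a Right y = ppair (ppair (swap_blank a) (pfst y)) (psnd (psnd y))"

lemma codes_tape_act:
  assumes "codes_tape y (t, h)"
  shows "codes_tape (act_code a d y) (t(h := a), h + shift d)"
proof -
  have r: "t (h + int j) = swap_blank (component j (psnd y))"
    and l: "t (h - 1 - int j) = swap_blank (component j (pfst y))" for j
    using assms by (auto simp: codes_tape_def)
  have r': "(t(h := a)) (h + int j) =
      swap_blank (component j (ppair (swap_blank a) (psnd (psnd y))))" for j
    using r[of j] by (cases j) (simp_all add: swap_blank_swap_blank)
  have l': "(t(h := a)) (h - 1 - int j) = swap_blank (component j (pfst y))" for j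
    using l[of j] by simp
  show ?thesis
  proof (cases d)
    case Stay
    then show ?thesis using r' l' by (simp add: codes_tape_def)
  next
    case Left
    have "(t(h := a)) (h - 1 + int j) = swap_blank (component j
        (ppair (pfst (pfst y)) (ppair (swap_blank a) (psnd (psnd y)))))" for j
    proof (cases j)
      case 0
      then show ?thesis using l'[of 0] by simp
    next
      case (Suc i)
      then show ?thesis using r'[of i] by simp
    qed
    moreover have "(t(h := a)) (h - 1 - 1 - int j) = swap_blank (component j (psnd (pfst y)))" for j
      using l'[of "Suc j"] by (simp add: algebra_simps)
    ultimately show ?thesis using Left by (simp add: codes_tape_def)
  next
    case Right
    have "(t(h := a)) (h + 1 + int j) = swap_blank (component j (psnd (psnd y)))" for j
      using r'[of "Suc j"] by (simp add: algebra_simps)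
    moreover have "(t(h := a)) (h - int j) =
        swap_blank (component j (ppair (swap_blank a) (pfst y)))" for j
    proof (cases j)
      case 0
      then show ?thesis using r'[of 0] by simp
    next
      case (Suc i)
      then show ?thesis using l'[of i] by (simp add: algebra_simps)
    qed
    ultimately show ?thesis using Right
      by (simp add: codes_tape_def del: component.simps fun_upd_apply)
  qed
qed

lemma pr_act_code: "pr f \<Longrightarrow> pr (\<lambda>x. act_code a d (f x))"
  by (cases d) (simp_all add: pr_pair pr_fst pr_snd pr_const)

lemma pr_swap_blank: "pr f \<Longrightarrow> pr (\<lambda>x. swap_blank (f x))"
  unfolding swap_blank_def by (intro pr_if prd_eq pr_const)

text \<open>
  Components of the code of a configuration: the state, the position of the input head, the number
  of written letters, the length of the input word, and the tapes.
\<close>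

definition observers :: "nat \<Rightarrow> (nat \<Rightarrow> nat) list" where
  "observers n = [component 0, \<lambda>x. if component 1 x < component 3 x then 1 else blank] @
    map (\<lambda>i x. swap_blank (component 0 (psnd (component (4 + i) x)))) [0..<n]"

definition observe :: "nat \<Rightarrow> nat \<Rightarrow> nat list" where
  "observe n x = map (\<lambda>f. f x) (observers n)"

definition observed_delta where
  "observed_delta M l = delta M (l ! 0) [l ! 1] (drop 2 l)"

definition apply_code :: "nat \<Rightarrow>
    (nat \<times> bool list \<times> (symbol \<times> direction) list \<times> symbol option) option \<Rightarrow> nat \<Rightarrow> nat" where
  "apply_code n r x = (case r of None \<Rightarrow> x | Some (q, adv, acts, out) \<Rightarrow>
    tuple ([q, component 1 x + (if adv ! 0 then 1 else 0),
      component 2 x + (if out = None then 0 else 1), component 3 x] @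
      map (\<lambda>i. act_code (fst (acts ! i)) (snd (acts ! i)) (component (4 + i) x)) [0..<n]))"

text \<open>A finite set covering all that can be observed in a run, as
  \<open>pr_finite_cases\<close> requires. The common bound serves for the state, which is the first
  entry, and for the symbols.\<close>

definition observations :: "machine \<Rightarrow> nat list set" where
  "observations M = {l. set l \<subseteq> {..<max (num_states M) (num_symbols M)} \<and> length l = num_works M + 2}"

definition step_code :: "machine \<Rightarrow> nat \<Rightarrow> nat" where
  "step_code M x = (let l = observe (num_works M) x in
    if l \<in> observations M then apply_code (num_works M) (observed_delta M l) x else x)"

definition halted_code :: "machine \<Rightarrow> nat \<Rightarrow> bool" where
  "halted_code M x \<longleftrightarrow> (let l = observe (num_works M) x in
    l \<in> observations M \<and> observed_delta M l = None)"

lemma finite_observations: "finite (observations M)"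
  unfolding observations_def by (rule finite_lists_length_eq) simp

lemma pr_observers: "f \<in> set (observers n) \<Longrightarrow> pr f"
proof -
  have "pr (component j)" for j
    using pr_component[OF pr_const pr_id] by simp
  then show "f \<in> set (observers n) \<Longrightarrow> pr f"
    by (auto simp: observers_def
        intro!: pr_if prd_less pr_const pr_swap_blank pr_fst pr_snd pr_component pr_id)
qed

lemma pr_apply_code: "pr (apply_code n r)"
proof (cases r)
  case None
  then have "apply_code n r = (\<lambda>x. x)" by (simp add: apply_code_def fun_eq_iff)
  then show ?thesis by (simp add: pr_id)
next
  case (Some p)
  then obtain q adv acts out where r: "r = Some (q, adv, acts, out)" by (cases p) auto
  let ?fs = "[\<lambda>_. q, \<lambda>x. component 1 x + (if adv ! 0 then 1 else 0),
      \<lambda>x. component 2 x + (if out = None then 0 else 1), \<lambda>x. component 3 x] @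
      map (\<lambda>i x. act_code (fst (acts ! i)) (snd (acts ! i)) (component (4 + i) x)) [0..<n]"
  have "pr (\<lambda>x. tuple (map (\<lambda>f. f x) ?fs))"
  proof (rule pr_tuple)
    fix f assume "f \<in> set ?fs"
    moreover have "pr (\<lambda>x. component j x)" for j
      using pr_component[OF pr_const pr_id] by simp
    ultimately show "pr f"
      by (auto intro!: pr_const pr_add pr_act_code pr_fst pr_snd pr_id)
  qed
  moreover have "apply_code n r = (\<lambda>x. tuple (map (\<lambda>f. f x) ?fs))"
    by (simp add: apply_code_def r fun_eq_iff comp_def)
  ultimately show ?thesis by simp
qed

lemma pr_step_code: "pr (step_code M)"
proof -
  have "step_code M = (\<lambda>x. if map (\<lambda>f. f x) (observers (num_works M)) \<in> observations M
      then apply_code (num_works M) (observed_delta M (map (\<lambda>f. f x) (observers (num_works M)))) x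
      else x)"
    by (simp add: step_code_def observe_def fun_eq_iff Let_def)
  moreover have "pr \<dots>"
    by (rule pr_finite_cases)
      (simp_all add: finite_observations pr_apply_code pr_id pr_observers)
  ultimately show ?thesis by simp
qed

lemma prd_halted_code: "prd (halted_code M)"
proof -
  have "(\<lambda>x. if halted_code M x then 1 else 0::nat) =
    (\<lambda>x. if map (\<lambda>f. f x) (observers (num_works M)) \<in> observations M
      then (\<lambda>l x. if observed_delta M l = None then 1 else 0)
        (map (\<lambda>f. f x) (observers (num_works M))) x else 0)"
    by (auto simp: halted_code_def observe_def fun_eq_iff Let_def)
  moreover have "pr \<dots>"
    by (rule pr_finite_cases) (simp_all add: finite_observations pr_const pr_observers)
  ultimately show ?thesis unfolding prd_def by (simp only:)
qed

text \<open>The written word enters only by its length, since the outputs of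
  \<open>computable_nat_fun\<close> are unary. The bounds on state and symbols keep the observation
  inside the table.\<close>

definition codes_config :: "machine \<Rightarrow> nat \<Rightarrow> nat \<Rightarrow> config \<Rightarrow> bool" where
  "codes_config M e x c \<longleftrightarrow>
    state c = component 0 x \<and> in_heads c = [component 1 x] \<and> length (written c) = component 2 x \<and>
    component 3 x = e \<and> length (works c) = num_works M \<and>
    (\<forall>i<num_works M. codes_tape (component (4 + i) x) (works c ! i)) \<and>
    state c < num_states M \<and> (\<forall>i<num_works M. \<forall>z. fst (works c ! i) z < num_symbols M)"

lemma codes_config_step:
  assumes M: "type2_machine M" "num_inputs M = 1" and x: "codes_config M e x c"
  defines "c' \<equiv> step M [word_tape (replicate e 1)] c"
  shows "halted_code M x \<longleftrightarrow> c' = None"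
    and "codes_config M e (step_code M x) (case c' of None \<Rightarrow> c | Some d \<Rightarrow> d)"
proof -
  let ?n = "num_works M"
  let ?as = "map2 (\<lambda>x h. x h) [word_tape (replicate e 1)] (in_heads c)"
  let ?bs = "map (\<lambda>(t, h). t h) (works c)"
  have head: "t h = swap_blank (component 0 (psnd y))" if "codes_tape y (t, h)" for t h y
  proof -
    have "t (h + int 0) = swap_blank (component 0 (psnd y))"
      using that unfolding codes_tape_def by blast
    then show ?thesis by simp
  qed
  have bs: "?bs ! i = swap_blank (component 0 (psnd (component (4 + i) x)))" if "i < ?n" for i
    using x that head[of "component (4 + i) x" "fst (works c ! i)" "snd (works c ! i)"]
    by (simp add: codes_config_def split_beta)
  have obs: "observe ?n x = state c # hd ?as # ?bs"
  proof -
    have "?bs = map (\<lambda>i. swap_blank (component 0 (psnd (component (4 + i) x)))) [0..<?n]"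
      by (rule nth_equalityI) (use x bs in \<open>auto simp: codes_config_def\<close>)
    moreover have "hd ?as = (if component 1 x < component 3 x then 1 else blank)"
      using x by (simp add: codes_config_def word_tape_def)
    ultimately show ?thesis
      using x by (simp add: observe_def observers_def codes_config_def comp_def)
  qed
  have as: "?as = [hd ?as]" using x by (simp add: codes_config_def)
  have as': "set ?as \<subseteq> {..<num_symbols M}"
    using x M by (auto simp: codes_config_def word_tape_def type2_machine_def)
  have bs': "set ?bs \<subseteq> {..<num_symbols M}"
    using x by (auto simp: codes_config_def in_set_conv_nth split: prod.splits) (metis fst_conv)
  have in_obs: "observe ?n x \<in> observations M"
    unfolding obs observations_def using as' bs' x
    by (subst (asm) as) (auto simp: codes_config_def less_max_iff_disj subset_iff)
  have od: "observed_delta M (observe ?n x) = delta M (state c) ?as ?bs"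
    unfolding observed_delta_def obs by (subst (2) as) simp
  show "halted_code M x \<longleftrightarrow> c' = None"
    using in_obs od by (simp add: halted_code_def c'_def step_def split: option.split prod.split)
  show "codes_config M e (step_code M x) (case c' of None \<Rightarrow> c | Some d \<Rightarrow> d)"
  proof (cases "delta M (state c) ?as ?bs")
    case None
    then show ?thesis
      using in_obs od x by (simp add: step_code_def c'_def step_def apply_code_def)
  next
    case (Some r)
    then obtain q adv acts out where
      r: "delta M (state c) ?as ?bs = Some (q, adv, acts, out)" by (cases r) auto
    have valid: "q < num_states M \<and> length adv = 1 \<and> length acts = ?n \<and>
        fst ` set acts \<subseteq> {..<num_symbols M}"
    proof -
      have "length ?as = num_inputs M" "length ?bs = ?n" "state c < num_states M"
        using x M(2) by (auto simp: codes_config_def)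
      with M as' bs' r show ?thesis unfolding type2_machine_def by (metis (no_types, lifting))
    qed
    obtain b where adv: "adv = [b]" using valid by (auto simp: length_Suc_conv)
    have sc: "step_code M x = apply_code ?n (Some (q, adv, acts, out)) x"
      using in_obs od r by (simp add: step_code_def)
    have comps: "component 0 (step_code M x) = q"
      "component 1 (step_code M x) = component 1 x + (if b then 1 else 0)"
      "component 2 (step_code M x) = component 2 x + (if out = None then 0 else 1)"
      "component 3 (step_code M x) = component 3 x"
      and comps': "i < ?n \<Longrightarrow> component (4 + i) (step_code M x) =
        act_code (fst (acts ! i)) (snd (acts ! i)) (component (4 + i) x)" for i
      unfolding sc apply_code_def by (simp_all add: component_tuple adv del: tuple.simps component.simps)
    define ws where "ws = map2 (\<lambda>(t, h) (a, d). (t(h := a), h + shift d)) (works c) acts"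
    have ws: "ws ! i = ((fst (works c ! i))(snd (works c ! i) := fst (acts ! i)),
        snd (works c ! i) + shift (snd (acts ! i)))" if "i < ?n" for i
      using that x valid by (auto simp: ws_def codes_config_def split: prod.split)
    have c': "c' = Some \<lparr>state = q, in_heads = [if b then Suc (component 1 x) else component 1 x],
        works = ws, written = written c @ (case out of None \<Rightarrow> [] | Some a \<Rightarrow> [a])\<rparr>"
      using r x adv by (simp add: c'_def step_def ws_def codes_config_def)
    show ?thesis
      unfolding c' codes_config_def option.case comps
    proof (intro conjI allI impI, goal_cases)
      case (6 i)
      have "codes_tape (component (4 + i) x) (fst (works c ! i), snd (works c ! i))"
        using 6 x by (simp add: codes_config_def)
      from codes_tape_act[OF this] show ?case using 6 comps' ws by simp
    next
      case (8 i z)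
      have "fst (acts ! i) < num_symbols M"
        using valid 8 by (auto simp: subset_iff)
      then show ?case using 8 ws x by (simp add: codes_config_def)
    qed (use x valid in \<open>auto simp: ws_def codes_config_def split: option.split\<close>)
  qed
qed

lemma run_halted:
  assumes "step M xs (run M xs t) = None" "t \<le> t'"
  shows "run M xs t' = run M xs t"
  using assms(2) by (induction rule: dec_induct) (simp_all add: assms(1))

text \<open>\<open>H c e t\<close> is to say that the machine started on \<open>c\<close> has halted
  within \<open>t\<close> steps with \<open>e\<close> letters written. A run with a step bound is
  primitive recursive whether or not \<open>g\<close> is. A halted run no longer changes, which
  gives uniqueness of \<open>e\<close> and persistence in \<open>t\<close>.\<close>

lemma computable_nat_fun_simulation:
  assumes "computable_nat_fun g"
  obtains H where "prd (\<lambda>p. H (pfst p) (pfst (psnd p)) (psnd (psnd p)))"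
    "\<And>c e t. H c e t \<Longrightarrow> g c = e" "\<And>c. \<exists>T. \<forall>t\<ge>T. H c (g c) t"
proof -
  obtain M where M: "type2_machine M" "num_inputs M = 1"
    and out: "\<And>e. outputs_word M [word_tape (replicate e 1)] (replicate (g e) 1)"
    using assms unfolding computable_nat_fun_def by blast
  define x where "x c t = (step_code M ^^ t) (tuple [0, 0, 0, c])" for c t
  define H where "H c e t \<longleftrightarrow> halted_code M (x c t) \<and> component 2 (x c t) = e" for c e t
  let ?run = "\<lambda>c. run M [word_tape (replicate c 1)]"
  have x: "codes_config M c (x c t) (?run c t)" for c t
  proof (induction t)
    case 0
    \<comment> \<open>Initial code: state 0, head on cell 0, nothing written, input length
      \<open>c\<close>. All further components are 0, the code of a blank tape.\<close>
    have tuple: "component j (tuple [0, 0, 0, c]) = (if j = 3 then c else 0)" for j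
      by (auto simp: component_tuple nth_Cons' simp del: tuple.simps)
    have "prod_decode 0 = (0, 0)" by (simp add: prod_decode_def prod_decode_aux.simps)
    then have "codes_tape 0 (\<lambda>_. blank, 0)"
      by (simp add: codes_tape_def component_0 swap_blank_def)
    then show ?case
      using M unfolding x_def funpow_0 codes_config_def tuple
      by (simp add: init_config_def type2_machine_def del: tuple.simps component.simps)
  next
    case (Suc t)
    from codes_config_step(2)[OF M Suc] show ?case
      by (simp only: x_def funpow.simps o_apply run.simps)
  qed
  have halted: "halted_code M (x c t) \<longleftrightarrow> step M [word_tape (replicate c 1)] (?run c t) = None"
    for c t by (rule codes_config_step(1)[OF M x])
  have len: "component 2 (x c t) = length (written (?run c t))" for c t
    using x[of c t] by (simp add: codes_config_def del: component.simps)
  have out': "\<exists>T. step M [word_tape (replicate c 1)] (?run c T) = None \<and>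
      length (written (?run c T)) = g c" for c
    using out[of c] unfolding outputs_word_def by fastforce
  show ?thesis
  proof (rule that[of H])
    show "g c = e" if "H c e t" for c e t
    proof -
      obtain T where T: "step M [word_tape (replicate c 1)] (?run c T) = None"
        "length (written (?run c T)) = g c" using out' by blast
      have t: "step M [word_tape (replicate c 1)] (?run c t) = None" "length (written (?run c t)) = e"
        using that halted len by (auto simp: H_def simp del: component.simps)
      have "?run c T = ?run c t"
        using run_halted[OF T(1)] run_halted[OF t(1)] linear by metis
      with T t show ?thesis by simp
    qed
    show "\<exists>T. \<forall>t\<ge>T. H c (g c) t" for c
    proof -
      obtain T where T: "step M [word_tape (replicate c 1)] (?run c T) = None"
        "length (written (?run c T)) = g c" using out' by blast
      have "H c (g c) t" if "T \<le> t" for t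
        unfolding H_def halted len run_halted[OF T(1) that] using T by simp
      then show ?thesis by blast
    qed
    have "pr2 (\<lambda>_. step_code M)"
      unfolding pr2_def by (rule pr_comp[OF pr_step_code pr_snd_basic])
    moreover have "pr (\<lambda>p. tuple [0, 0, 0, pfst p])"
      by (simp add: pr_pair pr_const pr_fst_basic)
    ultimately have "pr (\<lambda>p. x (pfst p) (psnd (psnd p)))"
      unfolding x_def by (intro pr_funpow pr_snd pr_id)
    then show "prd (\<lambda>p. H (pfst p) (pfst (psnd p)) (psnd (psnd p)))"
      unfolding H_def
      by (intro prd_conj prd_comp[OF prd_halted_code] prd_eq pr_component pr_const pr_fst pr_snd pr_id)
  qed
qed

section \<open>Functions with rational values\<close>


text \<open>A difference as numerator avoids a sign, a successor as denominator avoids division by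
  zero. The functions have real values so that geometric formulas can be treated as they
  stand.\<close>

definition prat :: "(nat \<Rightarrow> real) \<Rightarrow> bool" where
  "prat f \<longleftrightarrow> (\<exists>a b d. pr a \<and> pr b \<and> pr d \<and>
    (\<forall>x. f x = (real (a x) - real (b x)) / real (Suc (d x))))"

lemma pratI:
  assumes "pr a" "pr b" "pr d" "\<And>x. f x = (real (a x) - real (b x)) / real (Suc (d x))"
  shows "prat f"
  using assms unfolding prat_def by blast

lemma pratE:
  assumes "prat f"
  obtains a b d where "pr a" "pr b" "pr d"
    "\<And>x. f x = (real (a x) - real (b x)) / real (Suc (d x))"
  using assms unfolding prat_def by blast

lemma prat_nat: "pr f \<Longrightarrow> prat (\<lambda>x. real (f x))"
  by (rule pratI[of f "\<lambda>_. 0" "\<lambda>_. 0"]) (simp_all add: pr_const)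

lemma prat_const_nat: "prat (\<lambda>_. real k)"
  by (rule prat_nat[OF pr_const])

lemma prat_numeral: "prat (\<lambda>_. numeral k)"
  using prat_const_nat[of "numeral k"] by simp

lemma prat_0: "prat (\<lambda>_. 0)" and prat_1: "prat (\<lambda>_. 1)"
  using prat_const_nat[of 0] prat_const_nat[of 1] by simp_all

lemma prat_add: assumes "prat f" "prat g" shows "prat (\<lambda>x. f x + g x)"
proof -
  obtain a b d where f: "pr a" "pr b" "pr d"
    "\<And>x. f x = (real (a x) - real (b x)) / real (Suc (d x))" using assms(1) by (elim pratE) blast
  obtain a' b' d' where g: "pr a'" "pr b'" "pr d'"
    "\<And>x. g x = (real (a' x) - real (b' x)) / real (Suc (d' x))" using assms(2) by (elim pratE) blast
  show ?thesis
  proof (rule pratI)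
    show "f x + g x = (real (a x * Suc (d' x) + a' x * Suc (d x)) -
        real (b x * Suc (d' x) + b' x * Suc (d x))) / real (Suc (Suc (d x) * Suc (d' x) - 1))" for x
    proof -
      have "Suc (Suc (d x) * Suc (d' x) - 1) = Suc (d x) * Suc (d' x)" by simp
      then show ?thesis
        by (simp only: f g of_nat_add of_nat_mult) (simp add: field_simps del: of_nat_Suc)
    qed
  qed (intro pr_add pr_mult pr_Suc pr_diff pr_const f g)+
qed

lemma prat_minus: assumes "prat f" shows "prat (\<lambda>x. - f x)"
proof -
  obtain a b d where f: "pr a" "pr b" "pr d"
    "\<And>x. f x = (real (a x) - real (b x)) / real (Suc (d x))" using assms(1) by (elim pratE) blast
  show ?thesis
    by (rule pratI[of b a d]) (simp_all add: f divide_simps)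
qed

lemma prat_diff: "prat f \<Longrightarrow> prat g \<Longrightarrow> prat (\<lambda>x. f x - g x)"
  using prat_add[OF _ prat_minus, of f g] by simp

lemma prat_mult: assumes "prat f" "prat g" shows "prat (\<lambda>x. f x * g x)"
proof -
  obtain a b d where f: "pr a" "pr b" "pr d"
    "\<And>x. f x = (real (a x) - real (b x)) / real (Suc (d x))" using assms(1) by (elim pratE) blast
  obtain a' b' d' where g: "pr a'" "pr b'" "pr d'"
    "\<And>x. g x = (real (a' x) - real (b' x)) / real (Suc (d' x))" using assms(2) by (elim pratE) blast
  show ?thesis
  proof (rule pratI)
    show "f x * g x = (real (a x * a' x + b x * b' x) - real (a x * b' x + b x * a' x)) /
        real (Suc (Suc (d x) * Suc (d' x) - 1))" for x
    proof -
      have "Suc (Suc (d x) * Suc (d' x) - 1) = Suc (d x) * Suc (d' x)" by simp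
      then show ?thesis
        by (simp only: f g of_nat_add of_nat_mult) (simp add: field_simps del: of_nat_Suc)
    qed
  qed (intro pr_add pr_mult pr_Suc pr_diff pr_const f g)+
qed

lemma prat_divide: assumes "prat f" "pr g" "\<And>x. g x > 0" shows "prat (\<lambda>x. f x / real (g x))"
proof -
  have "prat (\<lambda>x. 1 / real (g x))"
  proof (rule pratI[of "\<lambda>_. 1" "\<lambda>_. 0" "\<lambda>x. g x - 1"])
    show "1 / real (g x) = (real 1 - real 0) / real (Suc (g x - 1))" for x
      using assms(3)[of x] by simp
  qed (intro pr_const pr_diff assms)+
  from prat_mult[OF assms(1) this] show ?thesis by simp
qed

lemma prat_divide_numeral: "prat f \<Longrightarrow> prat (\<lambda>x. f x / numeral k)"
  using prat_divide[of f "\<lambda>_. numeral k"] pr_const by simp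

lemma prat_power2: "prat f \<Longrightarrow> prat (\<lambda>x. (f x)\<^sup>2)"
  using prat_mult[of f f] by (simp add: power2_eq_square)

lemma prat_comp: assumes "prat f" "pr g" shows "prat (\<lambda>x. f (g x))"
proof -
  obtain a b d where f: "pr a" "pr b" "pr d"
    "\<And>x. f x = (real (a x) - real (b x)) / real (Suc (d x))" using assms(1) by (elim pratE) blast
  show ?thesis
    by (rule pratI[of "\<lambda>x. a (g x)" "\<lambda>x. b (g x)" "\<lambda>x. d (g x)"])
      (rule pr_comp[OF _ assms(2)] f)+
qed

lemma prat_if: assumes "prd P" "prat f" "prat g" shows "prat (\<lambda>x. if P x then f x else g x)"
proof -
  obtain a b d where f: "pr a" "pr b" "pr d"
    "\<And>x. f x = (real (a x) - real (b x)) / real (Suc (d x))" using assms(2) by (elim pratE) blast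
  obtain a' b' d' where g: "pr a'" "pr b'" "pr d'"
    "\<And>x. g x = (real (a' x) - real (b' x)) / real (Suc (d' x))" using assms(3) by (elim pratE) blast
  show ?thesis
  proof (rule pratI)
    show "(if P x then f x else g x) =
        (real (if P x then a x else a' x) - real (if P x then b x else b' x)) /
        real (Suc (if P x then d x else d' x))" for x
      by (simp add: f g)
  qed (intro pr_if assms f g)+
qed

lemma prat_sum:
  assumes "finite A" "\<And>i. i \<in> A \<Longrightarrow> prat (\<lambda>x. f x i)"
  shows "prat (\<lambda>x. \<Sum>i\<in>A. f x i)"
  using assms by (induction A) (simp_all add: prat_add prat_0)

text \<open>Clearing the positive denominators and moving the subtracted terms across leaves an
  inequality of natural numbers.\<close>

lemma prd_less_real: assumes "prat f" "prat g" shows "prd (\<lambda>x. f x < g x)"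
proof -
  obtain a b d where f: "pr a" "pr b" "pr d"
    "\<And>x. f x = (real (a x) - real (b x)) / real (Suc (d x))" using assms(1) by (elim pratE) blast
  obtain a' b' d' where g: "pr a'" "pr b'" "pr d'"
    "\<And>x. g x = (real (a' x) - real (b' x)) / real (Suc (d' x))" using assms(2) by (elim pratE) blast
  have "f x < g x \<longleftrightarrow>
      a x * Suc (d' x) + b' x * Suc (d x) < a' x * Suc (d x) + b x * Suc (d' x)" for x
  proof -
    have "f x < g x \<longleftrightarrow>
        (real (a x) - real (b x)) * real (Suc (d' x)) < (real (a' x) - real (b' x)) * real (Suc (d x))"
      unfolding f g by (simp add: divide_simps del: of_nat_Suc)
    also have "\<dots> \<longleftrightarrow> real (a x * Suc (d' x) + b' x * Suc (d x)) <
        real (a' x * Suc (d x) + b x * Suc (d' x))"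
      by (simp only: of_nat_add of_nat_mult left_diff_distrib) linarith
    finally show ?thesis by (simp only: of_nat_less_iff)
  qed
  moreover have "prd (\<lambda>x. a x * Suc (d' x) + b' x * Suc (d x) < a' x * Suc (d x) + b x * Suc (d' x))"
    by (intro prd_less pr_add pr_mult pr_Suc f g)
  ultimately show ?thesis by (simp only:)
qed

lemma prd_le_real: "prat f \<Longrightarrow> prat g \<Longrightarrow> prd (\<lambda>x. f x \<le> g x)"
  using prd_not[OF prd_less_real, of g f] by (simp add: not_less)

lemma prat_max: "prat f \<Longrightarrow> prat g \<Longrightarrow> prat (\<lambda>x. max (f x) (g x))"
  unfolding max_def by (intro prat_if prd_le_real)

text \<open>An integral quotient is at most \<open>a x + b x\<close> in absolute value, so a bounded
  search finds it; the two disjuncts are its two signs. Integrality serves to recognize dyadic cubes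
  and to locate parents.\<close>

lemma prd_Ints: assumes "prat f" shows "prd (\<lambda>x. f x \<in> \<int>)"
proof -
  obtain a b d where f: "pr a" "pr b" "pr d"
    "\<And>x. f x = (real (a x) - real (b x)) / real (Suc (d x))" using assms(1) by (elim pratE) blast
  have "f x \<in> \<int> \<longleftrightarrow> (\<exists>y < Suc (a x + b x). a x = b x + y * Suc (d x) \<or> b x = a x + y * Suc (d x))"
    (is "_ \<longleftrightarrow> ?R") for x
  proof
    assume "f x \<in> \<int>"
    then obtain z where "f x = of_int z" by (auto elim: Ints_cases)
    then have "real (a x) - real (b x) = of_int z * real (Suc (d x))"
      using f(4)[of x] by (simp add: divide_simps del: of_nat_Suc)
    then have "real_of_int (int (a x) - int (b x)) = real_of_int (z * int (Suc (d x)))" by simp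
    then have z: "int (a x) - int (b x) = z * int (Suc (d x))" by (simp only: of_int_eq_iff)
    define y where "y = nat \<bar>z\<bar>"
    have "a x = b x + y * Suc (d x) \<or> b x = a x + y * Suc (d x)"
    proof (cases "z \<ge> 0")
      case True
      then have "int (a x) = int (b x + y * Suc (d x))" using z by (simp add: y_def algebra_simps)
      then show ?thesis unfolding of_nat_eq_iff by blast
    next
      case False
      then have "int (b x) = int (a x + y * Suc (d x))" using z by (simp add: y_def algebra_simps)
      then show ?thesis unfolding of_nat_eq_iff by blast
    qed
    moreover from this have "y < Suc (a x + b x)" by auto
    ultimately show ?R by blast
  next
    assume ?R
    then obtain y where "a x = b x + y * Suc (d x) \<or> b x = a x + y * Suc (d x)" by blast
    then have "real (a x) - real (b x) = real y * real (Suc (d x)) \<or>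
        real (a x) - real (b x) = - real y * real (Suc (d x))"
      by (elim disjE; simp only: of_nat_add of_nat_mult) simp_all
    then have "f x = real y \<or> f x = - real y"
      unfolding f(4) by (auto simp del: of_nat_Suc)
    then show "f x \<in> \<int>" by auto
  qed
  moreover have "prd (\<lambda>x. \<exists>y < Suc (a x + b x).
      a x = b x + y * Suc (d x) \<or> b x = a x + y * Suc (d x))"
    by (intro prd_Ex_less prd_disj prd_eq pr_Suc pr_add pr_mult pr_snd pr_id
        pr_comp[OF f(1)] pr_comp[OF f(2)] pr_comp[OF f(3)] pr_fst)
  ultimately show ?thesis by (simp only:)
qed

section \<open>Coded rationals and bounds for codes\<close>

lemma real_int_decode:
  "real_of_int (int_decode a) = (if even a then real a / 2 else - (real a + 1) / 2)"
  by (auto simp: int_decode_def sum_decode_def elim!: evenE oddE)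

lemma real_rat_of_code:
  "real_of_rat (rat_of_code e) = real_of_int (int_decode (pfst e)) / real (Suc (psnd e))"
  by (simp add: rat_of_code_def split_beta of_rat_divide del: of_nat_Suc)

lemma real_nonneg_rat_of_code:
  "real_of_rat (nonneg_rat_of_code e) = real (pfst e) / real (Suc (psnd e))"
  by (simp add: nonneg_rat_of_code_def split_beta of_rat_divide del: of_nat_Suc)

lemma prat_rat_of_code: assumes "pr f" shows "prat (\<lambda>x. real_of_rat (rat_of_code (f x)))"
  unfolding real_rat_of_code real_int_decode
  by (intro prat_divide prat_if prd_even pr_fst assms prat_divide_numeral prat_minus prat_add
      prat_nat prat_1 pr_Suc pr_snd) simp

lemma prat_nonneg_rat_of_code:
  assumes "pr f" shows "prat (\<lambda>x. real_of_rat (nonneg_rat_of_code (f x)))"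
  unfolding real_nonneg_rat_of_code
  by (intro prat_divide pr_fst assms prat_nat pr_Suc pr_snd) simp

lemma prat_powi_int_decode: assumes "pr f" shows "prat (\<lambda>x. 2 powi (- int_decode (f x)))"
proof -
  have "(2::real) powi (- int_decode a) =
      (if even a then 1 / real (2 ^ (a div 2)) else real (2 ^ Suc (a div 2)))" for a
  proof (cases "even a")
    case True
    then show ?thesis by (auto simp: int_decode_def sum_decode_def power_int_minus divide_simps)
  next
    case False
    \<comment> \<open>Odd codes stand for the negative integers.\<close>
    then have "- int_decode a = int (Suc (a div 2))" by (simp add: int_decode_def sum_decode_def)
    then have "(2::real) powi (- int_decode a) = 2 ^ Suc (a div 2)" by (simp only: power_int_of_nat)
    with False show ?thesis by simp
  qed
  moreover have "prat (\<lambda>x. if even (f x) then 1 / real (2 ^ (f x div 2)) else real (2 ^ Suc (f x div 2)))"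
    by (intro prat_if prd_even assms prat_divide prat_1 pr_power pr_const pr_div2 prat_nat pr_Suc) simp
  ultimately show ?thesis by (simp only:)
qed

text \<open>Pairing is monotone, so bounded tuples have bounded codes. This turns the quantifier
  over grid points in \<open>far_test\<close> into a bounded one over numbers.\<close>

lemma tuple_code_bound:
  "\<exists>b. pr b \<and> (\<forall>k f. (\<forall>j<n. f j \<le> k) \<longrightarrow> (\<exists>e<b k. \<forall>j<n. component j e = f j))"
proof (induction n)
  case 0
  show ?case by (intro exI[of _ "\<lambda>_. 1"]) (auto simp: pr_const)
next
  case (Suc n)
  then obtain b where b: "pr b"
    "\<And>k f. (\<forall>j<n. f j \<le> k) \<Longrightarrow> (\<exists>e<b k. \<forall>j<n. component j e = f j)" by blast
  have mono: "ppair x y \<le> ppair x' y'" if "x \<le> x'" "y \<le> y'" for x y x' y'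
  proof -
    have "triangle i \<le> triangle j" if "i \<le> j" for i j
      using that by (induction rule: dec_induct) (auto simp: triangle_Suc)
    from this[of "x + y" "x' + y'"] that show ?thesis by (simp add: prod_encode_def)
  qed
  have "\<exists>e<Suc (ppair k (b k)). \<forall>j<Suc n. component j e = f j" if "\<forall>j<Suc n. f j \<le> k" for k f
  proof -
    have "\<forall>j<n. f (Suc j) \<le> k" using that by simp
    from b(2)[OF this] obtain e where e: "e < b k" "\<forall>j<n. component j e = f (Suc j)" by blast
    have "ppair (f 0) e \<le> ppair k (b k)" using that e by (intro mono) auto
    moreover have "component j (ppair (f 0) e) = f j" if "j < Suc n" for j
      using that e by (cases j) auto
    ultimately show ?thesis by (intro exI[of _ "ppair (f 0) e"]) auto
  qed
  moreover have "pr (\<lambda>k. Suc (ppair k (b k)))" by (intro pr_Suc pr_pair pr_id b)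
  ultimately show ?case by blast
qed

section \<open>Tests for far and near cubes\<close>


definition side_cube :: "real ^ 'n \<Rightarrow> real \<Rightarrow> (real ^ 'n) set" where
  "side_cube a l = cbox a (\<chi> i. a $ i + l)"

text \<open>Squared distances of rational points are rational, the distances themselves in general
  are not.\<close>

definition sq_dist :: "real ^ 'n \<Rightarrow> real ^ 'n \<Rightarrow> real" where
  "sq_dist x y = (\<Sum>i\<in>UNIV. (x $ i - y $ i)\<^sup>2)"

text \<open>The squared distance from \<open>x\<close> to \<open>side_cube a l\<close>.\<close>

definition sq_gap :: "real ^ 'n \<Rightarrow> real \<Rightarrow> real ^ 'n \<Rightarrow> real" where
  "sq_gap a l x = (\<Sum>i\<in>UNIV. (max 0 (max (a $ i - x $ i) (x $ i - (a $ i + l))))\<^sup>2)"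

abbreviation dim :: "'n itself \<Rightarrow> real" where
  "dim _ \<equiv> real CARD('n)"

lemma dist_power2: "(dist x y)\<^sup>2 = sq_dist x y"
  unfolding dist_norm power2_norm_eq_inner inner_vec_def sq_dist_def by (simp add: power2_eq_square)

lemma mem_side_cube: "x \<in> side_cube a l \<longleftrightarrow> (\<forall>i. a $ i \<le> x $ i \<and> x $ i \<le> a $ i + l)"
  by (simp add: side_cube_def mem_box_cart)

lemma side_cube_nonempty: "0 \<le> l \<Longrightarrow> a \<in> side_cube a l"
  by (simp add: mem_side_cube)

lemma compact_side_cube: "compact (side_cube a l)"
  by (simp add: side_cube_def)

lemma diameter_side_cube:
  fixes a :: "real ^ 'n"
  assumes "0 \<le> l"
  shows "diameter (side_cube a l) = sqrt (dim TYPE('n)) * l"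
proof -
  have "\<forall>i\<in>Basis. a \<bullet> i \<le> (\<chi> i. a $ i + l) \<bullet> i"
    using assms by (auto simp: Basis_vec_def inner_axis)
  then have "diameter (side_cube a l) = dist a (\<chi> i. a $ i + l)"
    unfolding side_cube_def by (rule diameter_cbox)
  also have "\<dots> = sqrt (dim TYPE('n) * l\<^sup>2)"
    using dist_power2[of a "\<chi> i. a $ i + l"] by (simp add: sq_dist_def real_sqrt_unique)
  finally show ?thesis using assms by (simp add: real_sqrt_mult)
qed

lemma sq_gap_le:
  assumes "q \<in> side_cube a l"
  shows "sq_gap a l x \<le> (dist x q)\<^sup>2"
  unfolding dist_power2 sq_gap_def sq_dist_def
proof (rule sum_mono)
  fix i
  have "a $ i \<le> q $ i" "q $ i \<le> a $ i + l" using assms by (auto simp: mem_side_cube)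
  then have "max 0 (max (a $ i - x $ i) (x $ i - (a $ i + l))) \<le> \<bar>x $ i - q $ i\<bar>" by auto
  then show "(max 0 (max (a $ i - x $ i) (x $ i - (a $ i + l))))\<^sup>2 \<le> (x $ i - q $ i)\<^sup>2"
    by (metis max.cobounded1 power2_abs power_mono)
qed

lemma sq_gap_attained:
  assumes "0 \<le> l"
  obtains q where "q \<in> side_cube a l" "(dist x q)\<^sup>2 = sq_gap a l x"
proof
  \<comment> \<open>Clamping each coordinate to its interval gives a nearest point of the
    cube.\<close>
  let ?q = "\<chi> i. max (a $ i) (min (x $ i) (a $ i + l))"
  show "?q \<in> side_cube a l" using assms by (simp add: mem_side_cube)
  show "(dist x ?q)\<^sup>2 = sq_gap a l x"
    unfolding dist_power2 sq_gap_def sq_dist_def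
  proof (rule sum.cong)
    fix i
    show "(x $ i - ?q $ i)\<^sup>2 = (max 0 (max (a $ i - x $ i) (x $ i - (a $ i + l))))\<^sup>2"
      using assms by (auto simp: max_def min_def power2_commute)
  qed simp
qed

lemma dim_ge_1: "1 \<le> dim TYPE('n::finite)"
  by (simp add: Suc_leI)

text \<open>The upper bound replaces the factor sqrt n by n where the machine needs a rational
  quantity.\<close>

lemma sqrt_dim: "1 \<le> sqrt (dim TYPE('n::finite))" "sqrt (dim TYPE('n)) \<le> dim TYPE('n)"
proof -
  show 1: "1 \<le> sqrt (dim TYPE('n))" using dim_ge_1 by simp
  have "sqrt (dim TYPE('n)) * 1 \<le> sqrt (dim TYPE('n)) * sqrt (dim TYPE('n))"
    by (intro mult_left_mono 1) simp
  then show "sqrt (dim TYPE('n)) \<le> dim TYPE('n)" by simp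
qed

lemma near_bound_power2:
    "(3 / 4 * (sqrt (dim TYPE('n::finite)) * l))\<^sup>2 = 9 / 16 * (dim TYPE('n) * l\<^sup>2)"
  and far_bound_power2:
    "(5 / 8 * (sqrt (dim TYPE('n)) * l))\<^sup>2 = 25 / 64 * (dim TYPE('n) * l\<^sup>2)"
  by (simp_all add: power_mult_distrib power_divide)

definition code_center :: "nat \<Rightarrow> real ^ 'n" where
  "code_center e = real_vec (rat_vec_of_code (fst (prod_decode e)))"

definition code_radius :: "nat \<Rightarrow> real" where
  "code_radius e = real_of_rat (nonneg_rat_of_code (snd (prod_decode e)))"

lemma ball_of_code: "ball_of_code e = ball (code_center e) (code_radius e)"
  by (simp add: ball_of_code_def code_center_def code_radius_def split_beta)

text \<open>
  Squared distances are compared, with \<open>9 / 16 = (3 / 4)\<^sup>2\<close> here and \<open>25 / 64 = (5 / 8)\<^sup>2\<close> in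
  \<open>far_test\<close>. The values lie between \<open>1 / 2\<close> and \<open>1\<close> and are chosen so that one of the two tests
  succeeds in the end, according to whether the distance exceeds \<open>5 / 8\<close> of the diameter or not.
\<close>

definition near_test :: "(nat \<Rightarrow> nat) \<Rightarrow> real ^ 'n \<Rightarrow> real \<Rightarrow> nat \<Rightarrow> bool" where
  "near_test v a l s \<longleftrightarrow> (\<exists>i<s. 4 * code_radius (v i) \<le> l \<and>
    sq_gap a l (code_center (v i)) < 9 / 16 * (dim TYPE('n) * l\<^sup>2))"

text \<open>The factor 8 limits the rounding error to diam / 8, so that 1/2 becomes 5/8 on the grid;
  the factor \<open>Suc s\<close> lets the error tend to 0, which completeness requires.\<close>

definition mesh :: "real \<Rightarrow> nat \<Rightarrow> real" where
  "mesh l s = l / real (8 * Suc s)"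

text \<open>With \<open>l\<close> the side and n the dimension, the grid extends by n l, which is at
  least the diameter, beyond the cube on every side. Its width (2 n + 1) l is the origin of the
  index bound in \<open>far_test\<close>.\<close>

definition grid :: "real ^ 'n \<Rightarrow> real \<Rightarrow> nat \<Rightarrow> ('n \<Rightarrow> nat) \<Rightarrow> real ^ 'n" where
  "grid a l s j = (\<chi> i. a $ i - dim TYPE('n) * l + real (j i) * mesh l s)"

text \<open>A grid point must lie in a ball shrunk by n times the mesh; then the full ball also
  contains every point that is rounded to this grid point. So checking finitely many points covers a
  neighbourhood of the cube. The separate condition on the radius guards against squaring a negative
  number.\<close>

definition far_test :: "(nat \<Rightarrow> nat) \<Rightarrow> real ^ 'n \<Rightarrow> real \<Rightarrow> nat \<Rightarrow> bool" where
  "far_test u a l s \<longleftrightarrow> (\<forall>j. (\<forall>i. j i \<le> (2 * CARD('n) + 1) * (8 * Suc s)) \<longrightarrow>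
    sq_gap a l (grid a l s j) \<le> 25 / 64 * (dim TYPE('n) * l\<^sup>2) \<longrightarrow>
    (\<exists>k<s. dim TYPE('n) * mesh l s < code_radius (u k) \<and>
      sq_dist (grid a l s j) (code_center (u k)) < (code_radius (u k) - dim TYPE('n) * mesh l s)\<^sup>2))"

section \<open>Soundness and completeness of the tests\<close>

lemma near_test_sound:
  fixes a :: "real ^ 'n"
  assumes "near_test v a l s" "0 < l" "\<And>i. ball_of_code (v i) \<inter> F \<noteq> ({} :: (real ^ 'n) set)"
  shows "\<exists>q\<in>side_cube a l. \<exists>x\<in>F. dist q x < diameter (side_cube a l)"
proof -
  let ?N = "sqrt (dim TYPE('n))"
  obtain i where i: "4 * code_radius (v i) \<le> l"
    "sq_gap a l (code_center (v i)) < 9 / 16 * (dim TYPE('n) * l\<^sup>2)"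
    using assms(1) unfolding near_test_def by blast
  let ?c = "code_center (v i) :: real ^ 'n"
  obtain q where q: "q \<in> side_cube a l" "(dist ?c q)\<^sup>2 = sq_gap a l ?c"
    using sq_gap_attained assms(2) less_imp_le by metis
  have "(dist ?c q)\<^sup>2 < (3 / 4 * (?N * l))\<^sup>2"
    unfolding near_bound_power2 using i(2) q(2) by simp
  then have "dist ?c q < 3 / 4 * (?N * l)"
    by (rule power_less_imp_less_base) (use assms(2) in simp)
  moreover obtain x where x: "x \<in> F" "dist ?c x < code_radius (v i)"
    using assms(3)[of i] by (auto simp: ball_of_code)
  moreover have "l \<le> ?N * l" using sqrt_dim(1) assms(2) by simp
  moreover have "dist q x \<le> dist ?c q + dist ?c x" by (rule dist_triangle3)
  \<comment> \<open>The center is less than 3/4 of the diameter from \<open>q\<close>, and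
    \<open>x\<close> is less than l / 4, hence less than a quarter of the diameter, from the
    center.\<close>
  ultimately have "dist q x < ?N * l" using i(1) by linarith
  then show ?thesis using q(1) x(1) diameter_side_cube[of l a] assms(2) by auto
qed

lemma setdist_attained:
  fixes F :: "(real ^ 'n) set"
  assumes "closed F" "F \<noteq> {}" "0 \<le> l"
  obtains q x where "q \<in> side_cube a l" "x \<in> F" "dist q x = setdist (side_cube a l) F"
  using setdist_compact_closed[OF compact_side_cube assms(1), of a l] assms side_cube_nonempty
  by (metis empty_iff)

text \<open>A rational ball of radius below l / 8 around a rational point close to a nearest point
  of \<open>F\<close> passes the test, because 5/8 + 1/8 = 3/4.\<close>

lemma near_test_complete:
  fixes a :: "real ^ 'n"
  assumes F: "closed F" "F \<noteq> {}" and l: "0 < l"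
    and v: "\<And>B. B \<in> rational_balls \<Longrightarrow> B \<inter> F \<noteq> {} \<Longrightarrow> \<exists>i. ball_of_code (v i) = B"
    and d: "setdist (side_cube a l) F \<le> 5 / 8 * diameter (side_cube a l)"
  shows "\<exists>s. near_test v a l s"
proof -
  let ?N = "sqrt (dim TYPE('n))"
  obtain q x where qx: "q \<in> side_cube a l" "x \<in> F" "dist q x = setdist (side_cube a l) F"
    using setdist_attained F l less_imp_le by metis
  obtain r where r: "0 < real_of_rat r" "real_of_rat r < l / 8"
    using of_rat_dense[of 0 "l / 8"] l by auto
  obtain c :: "rat ^ 'n" where c: "dist (real_vec c) x < real_of_rat r"
  proof -
    \<comment> \<open>Coordinate errors below \<open>r / n\<close> sum to less than
      \<open>r\<close>, and the sum bounds the Euclidean distance.\<close>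
    let ?\<epsilon> = "real_of_rat r / dim TYPE('n)"
    have "\<exists>p. x $ i - ?\<epsilon> < real_of_rat p \<and> real_of_rat p < x $ i" for i
      using of_rat_dense[of "x $ i - ?\<epsilon>" "x $ i"] r by auto
    then obtain p where p: "\<And>i. x $ i - ?\<epsilon> < real_of_rat (p i) \<and> real_of_rat (p i) < x $ i" by metis
    have "dist (real_vec (\<chi> i. p i)) x \<le> (\<Sum>i\<in>UNIV. \<bar>(real_vec (\<chi> i. p i) - x) $ i\<bar>)"
      unfolding dist_norm by (rule norm_le_l1_cart)
    also have "\<dots> < (\<Sum>i\<in>(UNIV :: 'n set). ?\<epsilon>)"
      by (rule sum_strict_mono) (use p in \<open>auto simp: real_vec_def abs_if algebra_simps\<close>)
    also have "\<dots> = real_of_rat r" by simp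
    finally show ?thesis by (rule that)
  qed
  have "ball (real_vec c) (real_of_rat r) \<in> rational_balls"
    using r(1) unfolding rational_balls_def by fastforce
  moreover have "ball (real_vec c) (real_of_rat r) \<inter> F \<noteq> {}" using c qx(2) by auto
  ultimately obtain i where "ball_of_code (v i) = ball (real_vec c) (real_of_rat r)"
    using v by blast
  \<comment> \<open>The name provides the ball as a set, and a nonempty ball determines its center
    and radius.\<close>
  then have i: "code_center (v i) = real_vec c" "code_radius (v i) = real_of_rat r"
    using r(1) by (auto simp: ball_of_code ball_eq_ball_iff)
  have diam: "diameter (side_cube a l) = ?N * l" using diameter_side_cube[of l a] l by simp
  have "l \<le> ?N * l" using sqrt_dim(1) l by simp
  moreover have "dist (real_vec c) q \<le> dist (real_vec c) x + dist q x" by (rule dist_triangle2)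
  ultimately have "dist (real_vec c) q < 3 / 4 * (?N * l)"
    using c r(2) d[unfolded diam] qx(3) by linarith
  then have "(dist (real_vec c) q)\<^sup>2 < (3 / 4 * (?N * l))\<^sup>2"
    by (rule power_strict_mono) simp_all
  then have "sq_gap a l (real_vec c) < 9 / 16 * (dim TYPE('n) * l\<^sup>2)"
    unfolding near_bound_power2 using sq_gap_le[OF qx(1), of "real_vec c"] by simp
  moreover have "4 * real_of_rat r \<le> l" using r by linarith
  ultimately have "near_test v a l (Suc i)"
    unfolding near_test_def using i by (intro exI[of _ i]) simp
  then show ?thesis by blast
qed

text \<open>Every coordinate of \<open>x\<close> is rounded down to the grid, with an error of at
  most the mesh. As \<open>x\<close> is close to the cube, the rounded point does not leave the
  range of the grid.\<close>

lemma grid_approx: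
  fixes a x q :: "real ^ 'n"
  assumes l: "0 < l" and q: "q \<in> side_cube a l" "dist q x \<le> 1 / 2 * diameter (side_cube a l)"
  obtains j where "\<And>i. j i \<le> (2 * CARD('n) + 1) * (8 * Suc s)"
    "dist x (grid a l s j) \<le> sqrt (dim TYPE('n)) * mesh l s"
proof
  let ?n = "dim TYPE('n)"
  define h where "h = mesh l s"
  have h: "0 < h" "h * real (8 * Suc s) = l" using l by (simp_all add: h_def mesh_def)
  define j where "j i = nat \<lfloor>(x $ i - (a $ i - ?n * l)) / h\<rfloor>" for i
  have "\<bar>x $ i - q $ i\<bar> \<le> ?n * l" for i
  proof -
    have "\<bar>x $ i - q $ i\<bar> \<le> dist q x"
      using dist_vec_nth_le[of x i q] by (simp add: dist_real_def dist_commute)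
    also have "\<dots> \<le> 1 / 2 * (sqrt ?n * l)" using q(2) diameter_side_cube[of l a] l by simp
    also have "\<dots> \<le> sqrt ?n * l" using l by simp
    also have "\<dots> \<le> ?n * l" using sqrt_dim(2) l by simp
    finally show ?thesis .
  qed
  moreover have "a $ i \<le> q $ i \<and> q $ i \<le> a $ i + l" for i using q(1) by (simp add: mem_side_cube)
  moreover have "(2 * ?n + 1) * l = 2 * (?n * l) + l" by (simp add: algebra_simps)
  ultimately have x: "0 \<le> x $ i - (a $ i - ?n * l)" "x $ i - (a $ i - ?n * l) \<le> (2 * ?n + 1) * l" for i
    by (smt (verit))+
  have j: "real (j i) \<le> (x $ i - (a $ i - ?n * l)) / h"
    "(x $ i - (a $ i - ?n * l)) / h < real (j i) + 1" for i
    using x(1)[of i] h(1) by (simp_all add: j_def)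
  show "j i \<le> (2 * CARD('n) + 1) * (8 * Suc s)" for i
  proof -
    have "real (j i) * h \<le> (2 * ?n + 1) * l" using j(1)[of i] x(2)[of i] h(1)
      by (simp add: pos_le_divide_eq)
    also have "\<dots> = (2 * ?n + 1) * (h * real (8 * Suc s))" by (simp only: h(2))
    also have "\<dots> = real ((2 * CARD('n) + 1) * (8 * Suc s)) * h" by (simp add: algebra_simps)
    finally show ?thesis using h(1) by (simp only: mult_le_cancel_right_pos of_nat_le_iff)
  qed
  have "(dist x (grid a l s j))\<^sup>2 \<le> (\<Sum>i\<in>(UNIV :: 'n set). h\<^sup>2)"
    unfolding dist_power2 sq_dist_def
  proof (rule sum_mono)
    fix i
    have "real (j i) * h \<le> x $ i - (a $ i - ?n * l)" "x $ i - (a $ i - ?n * l) < real (j i) * h + h"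
      using j[of i] h(1) by (simp_all add: field_simps)
    then have "0 \<le> x $ i - grid a l s j $ i" "x $ i - grid a l s j $ i \<le> h"
      by (simp_all add: grid_def h_def)
    then show "(x $ i - grid a l s j $ i)\<^sup>2 \<le> h\<^sup>2" by (intro power_mono)
  qed
  also have "\<dots> = (sqrt ?n * h)\<^sup>2" by (simp add: power_mult_distrib)
  finally show "dist x (grid a l s j) \<le> sqrt ?n * mesh l s"
    unfolding h_def[symmetric] by (rule power2_le_imp_le) (use h in simp)
qed

text \<open>A point of \<open>F\<close> within half a diameter of the cube would be rounded to a
  grid point within 5/8. The ball that the test provides for this grid point would then contain the
  point of \<open>F\<close>.\<close>

lemma far_test_sound:
  fixes a :: "real ^ 'n"
  assumes F: "closed F" "F \<noteq> {}" and l: "0 < l" and far: "far_test u a l s"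
    and u: "\<And>k. ball_of_code (u k) \<inter> F = {}"
  shows "1 / 2 * diameter (side_cube a l) < setdist (side_cube a l) F"
proof (rule ccontr)
  assume not: "\<not> ?thesis"
  let ?n = "dim TYPE('n)"
  obtain q x where qx: "q \<in> side_cube a l" "x \<in> F" "dist q x = setdist (side_cube a l) F"
    using setdist_attained F l less_imp_le by metis
  then have d: "dist q x \<le> 1 / 2 * diameter (side_cube a l)" using not by simp
  obtain j where j: "\<And>i. j i \<le> (2 * CARD('n) + 1) * (8 * Suc s)"
    "dist x (grid a l s j) \<le> sqrt ?n * mesh l s"
    by (rule grid_approx[OF l qx(1) d]) blast
  let ?g = "grid a l s j"
  have mesh: "0 < mesh l s" using l by (simp add: mesh_def)
  have "mesh l s \<le> l / 8" using l by (simp add: mesh_def divide_simps)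
  then have "sqrt ?n * mesh l s \<le> sqrt ?n * (l / 8)" by (intro mult_left_mono) simp_all
  moreover have "diameter (side_cube a l) = sqrt ?n * l" using diameter_side_cube[of l a] l by simp
  moreover have "dist ?g q \<le> dist x ?g + dist q x"
    using dist_triangle[of ?g q x] by (simp add: dist_commute)
  ultimately have "dist ?g q \<le> 5 / 8 * (sqrt ?n * l)"
    using j(2) d by (simp only: times_divide_eq_right)
  then have "(dist ?g q)\<^sup>2 \<le> (5 / 8 * (sqrt ?n * l))\<^sup>2" by (rule power_mono) simp
  then have "sq_gap a l ?g \<le> 25 / 64 * (?n * l\<^sup>2)"
    unfolding far_bound_power2 using sq_gap_le[OF qx(1), of ?g] by simp
  then obtain k where k: "?n * mesh l s < code_radius (u k)"
    "sq_dist ?g (code_center (u k)) < (code_radius (u k) - ?n * mesh l s)\<^sup>2"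
    using far j(1) unfolding far_test_def by blast
  have "dist ?g (code_center (u k)) < code_radius (u k) - ?n * mesh l s"
    by (rule power_less_imp_less_base[of _ 2]) (use k in \<open>simp_all add: dist_power2\<close>)
  moreover have "sqrt ?n * mesh l s \<le> ?n * mesh l s" using sqrt_dim(2) mesh by simp
  moreover have "dist x (code_center (u k)) \<le> dist x ?g + dist ?g (code_center (u k))"
    by (rule dist_triangle)
  ultimately have "x \<in> ball_of_code (u k)"
    using j(2) by (simp add: ball_of_code dist_commute)
  then show False using u qx(2) by blast
qed

text \<open>The closed neighbourhood of radius 5/8 of the diameter is compact and misses
  \<open>F\<close>. It is covered by the shrunk balls, whose unions grow with the stage, so a single
  stage suffices.\<close>

lemma far_test_complete:
  fixes a :: "real ^ 'n"
  assumes l: "0 < l" and u: "(\<Union>k. ball_of_code (u k)) = - F"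
    and d: "5 / 8 * diameter (side_cube a l) < setdist (side_cube a l) F"
  shows "\<exists>s. far_test u a l s"
proof -
  let ?n = "dim TYPE('n)"
  let ?K = "{x. sq_gap a l x \<le> 25 / 64 * (?n * l\<^sup>2)}"
  define W where "W s = (\<Union>k<s. ball (code_center (u k) :: real ^ 'n) (code_radius (u k) - ?n * mesh l s))" for s
  have K: "\<exists>q\<in>side_cube a l. dist x q \<le> 5 / 8 * (sqrt ?n * l)" if x: "x \<in> ?K" for x
  proof -
    obtain q where q: "q \<in> side_cube a l" "(dist x q)\<^sup>2 = sq_gap a l x"
      using sq_gap_attained l less_imp_le by metis
    have "(dist x q)\<^sup>2 \<le> (5 / 8 * (sqrt ?n * l))\<^sup>2"
      unfolding far_bound_power2 using x q(2) by simp
    then have "dist x q \<le> 5 / 8 * (sqrt ?n * l)" by (rule power2_le_imp_le) (use l in simp)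
    with q(1) show ?thesis by blast
  qed
  have "compact ?K"
  proof -
    obtain B where B: "\<And>q. q \<in> side_cube a l \<Longrightarrow> dist 0 q \<le> B"
      using compact_imp_bounded[OF compact_side_cube] unfolding bounded_any_center[of _ 0] by blast
    have "dist 0 x \<le> B + 5 / 8 * (sqrt ?n * l)" if "x \<in> ?K" for x
    proof -
      obtain q where q: "q \<in> side_cube a l" "dist x q \<le> 5 / 8 * (sqrt ?n * l)" using K \<open>x \<in> ?K\<close> by blast
      have "dist 0 x \<le> dist 0 q + dist x q" by (rule dist_triangle2)
      with q B show ?thesis by fastforce
    qed
    then have "bounded ?K" unfolding bounded_def by blast
    moreover have "closed ?K"
      unfolding sq_gap_def
      by (intro closed_Collect_le continuous_intros)
    ultimately show ?thesis by (simp add: compact_eq_bounded_closed)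
  qed
  moreover have "open (W s)" for s by (auto simp: W_def)
  moreover have "?K \<subseteq> (\<Union>s. W s)"
  proof
    fix x assume x: "x \<in> ?K"
    obtain q where q: "q \<in> side_cube a l" "dist x q \<le> 5 / 8 * (sqrt ?n * l)" using K x by blast
    have "0 < sqrt ?n * l" using sqrt_dim(1)[where 'n = 'n] l by simp
    moreover have "diameter (side_cube a l) = sqrt ?n * l" using diameter_side_cube[of l a] l by simp
    moreover have "setdist (side_cube a l) F \<le> dist x q" if "x \<in> F"
      using setdist_le_dist[OF q(1) that] by (simp add: dist_commute)
    ultimately have "x \<notin> F" using q(2) d by linarith
    then obtain k where k: "dist (code_center (u k)) x < code_radius (u k)"
    proof -
      have "x \<in> (\<Union>k. ball_of_code (u k))" using u \<open>x \<notin> F\<close> by simp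
      then show ?thesis using that by (auto simp: ball_of_code)
    qed
    obtain m where m: "?n * l < real m * (code_radius (u k) - dist (code_center (u k)) x)"
      using reals_Archimedean3 k by (metis diff_gt_0_iff_gt)
    \<comment> \<open>Stage \<open>s\<close> must be beyond \<open>k\<close>, for the ball to be
      available, and at least \<open>m\<close>, for the margin to be below the slack of
      \<open>x\<close> in this ball.\<close>
    define s where "s = max (Suc k) m"
    have "real m \<le> real (8 * Suc s)" by (simp only: of_nat_le_iff) (simp add: s_def max_def)
    then have "real m * (code_radius (u k) - dist (code_center (u k)) x) \<le>
        real (8 * Suc s) * (code_radius (u k) - dist (code_center (u k)) x)"
      using k by (intro mult_right_mono) simp_all
    with m have "?n * l < (code_radius (u k) - dist (code_center (u k)) x) * real (8 * Suc s)"
      by (simp only: mult.commute)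
    then have "?n * l / real (8 * Suc s) < code_radius (u k) - dist (code_center (u k)) x"
      by (subst pos_divide_less_eq) simp_all
    then have "x \<in> W s"
      by (auto simp: W_def mesh_def s_def intro!: bexI[of _ k])
    then show "x \<in> (\<Union>s. W s)" by blast
  qed
  ultimately obtain S where S: "finite S" "?K \<subseteq> (\<Union>s\<in>S. W s)"
    by (metis (no_types, lifting) compactE_image)
  have mono: "W s \<subseteq> W t" if "s \<le> t" for s t
  proof -
    have "mesh l t \<le> mesh l s" using that l by (auto simp: mesh_def intro!: divide_left_mono)
    then have "?n * mesh l t \<le> ?n * mesh l s" by (intro mult_left_mono) simp_all
    then show ?thesis unfolding W_def using that by (intro UN_mono subset_ball) auto
  qed
  define s where "s = Max (insert 0 S)"
  have "?K \<subseteq> W s"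
  proof -
    have "W t \<subseteq> W s" if "t \<in> S" for t using that S(1) by (intro mono) (simp add: s_def)
    then show ?thesis using S(2) by blast
  qed
  have "far_test u a l s"
    unfolding far_test_def
  proof (intro allI impI)
    fix j assume "sq_gap a l (grid a l s j) \<le> 25 / 64 * (?n * l\<^sup>2)"
    with \<open>?K \<subseteq> W s\<close> have "grid a l s j \<in> W s" by blast
    then obtain k where k: "k < s"
      "dist (grid a l s j) (code_center (u k)) < code_radius (u k) - ?n * mesh l s"
      by (auto simp: W_def dist_commute)
    then have "(dist (grid a l s j) (code_center (u k)))\<^sup>2 < (code_radius (u k) - ?n * mesh l s)\<^sup>2"
      by (intro power_strict_mono) simp_all
    moreover have "?n * mesh l s < code_radius (u k)"
      using k(2) zero_le_dist[of "grid a l s j" "code_center (u k)"] by linarith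
    ultimately show "\<exists>k<s. ?n * mesh l s < code_radius (u k) \<and>
        sq_dist (grid a l s j) (code_center (u k)) < (code_radius (u k) - ?n * mesh l s)\<^sup>2"
      using k(1) unfolding dist_power2 by blast
  qed
  then show ?thesis by blast
qed

section \<open>The family of dyadic cubes\<close>


definition settled :: "(nat \<Rightarrow> nat) \<Rightarrow> (nat \<Rightarrow> nat) \<Rightarrow> real ^ 'n \<Rightarrow> real \<Rightarrow> nat \<Rightarrow> bool" where
  "settled u v a l s \<longleftrightarrow> far_test u a l s \<or> near_test v a l s"

text \<open>If both tests first succeed at the same stage, the cube counts as far; otherwise failure
  of the far test means success of the near test at that stage.\<close>

definition is_far :: "(nat \<Rightarrow> nat) \<Rightarrow> (nat \<Rightarrow> nat) \<Rightarrow> real ^ 'n \<Rightarrow> real \<Rightarrow> bool" where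
  "is_far u v a l \<longleftrightarrow> far_test u a l (LEAST s. settled u v a l s)"

locale closed_set_name =
  fixes F :: "(real ^ 'n) set" and u v :: "nat \<Rightarrow> nat"
  assumes F: "closed F" "F \<noteq> {}" and name: "total_information_name F (u, v)"
begin

lemma name_u: "(\<Union>k. ball_of_code (u k)) = - F"
  using name by (simp add: total_information_name_def)

lemma name_u': "ball_of_code (u k) \<inter> F = {}"
  using name_u by blast

lemma name_v: "range (\<lambda>i. ball_of_code (v i)) = {B \<in> rational_balls. B \<inter> F \<noteq> {}}"
  using name by (simp add: total_information_name_def)

lemma name_v': "ball_of_code (v i) \<inter> F \<noteq> {}"
  using name_v by blast

text \<open>The two completeness results meet at 5/8 of the diameter and so leave no gap.\<close>

lemma ex_settled:
  fixes a :: "real ^ 'n"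
  assumes "0 < l"
  shows "\<exists>s. settled u v a l s"
proof (cases "setdist (side_cube a l) F \<le> 5 / 8 * diameter (side_cube a l)")
  case True
  have "\<exists>i. ball_of_code (v i) = B" if "B \<in> rational_balls" "B \<inter> F \<noteq> {}" for B
    using name_v that by (metis (mono_tags, lifting) imageE mem_Collect_eq)
  from near_test_complete[OF F assms this True] show ?thesis by (auto simp: settled_def)
next
  case False
  then have "5 / 8 * diameter (side_cube a l) < setdist (side_cube a l) F" by simp
  from far_test_complete[OF assms name_u this] show ?thesis by (auto simp: settled_def)
qed

lemma is_far_setdist:
  assumes "0 < l" "is_far u v a l"
  shows "1 / 2 * diameter (side_cube a l) < setdist (side_cube a l) F"
  using far_test_sound[OF F assms(1) assms(2)[unfolded is_far_def] name_u'] .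

lemma not_is_far_dist:
  assumes "0 < l" "\<not> is_far u v a l"
  shows "\<exists>q\<in>side_cube a l. \<exists>x\<in>F. dist q x < diameter (side_cube a l)"
proof -
  have "settled u v a l (LEAST s. settled u v a l s)"
    using ex_settled[OF assms(1)] by (rule LeastI_ex)
  then have "near_test v a l (LEAST s. settled u v a l s)"
    using assms(2) by (simp add: settled_def is_far_def)
  from near_test_sound[OF this assms(1) name_v'] show ?thesis .
qed

text \<open>
  Passing to a cube of half the size turns the lower bound of half a diameter into one of a full
  diameter, which excludes a near cube.
\<close>

lemma is_far_mono:
  fixes a b :: "real ^ 'n"
  assumes "0 < l" "side_cube b l \<subseteq> side_cube a (2 * l)" "is_far u v a (2 * l)"
  shows "is_far u v b l"
proof (rule ccontr)
  assume "\<not> is_far u v b l"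
  then obtain q x where q: "q \<in> side_cube b l" "x \<in> F" "dist q x < diameter (side_cube b l)"
    using not_is_far_dist assms(1) by blast
  have "setdist (side_cube a (2 * l)) F \<le> dist q x"
    using q assms(2) by (intro setdist_le_dist) auto
  moreover have "1 / 2 * diameter (side_cube a (2 * l)) < setdist (side_cube a (2 * l)) F"
    using is_far_setdist assms by simp
  ultimately show False
    using q(3) assms(1) diameter_side_cube[of "2 * l" a] diameter_side_cube[of l b] by simp
qed

end

section \<open>Dyadic cubes and their parents\<close>

definition corner :: "int \<Rightarrow> int ^ 'n \<Rightarrow> real ^ 'n" where
  "corner k m = (\<chi> i. of_int (m $ i) * 2 powi (- k))"

text \<open>The lower corner of the parent of a dyadic cube.\<close>

definition parent_corner :: "real ^ 'n \<Rightarrow> real \<Rightarrow> real ^ 'n" where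
  "parent_corner a l = (\<chi> i. if a $ i / (2 * l) \<in> \<int> then a $ i else a $ i - l)"

definition selected :: "(nat \<Rightarrow> nat) \<Rightarrow> (nat \<Rightarrow> nat) \<Rightarrow> real ^ 'n \<Rightarrow> real \<Rightarrow> bool" where
  "selected u v a l \<longleftrightarrow> is_far u v a l \<and> \<not> is_far u v (parent_corner a l) (2 * l)"

definition whitney_family :: "(nat \<Rightarrow> nat) \<Rightarrow> (nat \<Rightarrow> nat) \<Rightarrow> (real ^ 'n) set set" where
  "whitney_family u v = {dyadic_cube k m | k m. selected u v (corner k m) (2 powi (- k))}"

text \<open>Among the closed cubes of level \<open>k\<close> that contain \<open>x\<close>, this
  picks the one whose half-open version contains \<open>x\<close>; with this choice the cubes of all
  levels form a chain (\<open>cube_index_parent\<close>).\<close>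

definition cube_index :: "real ^ 'n \<Rightarrow> int \<Rightarrow> int ^ 'n" where
  "cube_index x k = (\<chi> i. \<lfloor>x $ i * 2 powi k\<rfloor>)"

lemma dyadic_cube_eq_side_cube: "dyadic_cube k m = side_cube (corner k m) (2 powi (- k))"
  by (simp add: dyadic_cube_def side_cube_def corner_def algebra_simps)

lemma powi_neg_pred: "2 * 2 powi (- k) = (2::real) powi (- (k - 1))"
  by (simp add: power_int_diff power_int_minus field_simps)

text \<open>Integrality of the quotient by \<open>2 * l\<close> is evenness of the index. An even
  index keeps the corner, an odd one moves it down by one side length.\<close>

lemma parent_corner_corner: "parent_corner (corner k m) (2 powi (- k)) = corner (k - 1) (\<chi> i. m $ i div 2)"
proof -
  have eq: "real_of_int z * 2 powi (- k) / (2 * 2 powi (- k)) = of_int z / 2" for z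
    by simp
  have "real_of_int z / 2 \<in> \<int> \<longleftrightarrow> even z" for z
    using of_int_div_of_int_in_Ints_iff[of z 2] by simp
  then have "(if real_of_int z * 2 powi (- k) / (2 * 2 powi (- k)) \<in> \<int>
      then of_int z * 2 powi (- k) else of_int z * 2 powi (- k) - 2 powi (- k)) =
      of_int (z div 2) * ((2::real) powi (- (k - 1)))" for z
    unfolding eq powi_neg_pred[symmetric] by (auto elim!: evenE oddE simp: algebra_simps)
  then show ?thesis unfolding vec_eq_iff parent_corner_def corner_def vec_lambda_beta by blast
qed

lemma cube_index_parent: "(\<chi> i. cube_index x k $ i div 2) = cube_index x (k - 1)"
proof -
  have "\<lfloor>y * 2 powi k\<rfloor> div 2 = \<lfloor>y * 2 powi (k - 1)\<rfloor>" for y :: real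
    using floor_divide_real_eq_div[of 2 "y * 2 powi k"] by (simp add: power_int_diff)
  then show ?thesis by (simp add: cube_index_def)
qed

lemma dyadic_cube_subset_parent: "dyadic_cube k m \<subseteq> dyadic_cube (k - 1) (\<chi> i. m $ i div 2)"
proof -
  let ?p = "2 powi (- k) :: real"
  have lower: "of_int (z div 2) * (2 * ?p) \<le> of_int z * ?p"
    and upper: "of_int z * ?p + ?p \<le> of_int (z div 2) * (2 * ?p) + 2 * ?p" for z
  proof -
    have "of_int (2 * (z div 2)) * ?p \<le> of_int z * ?p"
      by (intro mult_right_mono, unfold of_int_le_iff) simp_all
    then show "of_int (z div 2) * (2 * ?p) \<le> of_int z * ?p" by (simp add: mult_ac)
    have "of_int (z + 1) * ?p \<le> of_int (2 * (z div 2) + 2) * ?p"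
      by (intro mult_right_mono, unfold of_int_le_iff) simp_all
    then show "of_int z * ?p + ?p \<le> of_int (z div 2) * (2 * ?p) + 2 * ?p" by (simp add: algebra_simps)
  qed
  show ?thesis
    unfolding dyadic_cube_eq_side_cube powi_neg_pred[symmetric]
  proof
    fix x assume "x \<in> side_cube (corner k m) ?p"
    then have "of_int (m $ i) * ?p \<le> x $ i" "x $ i \<le> of_int (m $ i) * ?p + ?p" for i
      by (simp_all add: mem_side_cube corner_def)
    then have "of_int (m $ i div 2) * (2 * ?p) \<le> x $ i \<and>
        x $ i \<le> of_int (m $ i div 2) * (2 * ?p) + 2 * ?p" for i
      using lower[of "m $ i"] upper[of "m $ i"] by (meson order_trans)
    then show "x \<in> side_cube (corner (k - 1) (\<chi> i. m $ i div 2)) (2 * ?p)"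
      unfolding mem_side_cube corner_def powi_neg_pred[symmetric] vec_lambda_beta by blast
  qed
qed

lemma mem_dyadic_cube_index: "x \<in> dyadic_cube k (cube_index x k)"
proof -
  have "of_int \<lfloor>y * 2 powi k\<rfloor> * 2 powi (- k) \<le> y"
    "y \<le> of_int \<lfloor>y * 2 powi k\<rfloor> * 2 powi (- k) + 2 powi (- k)" for y :: real
  proof -
    have y: "(y * 2 powi k) * 2 powi (- k) = y" by (simp add: power_int_minus)
    have "of_int \<lfloor>y * 2 powi k\<rfloor> * 2 powi (- k) \<le> (y * 2 powi k) * 2 powi (- k)"
      by (intro mult_right_mono) simp_all
    then show "of_int \<lfloor>y * 2 powi k\<rfloor> * 2 powi (- k) \<le> y" unfolding y .
    have "(y * 2 powi k) * 2 powi (- k) \<le> (of_int \<lfloor>y * 2 powi k\<rfloor> + 1) * 2 powi (- k)"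
      by (intro mult_right_mono real_of_int_floor_add_one_ge) simp
    then show "y \<le> of_int \<lfloor>y * 2 powi k\<rfloor> * 2 powi (- k) + 2 powi (- k)"
      unfolding y by (simp add: algebra_simps)
  qed
  then show ?thesis
    by (simp add: dyadic_cube_eq_side_cube mem_side_cube corner_def cube_index_def)
qed

text \<open>Strict inequalities force the floor. Hence cubes sharing an interior point differ at
  most in their level.\<close>

lemma interior_dyadic_cube_index:
  assumes "x \<in> interior (dyadic_cube k m)"
  shows "m = cube_index x k"
proof -
  have "x \<in> box (corner k m) (\<chi> i. (of_int (m $ i) + 1) * 2 powi (- k))"
    using assms by (simp add: dyadic_cube_def interior_cbox corner_def)
  then have x: "of_int (m $ i) * 2 powi (- k) < x $ i" "x $ i < (of_int (m $ i) + 1) * 2 powi (- k)" for i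
    by (simp_all add: mem_box_cart corner_def)
  have "of_int (m $ i) \<le> x $ i * 2 powi k" "x $ i * 2 powi k < of_int (m $ i) + 1" for i
    using x[of i] by (simp_all add: power_int_minus field_simps)
  then have "\<lfloor>x $ i * 2 powi k\<rfloor> = m $ i" for i
    by (intro floor_unique)
  then show ?thesis by (simp add: cube_index_def vec_eq_iff)
qed

text \<open>The diameter gives the level, and the center, an interior point, gives the index. This
  allows passing between cubes as sets, in the family, and their parameters, in
  \<open>selected\<close>.\<close>

lemma dyadic_cube_inject:
  assumes "dyadic_cube k m = (dyadic_cube k' m' :: (real ^ 'n) set)"
  shows "k = k' \<and> m = m'"
proof -
  have "diameter (dyadic_cube k m :: (real ^ 'n) set) = sqrt (dim TYPE('n)) * 2 powi (- k)" for k m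
    by (simp add: dyadic_cube_eq_side_cube diameter_side_cube)
  then have "(2::real) powi (- k) = 2 powi (- k')" using assms by (metis mult_left_cancel
        real_sqrt_eq_zero_cancel_iff of_nat_eq_0_iff zero_less_card_finite less_numeral_extra(3))
  then have k: "k = k'"
    using power_int_strict_increasing[of "- k" "- k'" "2::real"]
      power_int_strict_increasing[of "- k'" "- k" "2::real"] by (cases k k' rule: linorder_cases) simp_all
  have "(\<chi> i. (of_int (m $ i) + 1 / 2) * 2 powi (- k)) \<in> interior (dyadic_cube k m)"
    by (simp add: dyadic_cube_def interior_cbox mem_box_cart)
  then show ?thesis using interior_dyadic_cube_index assms k by metis
qed

section \<open>The selected cubes satisfy (C1), (C2) and (C3)\<close>

context closed_set_name
begin

lemma not_is_far_dyadic:
  "\<not> is_far u v (corner k m) (2 powi (- k)) \<Longrightarrow>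
    \<exists>q\<in>dyadic_cube k m. \<exists>x\<in>F. dist q x < diameter (dyadic_cube k m :: (real ^ 'n) set)"
  unfolding dyadic_cube_eq_side_cube by (rule not_is_far_dist) simp_all

lemma is_far_dyadic:
  "is_far u v (corner k m) (2 powi (- k)) \<Longrightarrow>
    1 / 2 * diameter (dyadic_cube k m) < setdist (dyadic_cube k m) F"
  unfolding dyadic_cube_eq_side_cube by (rule is_far_setdist) simp_all

text \<open>Along the chain of cubes around \<open>x\<close>, being far is monotone in the level;
  the selected cube is at the jump.\<close>

definition far_level :: "real ^ 'n \<Rightarrow> int \<Rightarrow> bool" where
  "far_level x k \<longleftrightarrow> is_far u v (corner k (cube_index x k)) (2 powi (- k))"

lemma selected_cube_index:
  "selected u v (corner k (cube_index x k)) (2 powi (- k)) \<longleftrightarrow> far_level x k \<and> \<not> far_level x (k - 1)"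
  by (simp add: selected_def far_level_def parent_corner_corner cube_index_parent powi_neg_pred)

lemma far_level_Suc: "far_level x (k - 1) \<Longrightarrow> far_level x k"
  unfolding far_level_def
  using is_far_mono[of "2 powi (- k)" "corner k (cube_index x k)" "corner (k - 1) (cube_index x (k - 1))"]
    dyadic_cube_subset_parent[of k "cube_index x k"]
  by (simp add: powi_neg_pred cube_index_parent dyadic_cube_eq_side_cube)

lemma far_level_mono: "j \<le> k \<Longrightarrow> far_level x j \<Longrightarrow> far_level x k"
  by (induction k rule: int_ge_induct) (use far_level_Suc in fastforce)+

lemma diameter_dyadic_cube:
  "diameter (dyadic_cube k m :: (real ^ 'n) set) = sqrt (dim TYPE('n)) * 2 powi (- k)"
  by (simp add: dyadic_cube_eq_side_cube diameter_side_cube)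

text \<open>A cube around \<open>x\<close> that is not far has a point of \<open>F\<close> within
  two diameters of \<open>x\<close>; for small cubes this contradicts openness of the
  complement.\<close>

lemma ex_far_level: "x \<notin> F \<Longrightarrow> \<exists>k. far_level x k"
proof -
  assume "x \<notin> F"
  then have "open (- F)" "x \<in> - F" using F(1) by (simp_all add: open_Compl)
  then obtain e where e: "0 < e" "ball x e \<subseteq> - F" by (rule openE)
  obtain j where j: "(1 / 2) ^ j < e / (2 * sqrt (dim TYPE('n)))"
    using real_arch_pow_inv[of "e / (2 * sqrt (dim TYPE('n)))" "1 / 2"] e(1) by auto
  have "far_level x (int j)"
  proof (rule ccontr)
    let ?Q = "dyadic_cube (int j) (cube_index x (int j))"
    assume "\<not> far_level x (int j)"
    then obtain q y where q: "q \<in> ?Q" "y \<in> F" "dist q y < diameter ?Q"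
      unfolding far_level_def by (blast dest: not_is_far_dyadic)
    have "dist x q \<le> diameter ?Q"
      using q(1) mem_dyadic_cube_index
      by (intro diameter_bounded_bound) (auto simp: dyadic_cube_def)
    then have "dist x y < 2 * diameter ?Q" using q(3) dist_triangle[of x y q] by linarith
    also have "\<dots> = 2 * sqrt (dim TYPE('n)) * (1 / 2) ^ j"
      by (simp add: diameter_dyadic_cube power_int_minus power_divide inverse_eq_divide)
    also have "\<dots> \<le> e" using j by (simp add: field_simps)
    finally show False using e(2) q(2) by auto
  qed
  then show ?thesis by blast
qed

text \<open>For \<open>y\<close> in \<open>F\<close>, a far cube around \<open>x\<close> has
  diameter below \<open>2 * dist x y\<close>. Nonemptiness of \<open>F\<close> thus stops the far
  cubes from growing.\<close>

lemma ex_not_far_level: "\<exists>k. \<not> far_level x k"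
proof -
  obtain y where y: "y \<in> F" using F(2) by blast
  obtain j where j: "2 * dist x y < 2 ^ j" using real_arch_pow[of 2 "2 * dist x y"] by auto
  let ?Q = "dyadic_cube (- int j) (cube_index x (- int j))"
  have "setdist ?Q F \<le> dist x y" using mem_dyadic_cube_index y by (rule setdist_le_dist)
  moreover have "1 * 2 ^ j \<le> sqrt (dim TYPE('n)) * 2 ^ j"
    using sqrt_dim(1)[where 'n = 'n] by (intro mult_right_mono) simp_all
  then have "2 ^ j \<le> diameter ?Q" by (simp add: diameter_dyadic_cube)
  ultimately have "\<not> far_level x (- int j)"
    using is_far_dyadic[of "- int j" "cube_index x (- int j)"] j unfolding far_level_def by fastforce
  then show ?thesis by blast
qed

text \<open>Without a jump, \<open>x\<close> would be far at every level, upwards by monotonicity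
  and downwards by assumption.\<close>

lemma ex_selected_level:
  assumes "x \<notin> F"
  shows "\<exists>k. far_level x k \<and> \<not> far_level x (k - 1)"
proof (rule ccontr)
  assume no: "\<not> ?thesis"
  obtain k where "far_level x k" using ex_far_level assms by blast
  have "far_level x j" for j
  proof (induction j rule: int_induct[of _ k])
    case (step1 i)
    then show ?case using far_level_mono[of i "i + 1"] by simp
  qed (use no \<open>far_level x k\<close> in blast)+
  then show False using ex_not_far_level by blast
qed

lemma whitney_family_CUBE: "whitney_family u v \<in> CUBE F"
proof -
  have bounds: "1 / 2 * diameter Q < setdist Q F \<and> setdist Q F < 5 * diameter Q"
    if mem: "Q \<in> whitney_family u v" for Q :: "(real ^ 'n) set"
  proof -
    obtain k m where Q: "Q = dyadic_cube k m" and sel: "selected u v (corner k m) (2 powi (- k))"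
      using mem unfolding whitney_family_def by blast
    let ?P = "dyadic_cube (k - 1) (\<chi> i. m $ i div 2) :: (real ^ 'n) set"
    have far: "1 / 2 * diameter Q < setdist Q F"
      unfolding Q by (rule is_far_dyadic) (use sel in \<open>simp add: selected_def\<close>)
    have "\<not> is_far u v (corner (k - 1) (\<chi> i. m $ i div 2)) (2 powi (- (k - 1)))"
      using sel unfolding selected_def parent_corner_corner powi_neg_pred by blast
    then obtain q x where q: "q \<in> ?P" "x \<in> F" "dist q x < diameter ?P"
      by (blast dest: not_is_far_dyadic)
    have z: "corner k m \<in> Q"
      unfolding Q dyadic_cube_eq_side_cube by (rule side_cube_nonempty) simp
    then have "dist (corner k m) q \<le> diameter ?P"
      using dyadic_cube_subset_parent q(1)
      by (intro diameter_bounded_bound) (auto simp: Q dyadic_cube_def)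
    then have "dist (corner k m) x < 2 * diameter ?P"
      using q(3) dist_triangle[of "corner k m" x q] by linarith
    also have "\<dots> = 4 * diameter Q"
      unfolding Q diameter_dyadic_cube powi_neg_pred[symmetric] by simp
    finally have "setdist Q F < 4 * diameter Q"
      using setdist_le_dist[OF z q(2)] by linarith
    moreover have "0 \<le> diameter Q" by (simp add: Q diameter_dyadic_cube)
    ultimately show ?thesis using far by linarith
  qed
  have "\<Union> (whitney_family u v) = - F"
  proof (intro equalityI subsetI)
    fix x :: "real ^ 'n" assume "x \<in> \<Union> (whitney_family u v)"
    then obtain Q where Q: "Q \<in> whitney_family u v" "x \<in> Q" by blast
    then have "0 \<le> diameter Q"
      by (auto simp: whitney_family_def diameter_dyadic_cube)
    then show "x \<in> - F"
      using bounds[OF Q(1)] setdist_le_dist[OF Q(2), of x F] by auto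
  next
    fix x assume "x \<in> - F"
    then obtain k where "selected u v (corner k (cube_index x k)) (2 powi (- k))"
      using ex_selected_level selected_cube_index by blast
    then show "x \<in> \<Union> (whitney_family u v)"
      using mem_dyadic_cube_index unfolding whitney_family_def by blast
  qed
  moreover have "interior Q \<inter> interior Q' = {}"
    if Q: "Q \<in> whitney_family u v" "Q' \<in> whitney_family u v" "Q \<noteq> Q'" for Q Q' :: "(real ^ 'n) set"
  proof (rule ccontr)
    assume "interior Q \<inter> interior Q' \<noteq> {}"
    then obtain x where x: "x \<in> interior Q" "x \<in> interior Q'" by blast
    have level: "\<exists>k. R = dyadic_cube k (cube_index x k) \<and> far_level x k \<and> \<not> far_level x (k - 1)"
      if "R \<in> whitney_family u v" "x \<in> interior R" for R
      using that interior_dyadic_cube_index selected_cube_index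
      unfolding whitney_family_def by fastforce
    obtain k k' where "Q = dyadic_cube k (cube_index x k)" "far_level x k" "\<not> far_level x (k - 1)"
      "Q' = dyadic_cube k' (cube_index x k')" "far_level x k'" "\<not> far_level x (k' - 1)"
      using level Q x by metis
    \<comment> \<open>If one level were smaller, monotonicity would make the level just above the
      other cube far as well, against its selection.\<close>
    moreover from this have "k = k'"
      using far_level_mono[of k "k' - 1" x] far_level_mono[of k' "k - 1" x] by fastforce
    ultimately show False using Q(3) by simp
  qed
  ultimately show ?thesis
    using bounds by (auto simp: CUBE_def whitney_family_def dyadic_cubes_def)
qed

end

lemma dyadic_cube_in_whitney_family:
  "dyadic_cube k m \<in> whitney_family u v \<longleftrightarrow> selected u v (corner k m) (2 powi (- k))"
  unfolding whitney_family_def using dyadic_cube_inject by (auto dest: dyadic_cube_inject)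

section \<open>The search\<close>


text \<open>With the latest input in front, input \<open>i\<close> stands at place
  \<open>t - Suc i\<close>. Values for \<open>i\<close> not below \<open>t\<close> are meaningless;
  the congruence condition in \<open>search_machine\<close> makes the search independent of
  them.\<close>

definition past_u :: "nat \<Rightarrow> nat \<Rightarrow> nat \<Rightarrow> nat" where
  "past_u t h i = pfst (component (t - Suc i) h)"

definition past_v :: "nat \<Rightarrow> nat \<Rightarrow> nat \<Rightarrow> nat" where
  "past_v t h i = psnd (component (t - Suc i) h)"

lemma pr_past:
  assumes "pr t" "pr h" "pr i"
  shows "pr (\<lambda>x. past_u (t x) (h x) (i x))" "pr (\<lambda>x. past_v (t x) (h x) (i x))"
  unfolding past_u_def past_v_def by (intro pr_fst pr_snd pr_component pr_diff pr_Suc assms)+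

text \<open>
  The state of the search is \<open>\<langle>r, \<langle>e, \<langle>t, h\<rangle>\<rangle>\<rangle>\<close> with the last result \<open>r\<close>, the number \<open>e\<close> of letters written,
  the number \<open>t\<close> of stages and the list \<open>h\<close> of the input read, the latest first.
\<close>

lemma search_machine:
  fixes found :: "bool \<Rightarrow> (nat \<Rightarrow> nat) \<Rightarrow> (nat \<Rightarrow> nat) \<Rightarrow> nat \<Rightarrow> nat \<Rightarrow> bool"
  assumes pr_found: "\<And>b. prd (\<lambda>x. found b (past_u (pfst (psnd x)) (psnd (psnd x)))
      (past_v (pfst (psnd x)) (psnd (psnd x))) (pfst x) (pfst (psnd x)))"
    and cong: "\<And>b u v u' v' e t. (\<And>i. i < t \<Longrightarrow> u i = u' i \<and> v i = v' i) \<Longrightarrow>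
      found b u v e t = found b u' v' e t"
  shows "\<exists>M. type2_machine M \<and> num_inputs M = 2 \<and> (\<forall>u v p.
    (\<forall>b e t. found b u v e t \<longrightarrow> p e = (if b then 1 else 0)) \<and>
    (\<forall>e. \<exists>T. \<forall>t\<ge>T. \<exists>b. found b u v e t) \<longrightarrow>
    outputs_sequence M [sequence_tape u, sequence_tape v] p)"
proof -
  define D where "D b x = found b (past_u (pfst (psnd x)) (psnd (psnd x)))
      (past_v (pfst (psnd x)) (psnd (psnd x))) (pfst x) (pfst (psnd x))" for b x
  have D: "prd (D b)" for b unfolding D_def using pr_found .
  \<comment> \<open>The coding of \<open>letter\<close>: 2 for the letter 1, 1 for the letter 0, and
    0 while nothing is found.\<close>
  define r where "r x = (if D True x then 2 else if D False x then 1 else (0::nat))" for x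
  \<comment> \<open>The data for the current search: the counter \<open>e\<close>, the increased
    stage, and the history with the new pair of inputs in front.\<close>
  define new where "new y = ppair (pfst (psnd (pfst y))) (ppair (Suc (pfst (psnd (psnd (pfst y)))))
      (ppair (psnd y) (psnd (psnd (psnd (pfst y))))))" for y
  define f where "f y = ppair (r (new y)) (ppair (pfst (new y) + (if r (new y) = 0 then 0 else 1))
      (psnd (new y)))" for y
  have "pr r" unfolding r_def by (intro pr_if D pr_const)
  moreover have new: "pr new" unfolding new_def
    by (intro pr_pair pr_Suc pr_fst pr_snd pr_id)
  ultimately have rnew: "pr (\<lambda>y. r (new y))" by (rule pr_comp)
  have "pr f" unfolding f_def
    by (intro pr_pair pr_add pr_if prd_eq pr_const pr_fst pr_snd rnew new)
  from computes_stages[OF this] obtain M where M: "type2_machine M" "num_inputs M = 2"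
    and run: "\<And>u v t. \<exists>t'. written (run M [sequence_tape u, sequence_tape v] t') = emitted f u v t"
    by blast
  have "outputs_sequence M [sequence_tape u, sequence_tape v] p"
    if sound: "\<And>b e t. found b u v e t \<Longrightarrow> p e = (if b then 1 else 0)"
      and complete: "\<And>e. \<exists>T. \<forall>t\<ge>T. \<exists>b. found b u v e t" for u v p
  proof -
    define E where "E t = pfst (psnd (stage f u v t))" for t
    define h where "h t = psnd (psnd (psnd (stage f u v t)))" for t
    \<comment> \<open>The step from \<open>t\<close> to \<open>Suc t\<close> has read
      \<open>Suc t\<close> inputs from each tape, so it searches with this bound.\<close>
    define R where "R t = (if found True u v (E t) (Suc t) then 2
        else if found False u v (E t) (Suc t) then 1 else (0::nat))" for t
    have "prod_decode 0 = (0, 0)" by (simp add: prod_decode_def prod_decode_aux.simps)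
    then have inv0: "pfst (psnd (psnd (stage f u v 0))) = 0" "E 0 = 0" by (simp_all add: E_def)
    have inv: "pfst (psnd (psnd (stage f u v t))) = t \<and> (\<forall>i<t. component (t - Suc i) (h t) = ppair (u i) (v i)) \<and>
        stage f u v (Suc t) = ppair (R t) (ppair (E t + (if R t = 0 then 0 else 1))
          (ppair (Suc t) (h (Suc t))))" for t
    proof (induction t)
      case 0
      let ?h = "ppair (ppair (u 0) (v 0)) (h 0)"
      have "D b (ppair (E 0) (ppair (Suc 0) ?h)) = found b u v (E 0) (Suc 0)" for b
        unfolding D_def by (simp, rule cong) (simp add: past_u_def past_v_def)
      then have "r (ppair (E 0) (ppair (Suc 0) ?h)) = R 0" by (simp add: r_def R_def)
      then have "stage f u v (Suc 0) = ppair (R 0) (ppair (E 0 + (if R 0 = 0 then 0 else 1)) (ppair (Suc 0) ?h))"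
        using inv0 by (simp add: f_def new_def E_def h_def del: stage.simps(1))
      moreover from this have "h (Suc 0) = ?h" unfolding h_def[of "Suc 0"] by (simp del: stage.simps)
      ultimately show ?case using inv0 by simp
    next
      case (Suc t)
      let ?s = "stage f u v (Suc t)"
      have s: "?s = ppair (R t) (ppair (E t + (if R t = 0 then 0 else 1)) (ppair (Suc t) (h (Suc t))))"
        using Suc by blast
      have E': "E (Suc t) = E t + (if R t = 0 then 0 else 1)" unfolding E_def[of "Suc t"] s by simp
      have h': "h (Suc t) = ppair (ppair (u t) (v t)) (h t)"
        unfolding h_def by (simp add: f_def new_def)
      have comps: "component (Suc t - Suc i) (h (Suc t)) = ppair (u i) (v i)" if "i < Suc t" for i
      proof (cases "i = t")
        case True
        then show ?thesis by (simp add: h')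
      next
        case False
        then have "Suc t - Suc i = Suc (t - Suc i)" "i < t" using that by auto
        then show ?thesis using Suc by (simp add: h')
      qed
      let ?h = "ppair (ppair (u (Suc t)) (v (Suc t))) (h (Suc t))"
      have comps': "component (Suc (Suc t) - Suc i) ?h = ppair (u i) (v i)" if "i < Suc (Suc t)" for i
      proof (cases "i = Suc t")
        case False
        then have "Suc (Suc t) - Suc i = Suc (Suc t - Suc i)" "i < Suc t" using that by auto
        then show ?thesis using comps by simp
      qed simp
      have "D b (ppair (E (Suc t)) (ppair (Suc (Suc t)) ?h)) = found b u v (E (Suc t)) (Suc (Suc t))" for b
        unfolding D_def by (simp only: prod_encode_inverse fst_conv snd_conv, rule cong)
          (simp only: past_u_def past_v_def comps' prod_encode_inverse fst_conv snd_conv)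
      then have r: "r (ppair (E (Suc t)) (ppair (Suc (Suc t)) ?h)) = R (Suc t)"
        by (simp add: r_def R_def)
      have "new (ppair ?s (ppair (u (Suc t)) (v (Suc t)))) = ppair (E (Suc t)) (ppair (Suc (Suc t)) ?h)"
        unfolding new_def s E' by simp
      then have n: "stage f u v (Suc (Suc t)) = ppair (R (Suc t))
          (ppair (E (Suc t) + (if R (Suc t) = 0 then 0 else 1)) (ppair (Suc (Suc t)) ?h))"
        unfolding stage.simps(2)[of f u v "Suc t"] f_def[of "ppair ?s _"] by (simp only: r prod_encode_inverse fst_conv snd_conv)
      then have "h (Suc (Suc t)) = ?h" unfolding h_def[of "Suc (Suc t)"] by (simp del: stage.simps)
      with n comps s show ?case by (simp del: stage.simps component.simps)
    qed
    have E_Suc: "E (Suc t) = E t + (if R t = 0 then 0 else 1)" for t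
      using inv[of t] unfolding E_def[of "Suc t"] by simp
    have "emitted f u v t = map p [0..<E t]" for t
    proof (induction t)
      case 0
      then show ?case by (simp add: inv0)
    next
      case (Suc t)
      have "pfst (stage f u v (Suc t)) = R t" using inv[of t] by simp
      then have "letter (pfst (stage f u v (Suc t))) = (if R t = 0 then [] else [p (E t)])"
        using sound[of True "E t" "Suc t"] sound[of False "E t" "Suc t"]
        by (simp add: letter_def R_def)
      with Suc show ?case by (simp add: E_Suc del: stage.simps)
    qed
    \<comment> \<open>The counter waits at \<open>n\<close> until a result for \<open>n\<close> is
      found, and from stage \<open>T\<close> on there is one at every stage.\<close>
    moreover have "\<exists>t. n \<le> E t" for n
    proof (induction n)
      case (Suc n)
      then obtain t where t: "n \<le> E t" by blast
      obtain T where T: "\<And>t. T \<le> t \<Longrightarrow> \<exists>b. found b u v n t" using complete by blast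
      have "mono E" by (simp add: mono_iff_le_Suc E_Suc)
      then have n: "n \<le> E (max t T)" using t monoD[of E t "max t T"] by simp
      have "\<exists>b. found b u v n (Suc (max t T))" by (rule T) simp
      then have "R (max t T) \<noteq> 0" if "E (max t T) = n" using that by (auto simp: R_def) (metis (full_types))+
      then have "Suc n \<le> E (Suc (max t T))" using n by (cases "E (max t T) = n") (auto simp: E_Suc)
      then show ?case by blast
    qed simp
    ultimately show ?thesis
      unfolding outputs_sequence_def using run[of u v]
      by (metis add_0 diff_zero length_map length_upt less_eq_Suc_le nth_map nth_upt)
  qed
  then show ?thesis using M by blast
qed

section \<open>The tests are primitive recursive\<close>

lemma prat_divide_real:
  assumes "prat f" "prat g" "\<And>x. 0 < g x"
  shows "prat (\<lambda>x. f x / g x)"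
proof -
  obtain a b d where g: "pr a" "pr b" "pr d"
    "\<And>x. g x = (real (a x) - real (b x)) / real (Suc (d x))" using assms(2) by (elim pratE) blast
  have ba: "b x < a x" for x
    using assms(3)[of x] unfolding g by (simp add: zero_less_divide_iff)
  then have "f x / g x = f x * real (Suc (d x)) / real (a x - b x)" for x
    unfolding g by (simp add: of_nat_diff less_imp_le del: of_nat_Suc)
  moreover have "prat (\<lambda>x. f x * real (Suc (d x)) / real (a x - b x))"
    using ba by (intro prat_divide prat_mult prat_nat assms pr_Suc pr_diff g) simp
  ultimately show ?thesis by simp
qed

lemma prat_sq_gap:
  fixes A X :: "nat \<Rightarrow> real ^ 'n"
  assumes "\<And>i. prat (\<lambda>x. A x $ i)" "prat L" "\<And>i. prat (\<lambda>x. X x $ i)"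
  shows "prat (\<lambda>x. sq_gap (A x) (L x) (X x))"
  unfolding sq_gap_def
  by (intro prat_sum finite prat_power2 prat_max prat_0 prat_diff prat_add assms)

lemma prat_code_center: "pr f \<Longrightarrow> prat (\<lambda>x. (code_center (f x) :: real ^ 'n) $ i)"
  unfolding code_center_def real_vec_def rat_vec_of_code_def vec_lambda_beta
  by (intro prat_rat_of_code pr_component pr_const pr_fst)

lemma prat_code_radius: "pr f \<Longrightarrow> prat (\<lambda>x. code_radius (f x))"
  unfolding code_radius_def by (intro prat_nonneg_rat_of_code pr_snd)

lemma prd_near_test:
  fixes A :: "nat \<Rightarrow> real ^ 'n"
  assumes V: "pr (\<lambda>p. V (pfst p) (psnd p))" and A: "\<And>i. prat (\<lambda>x. A x $ i)" and L: "prat L" and S: "pr S"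
  shows "prd (\<lambda>x. near_test (V x) (A x) (L x) (S x))"
  unfolding near_test_def
  by (intro prd_Ex_less prd_conj prd_le_real prd_less_real prat_mult prat_numeral prat_code_radius V
      prat_comp[OF L] prat_sq_gap prat_comp[OF A] prat_code_center prat_divide_numeral
      prat_const_nat prat_power2 pr_fst pr_id S)

text \<open>Index functions on the coordinates are replaced by codes of tuples. A code below the
  bound may still have large components, so the guard on them remains.\<close>

lemma far_test_iff_bounded:
  fixes a :: "real ^ 'n"
  assumes b: "\<forall>k f. (\<forall>j<CARD('n). f j \<le> k) \<longrightarrow> (\<exists>e<b k. \<forall>j<CARD('n). component j e = f j)"
  defines "J \<equiv> \<lambda>e i. component (to_nat_on (UNIV :: 'n set) i) e"
  shows "far_test u a l s \<longleftrightarrow> (\<forall>e < b ((2 * CARD('n) + 1) * (8 * Suc s)).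
    (\<forall>i\<in>UNIV. J e i \<le> (2 * CARD('n) + 1) * (8 * Suc s)) \<longrightarrow>
    sq_gap a l (grid a l s (J e)) \<le> 25 / 64 * (dim TYPE('n) * l\<^sup>2) \<longrightarrow>
    (\<exists>k<s. dim TYPE('n) * mesh l s < code_radius (u k) \<and>
      sq_dist (grid a l s (J e)) (code_center (u k)) < (code_radius (u k) - dim TYPE('n) * mesh l s)\<^sup>2))"
    (is "?L \<longleftrightarrow> ?R")
proof
  assume ?L
  then show ?R unfolding far_test_def by simp
next
  assume R: ?R
  show ?L
    unfolding far_test_def
  proof (rule allI, rule impI)
    fix j :: "'n \<Rightarrow> nat"
    let ?B = "(2 * CARD('n) + 1) * (8 * Suc s)"
    let ?t = "to_nat_on (UNIV :: 'n set)"
    assume j: "\<forall>i. j i \<le> ?B"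
    have "bij_betw ?t UNIV {..<CARD('n)}" by (rule to_nat_on_finite) simp
    then have t: "?t i < CARD('n)" "inv ?t (?t i) = i" for i by (auto simp: bij_betw_def)
    obtain e where e: "e < b ?B" "\<And>k. k < CARD('n) \<Longrightarrow> component k e = j (inv ?t k)"
      using b[rule_format, of "\<lambda>k. j (inv ?t k)" ?B] j by blast
    have "J e = j" using e(2) t by (simp add: J_def fun_eq_iff)
    with R e(1) j show "sq_gap a l (grid a l s j) \<le> 25 / 64 * (dim TYPE('n) * l\<^sup>2) \<longrightarrow>
        (\<exists>k<s. dim TYPE('n) * mesh l s < code_radius (u k) \<and>
          sq_dist (grid a l s j) (code_center (u k)) < (code_radius (u k) - dim TYPE('n) * mesh l s)\<^sup>2)"
      by metis
  qed
qed

lemma prat_mesh: "prat L \<Longrightarrow> pr S \<Longrightarrow> prat (\<lambda>x. mesh (L x) (S x))"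
  unfolding mesh_def by (intro prat_divide pr_mult pr_const pr_Suc) simp_all

lemma prd_far_test:
  fixes A :: "nat \<Rightarrow> real ^ 'n"
  assumes U: "pr (\<lambda>p. U (pfst p) (psnd p))" and A: "\<And>i. prat (\<lambda>x. A x $ i)" and L: "prat L" and S: "pr S"
  shows "prd (\<lambda>x. far_test (U x) (A x) (L x) (S x))"
proof -
  obtain b where b: "pr b"
    "\<forall>k f. (\<forall>j<CARD('n). f j \<le> k) \<longrightarrow> (\<exists>e<b k. \<forall>j<CARD('n). component j e = f j)"
    using tuple_code_bound[of "CARD('n)"] by blast
  have U': "pr (\<lambda>q. U (pfst (pfst q)) (psnd q))"
    using pr_comp[OF U, of "\<lambda>q. ppair (pfst (pfst q)) (psnd q)"]
    by (simp add: pr_pair pr_fst pr_snd pr_id)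
  show ?thesis
    unfolding far_test_iff_bounded[OF b(2)] sq_dist_def grid_def vec_lambda_beta
    by (intro U' prd_All_less prd_imp prd_Ball_finite finite prd_le pr_component pr_const pr_snd pr_id
        pr_mult pr_Suc pr_comp[OF S] pr_fst prd_le_real prat_sq_gap prat_comp[OF A] prat_comp[OF L]
        prat_divide_numeral prat_mult prat_numeral prat_const_nat prat_power2 prd_Ex_less prd_conj
        prd_less_real prat_mesh prat_code_radius prat_sum prat_diff prat_add prat_nat
        prat_code_center pr_comp[OF b(1)] S | simp only: vec_lambda_beta)+
qed


section \<open>Verdicts from finitely many inputs\<close>

lemma far_test_cong: "(\<And>i. i < s \<Longrightarrow> u i = u' i) \<Longrightarrow> far_test u a l s = far_test u' a l s"
  unfolding far_test_def by (metis (no_types, lifting))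

lemma near_test_cong: "(\<And>i. i < s \<Longrightarrow> v i = v' i) \<Longrightarrow> near_test v a l s = near_test v' a l s"
  unfolding near_test_def by (metis (no_types, lifting))

text \<open>The \<open>LEAST\<close> in \<open>is_far\<close> is an unbounded search; here the stage
  is a candidate, checked by bounded quantifiers.\<close>

definition first_settled where
  "first_settled u v a l s \<longleftrightarrow> settled u v a l s \<and> (\<forall>s'<s. \<not> settled u v a l s')"

lemma first_settled_Least: "first_settled u v a l s \<Longrightarrow> s = (LEAST s. settled u v a l s)"
  unfolding first_settled_def by (metis LeastI Least_le not_less_Least order_le_less)

lemma first_settled_cong:
  assumes "\<And>i. i < s \<Longrightarrow> u i = u' i \<and> v i = v' i"
  shows "first_settled u v a l s = first_settled u' v' a l s"
proof -
  have "settled u v a l s' = settled u' v' a l s'" if "s' \<le> s" for s'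
    using far_test_cong[of s' u u' a l] near_test_cong[of s' v v' a l] assms that
    by (simp add: settled_def)
  then show ?thesis by (simp add: first_settled_def)
qed

definition code_side :: "nat \<Rightarrow> real" where
  "code_side c = 2 powi (- int_decode (pfst c))"

text \<open>A code names the center, whereas the tests work with the lower corner.\<close>

definition code_corner :: "nat \<Rightarrow> real ^ 'n" where
  "code_corner c = (\<chi> i. real_vec (rat_vec_of_code (psnd c)) $ i - code_side c / 2)"

text \<open>
  A point that is not the center of a dyadic cube is not rejected beforehand: both tests make
  sense for every cube, so the divisibility condition only enters the result \<open>b\<close>.
\<close>

definition verdict :: "'n::finite itself \<Rightarrow> bool \<Rightarrow> (nat \<Rightarrow> nat) \<Rightarrow> (nat \<Rightarrow> nat) \<Rightarrow>
    nat \<Rightarrow> nat \<Rightarrow> nat \<Rightarrow> bool" where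
  "verdict _ b u v c s s' \<longleftrightarrow>
    (let l = code_side c; a = code_corner c :: real ^ 'n; a' = parent_corner a l
     in first_settled u v a l s \<and> first_settled u v a' (2 * l) s' \<and>
        ((\<forall>i. a $ i / l \<in> \<int>) \<and> far_test u a l s \<and> \<not> far_test u a' (2 * l) s' \<longleftrightarrow> b))"

lemma code_side_pos: "0 < code_side c"
  by (simp add: code_side_def)

text \<open>The first settled stages are unique, so the stages found by the search are those of
  \<open>is_far\<close>.\<close>

lemma verdict_iff:
  fixes c :: nat
  defines "a \<equiv> code_corner c :: real ^ 'n"
  assumes "verdict TYPE('n) b u v c s s'"
  shows "b \<longleftrightarrow> (\<forall>i. a $ i / code_side c \<in> \<int>) \<and> selected u v a (code_side c)"
  using assms first_settled_Least unfolding verdict_def selected_def is_far_def Let_def by metis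

text \<open>Cubes with arbitrary corners get settled, so the search also ends at codes of points
  that are not centers and the output does not stall there.\<close>

lemma ex_verdict:
  assumes "closed_set_name (F :: (real ^ 'n) set) u v"
  shows "\<exists>b s s'. verdict TYPE('n) b u v c s s'"
proof -
  have "\<exists>s. first_settled u v a l s" if "0 < l" for a :: "real ^ 'n" and l
    using closed_set_name.ex_settled[OF assms that] unfolding first_settled_def
    by (metis LeastI not_less_Least)
  from this[OF code_side_pos] this[of "2 * code_side c"] code_side_pos[of c]
  show ?thesis unfolding verdict_def Let_def by (metis mult_pos_pos zero_less_numeral)
qed

text \<open>A verdict reached at stages below \<open>t\<close> uses only the first \<open>t\<close>
  inputs, as \<open>search_machine\<close> demands.\<close>

lemma verdict_cong:
  fixes T :: "'n::finite itself"
  assumes "\<And>i. i < t \<Longrightarrow> u i = u' i \<and> v i = v' i" "s < t" "s' < t"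
  shows "verdict T b u v c s s' = verdict T b u' v' c s s'"
proof -
  have "first_settled u v a l r = first_settled u' v' a l r \<and> far_test u a l r = far_test u' a l r"
    if "r < t" for a :: "real ^ 'n" and l r
    using that assms(1) first_settled_cong[of r u u' v v' a l] far_test_cong[of r u u' a l] by simp
  then show ?thesis using assms(2,3) unfolding verdict_def Let_def by simp
qed

lemma prat_code_side: "pr f \<Longrightarrow> prat (\<lambda>x. code_side (f x))"
  unfolding code_side_def by (intro prat_powi_int_decode pr_fst)

lemma prat_code_corner: "pr f \<Longrightarrow> prat (\<lambda>x. (code_corner (f x) :: real ^ 'n) $ i)"
  unfolding code_corner_def real_vec_def rat_vec_of_code_def vec_lambda_beta
  by (intro prat_diff prat_divide_numeral prat_rat_of_code prat_code_side pr_component pr_const pr_snd)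

lemma prat_parent_corner:
  fixes A :: "nat \<Rightarrow> real ^ 'n"
  assumes "\<And>i. prat (\<lambda>x. A x $ i)" "prat L" "\<And>x. 0 < L x"
  shows "prat (\<lambda>x. parent_corner (A x) (L x) $ i)"
  unfolding parent_corner_def vec_lambda_beta
  by (intro prat_if prd_Ints prat_divide_real prat_mult prat_numeral prat_diff assms)
    (simp add: assms)

lemma prd_first_settled:
  fixes A :: "nat \<Rightarrow> real ^ 'n"
  assumes U: "pr (\<lambda>p. U (pfst p) (psnd p))" and V: "pr (\<lambda>p. V (pfst p) (psnd p))"
    and A: "\<And>i. prat (\<lambda>x. A x $ i)" and L: "prat L" and S: "pr S"
  shows "prd (\<lambda>x. first_settled (U x) (V x) (A x) (L x) (S x))"
proof -
  have shift: "pr (\<lambda>q. W (pfst (pfst q)) (psnd q))" if "pr (\<lambda>p. W (pfst p) (psnd p))" for W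
    using pr_comp[OF that, of "\<lambda>q. ppair (pfst (pfst q)) (psnd q)"]
    by (simp add: pr_pair pr_fst pr_snd pr_id)
  show ?thesis
    unfolding first_settled_def settled_def
    by (intro prd_conj prd_disj prd_not prd_All_less prd_far_test prd_near_test U V shift[OF U]
        shift[OF V] A L S prat_comp[OF A] prat_comp[OF L] pr_fst pr_snd pr_id)
qed

lemma prd_verdict:
  assumes "pr T" "pr H" "pr C" "pr S" "pr S'"
  shows "prd (\<lambda>x. verdict TYPE('n::finite) b (past_u (T x) (H x)) (past_v (T x) (H x)) (C x) (S x) (S' x))"
proof -
  have U: "pr (\<lambda>p. past_u (T (pfst p)) (H (pfst p)) (psnd p))"
    and V: "pr (\<lambda>p. past_v (T (pfst p)) (H (pfst p)) (psnd p))"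
    by (intro pr_past pr_comp[OF assms(1)] pr_comp[OF assms(2)] pr_fst pr_snd pr_id)+
  have ints: "prd (\<lambda>x. \<forall>i\<in>UNIV. (code_corner (C x) :: real ^ 'n) $ i / code_side (C x) \<in> \<int>)"
    by (intro prd_Ball_finite finite prd_Ints prat_divide_real prat_code_corner prat_code_side
        code_side_pos assms)
  have iff: "prd (\<lambda>x. P x \<longleftrightarrow> b)" if "prd P" for P
    using that prd_not[OF that] by (cases b) simp_all
  show ?thesis
    unfolding verdict_def Let_def
    by (intro prd_conj iff prd_first_settled prd_far_test prd_not U V assms prat_parent_corner
        prat_code_corner prat_code_side prat_mult prat_numeral code_side_pos ints[simplified])
qed

section \<open>Codes of dyadic cubes and computability of CUBE\<close>

lemma real_of_rat_center:
  "real_of_rat ((of_int z + 1 / 2) * 2 powi j) = (of_int z + 1 / 2) * 2 powi j"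
  by (simp add: of_rat_mult of_rat_add of_rat_divide power_int_def of_rat_power of_rat_inverse)

lemma code_corner_dyadic:
  assumes "level_point_of_code c = (k, dyadic_center k m :: rat ^ 'n)"
  shows "code_side c = 2 powi (- k)" "code_corner c = (corner k m :: real ^ 'n)"
proof -
  have k: "int_decode (pfst c) = k" and m: "rat_vec_of_code (psnd c) = (dyadic_center k m :: rat ^ 'n)"
    using assms by (auto simp: level_point_of_code_def split_beta)
  show side: "code_side c = 2 powi (- k)" by (simp add: code_side_def k)
  have "(code_corner c :: real ^ 'n) $ i = corner k m $ i" for i
    unfolding code_corner_def real_vec_def m dyadic_center_def side vec_lambda_beta
      real_of_rat_center by (simp add: corner_def algebra_simps)
  then show "code_corner c = (corner k m :: real ^ 'n)" by (simp add: vec_eq_iff)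
qed

lemma corner_divide_side: "(corner k m :: real ^ 'n) $ i / 2 powi (- k) \<in> \<int>"
  by (simp add: corner_def)

theorem mainTheorem3:
  fixes \<rho> :: "int \<times> (rat ^ 'n) \<Rightarrow> nat"
  assumes "computable_bijection \<rho>"
  shows "\<exists>M. type2_machine M \<and> num_inputs M = 2 \<and>
    (\<forall>(F :: (real ^ 'n) set) u v.
      closed F \<and> F \<noteq> {} \<and> total_information_name F (u, v) \<longrightarrow>
      (\<exists>p \<F>. outputs_sequence M [sequence_tape u, sequence_tape v] p \<and>
        family_name \<rho> \<F> p \<and> \<F> \<in> CUBE F))"
proof -
  let ?point = "level_point_of_code :: nat \<Rightarrow> int \<times> (rat ^ 'n)"
  have bij: "bij \<rho>" and "computable_nat_fun (\<lambda>c. \<rho> (?point c))"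
    using assms by (simp_all add: computable_bijection_def)
  then obtain H where H: "prd (\<lambda>p. H (pfst p) (pfst (psnd p)) (psnd (psnd p)))"
    "\<And>c e t. H c e t \<Longrightarrow> \<rho> (?point c) = e" "\<And>c. \<exists>T. \<forall>t\<ge>T. H c (\<rho> (?point c)) t"
    using computable_nat_fun_simulation by blast
  \<comment> \<open>The inverse of \<open>\<rho>\<close> is found by search: \<open>c\<close> is
    accepted once the simulation confirms that it is sent to \<open>e\<close>. The one bound
    \<open>t\<close> serves for codes, stages and simulated steps.\<close>
  define found where "found b u v e t \<longleftrightarrow>
    (\<exists>c<t. \<exists>s<t. \<exists>s'<t. H c e t \<and> verdict TYPE('n) b u v c s s')" for b u v e t
  have H': "prd (\<lambda>x. H (f x) (g x) (h x))" if "pr f" "pr g" "pr h" for f g h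
    using prd_comp[OF H(1), of "\<lambda>x. ppair (f x) (ppair (g x) (h x))"] that by (simp add: pr_pair)
  have "\<exists>M. type2_machine M \<and> num_inputs M = 2 \<and> (\<forall>u v p.
    (\<forall>b e t. found b u v e t \<longrightarrow> p e = (if b then 1 else 0)) \<and>
    (\<forall>e. \<exists>T. \<forall>t\<ge>T. \<exists>b. found b u v e t) \<longrightarrow>
    outputs_sequence M [sequence_tape u, sequence_tape v] p)"
  proof (rule search_machine)
    show "prd (\<lambda>x. found b (past_u (pfst (psnd x)) (psnd (psnd x)))
      (past_v (pfst (psnd x)) (psnd (psnd x))) (pfst x) (pfst (psnd x)))" for b
      unfolding found_def
      by (intro prd_Ex_less prd_conj H' prd_verdict pr_fst pr_snd pr_id)
    show "found b u v e t = found b u' v' e t"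
      if "\<And>i. i < t \<Longrightarrow> u i = u' i \<and> v i = v' i" for b u v u' v' e t
      unfolding found_def using verdict_cong[of t u u' v v', OF that] by metis
  qed
  then obtain M where M: "type2_machine M" "num_inputs M = 2" "\<And>u v p.
    (\<And>b e t. found b u v e t \<Longrightarrow> p e = (if b then 1 else 0)) \<Longrightarrow>
    (\<And>e. \<exists>T. \<forall>t\<ge>T. \<exists>b. found b u v e t) \<Longrightarrow>
    outputs_sequence M [sequence_tape u, sequence_tape v] p"
    by blast
  have *: "\<exists>p \<F>. outputs_sequence M [sequence_tape u, sequence_tape v] p \<and>
      family_name \<rho> \<F> p \<and> \<F> \<in> CUBE F"
    if F: "closed F" "F \<noteq> {}" "total_information_name F (u, v)"
    for F :: "(real ^ 'n) set" and u v
  proof -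
    interpret closed_set_name F u v by unfold_locales (use F in auto)
    \<comment> \<open>At codes of points that are not centers of dyadic cubes of the given level,
      \<open>family_name\<close> only asks for a value 0 or 1; the value there is 0.\<close>
    define p where "p e = (if \<exists>k m. inv \<rho> e = (k, dyadic_center k m) \<and>
      dyadic_cube k m \<in> (whitney_family u v :: (real ^ 'n) set set) then 1 else (0::nat))" for e
    have center_inject: "m = m'" if "dyadic_center k m = (dyadic_center k m' :: rat ^ 'n)" for k m m'
      using that by (simp add: dyadic_center_def vec_eq_iff)
    have p_center: "p (\<rho> (k, dyadic_center k m)) = 1 \<longleftrightarrow>
        dyadic_cube k m \<in> (whitney_family u v :: (real ^ 'n) set set)" for k m
      using bij center_inject by (auto simp: p_def bij_is_inj)
    have p_verdict: "p (\<rho> (?point c)) = (if b then 1 else 0)" if "verdict TYPE('n) b u v c s s'" for b c s s'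
    proof (cases "\<exists>k m. ?point c = (k, dyadic_center k m)")
      case True
      then obtain k m where km: "?point c = (k, dyadic_center k m)" by blast
      have "b \<longleftrightarrow> dyadic_cube k m \<in> (whitney_family u v :: (real ^ 'n) set set)"
        using verdict_iff[OF that] corner_divide_side[of k m]
        unfolding code_corner_dyadic[OF km] dyadic_cube_in_whitney_family by blast
      moreover have "p (\<rho> (k, dyadic_center k m)) \<in> {0, 1}" by (simp add: p_def)
      ultimately show ?thesis using p_center[of k m] km by (cases b) simp_all
    next
      case False
      \<comment> \<open>Integral quotients would be the index of a dyadic cube with the coded point
        as its center.\<close>
      have "\<not> (\<forall>i. (code_corner c :: real ^ 'n) $ i / code_side c \<in> \<int>)"
      proof
        assume "\<forall>i. (code_corner c :: real ^ 'n) $ i / code_side c \<in> \<int>"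
        then have "\<forall>i. \<exists>z. (code_corner c :: real ^ 'n) $ i / code_side c = of_int z"
          by (auto elim: Ints_cases)
        then obtain z where z: "\<And>i. (code_corner c :: real ^ 'n) $ i / code_side c = of_int (z i)"
          by metis
        let ?k = "int_decode (pfst c)"
        have "real_of_rat (rat_vec_of_code (psnd c) $ i) =
            real_of_rat ((of_int (z i) + 1 / 2) * 2 powi (- ?k))" for i :: 'n
        proof -
          have "(code_corner c :: real ^ 'n) $ i = of_int (z i) * code_side c"
            using z[of i] code_side_pos[of c] by (simp add: field_simps)
          then have "real_of_rat ((rat_vec_of_code (psnd c) :: rat ^ 'n) $ i) =
              (of_int (z i) + 1 / 2) * code_side c"
            by (simp add: code_corner_def real_vec_def algebra_simps)
          then show ?thesis unfolding real_of_rat_center code_side_def .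
        qed
        then have "?point c = (?k, dyadic_center ?k (\<chi> i. z i))"
          by (simp add: level_point_of_code_def split_beta dyadic_center_def vec_eq_iff)
        with False show False by blast
      qed
      with verdict_iff[OF that] have "\<not> b" by blast
      then show ?thesis using False bij by (auto simp: p_def bij_is_inj)
    qed
    have "outputs_sequence M [sequence_tape u, sequence_tape v] p"
    proof (rule M(3))
      show "p e = (if b then 1 else 0)" if "found b u v e t" for b e t
        using that H(2) p_verdict unfolding found_def by blast
      show "\<exists>T. \<forall>t\<ge>T. \<exists>b. found b u v e t" for e
      proof -
        obtain c where c: "\<rho> (?point c) = e"
          using bij surj_level_point_of_code by (metis bij_pointE surjD)
        obtain b s s' where "verdict TYPE('n) b u v c s s'"
          using ex_verdict[OF closed_set_name_axioms] by blast
        moreover obtain T where "\<forall>t\<ge>T. H c e t" using H(3)[of c] c by blast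
        \<comment> \<open>The witnesses do not depend on \<open>t\<close>, so they serve for all
          later stages too.\<close>
        ultimately have "found b u v e t" if "Max {T, Suc c, Suc s, Suc s'} \<le> t" for t
          unfolding found_def using that by (auto simp: Suc_le_eq)
        then show ?thesis by blast
      qed
    qed
    moreover have "family_name \<rho> (whitney_family u v) p"
      unfolding family_name_def using p_center whitney_family_CUBE by (auto simp: p_def CUBE_def)
    ultimately show ?thesis using whitney_family_CUBE by blast
  qed
  show ?thesis
    by (intro exI[of _ M] conjI allI impI M(1,2), elim conjE, rule *)
qed

end
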